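(* Let $A$ be a finite-dimensional vector space, $\circ$ a binary operation on $A$, $\Delta:A\to A\otimes A$ a linear map and $\cdot$ the dual operation of $\Delta$ on $A^*$. Let $\circ_h$ be a $\mathbf{K}$-bilinear operation on $A_h$, $\Delta_h:A_h\to A_h\hat\otimes A_h$ a $\mathbf{K}$-linear map and $\cdot_h$ its topological dual operation on $A_h^\star$. Let $\odot$ on $A\oplus A^*$ and $\odot_h$ on $A_h\oplus A_h^\star$ be the operations $$(x+a^* )\odot(y+b^* )=x\circ y+R_\cdot^*(a^* )y+L_\cdot^*(b^* )x+R_\circ^*(x)b^*+L_\circ^*(y)a^*+a^*\cdot b^*,$$ $$(x_h+a^\star)\odot_h(y_h+b^\star)=x_h\circ_h y_h+R_{\cdot_h}^\star(a^\star)y_h+L_{\cdot_h}^\star(b^\star)x_h+R_{\circ_h}^\star(x_h)b^\star+L_{\circ_h}^\star(y_h)a^\star+a^\star\cdot_h b^\star .$$ (1) Assume that $(A,\circ,\Delta)$ is a commutative and cocommutative ASI bialgebra, $(A_h,\circ_h,\Delta_h)$ is an ASI bialgebra deformation of it and $(A,\{,\},\circ,\delta,\Delta)$ is the QCL. Then $((A_h\oplus A_h^\star,\odot_h),A_h,A_h^\star)$, the standard Manin triple of topologically free associative algebras corresponding to $(A_h,\circ_h,\Delta_h)$, is an associative Manin triple deformation of $((A\oplus A^*,\odot),A,A^* )$, the standard Manin triple of commutative associative algebras corresponding to $(A,\circ,\Delta)$. Moreover, $((A\oplus A^*,\llbracket,\rrbracket,\odot),A,A^* )$, the standard Manin triple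 of Poisson algebras corresponding to $(A,\{,\},\circ,\delta,\Delta)$, coincides with the QCL of $((A_h\oplus A_h^\star,\odot_h),A_h,A_h^\star)$. (2) Assume that $((A_h\oplus A_h^\star,\odot_h),A_h,A_h^\star)$ is an associative Manin triple deformation of a standard Manin triple of commutative associative algebras $((A\oplus A^*,\odot),A,A^* )$ and that the QCL is $((A\oplus A^*,\llbracket,\rrbracket,\odot),A,A^* )$. Then $(A_h,\circ_h,\Delta_h)$, the topologically free ASI bialgebra corresponding to $((A_h\oplus A_h^\star,\odot_h),A_h,A_h^\star)$, is an ASI bialgebra deformation of $(A,\circ,\Delta)$, the commutative and cocommutative ASI bialgebra corresponding to $((A\oplus A^*,\odot),A,A^* )$. Moreover, the Poisson bialgebra corresponding to the standard Manin triple of Poisson algebras $((A\oplus A^*,\llbracket,\rrbracket,\odot),A,A^* )$ coincides with the QCL of $(A_h,\circ_h,\Delta_h)$.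
   Context: Conventions. $\mathbf{k}$ is a field of characteristic $0$, $\mathbf{K}=\mathbf{k}[[h]]$; vector spaces, algebras, tensor products are over $\mathbf{k}$; no units/counits required; binary operations are bilinear. $V_h:=V[[h]]\supset V$; $\equiv\pmod h$ means equality modulo $hV_h$. Topologically free $\mathbf{K}$-module: isomorphic to some $V[[h]]$. $\hat\otimes$ is the $h$-adic completion of $\otimes_{\mathbf{K}}$, so $V_h\hat\otimes W_h\cong(V\otimes W)[[h]]$. $\sigma$, $\sigma_{\mathbf{K}}$ are the flips on $A\otimes A$, $A_h\hat\otimes A_h$. $L_\circ(x)y=x\circ y$, $R_\circ(x)y=y\circ x$, $\mathrm{ad}_{\{,\}}(x)y=\{x,y\}$. Duals. $V^*=\mathrm{Hom}_{\mathbf{k}}(V,\mathbf{k})$ with pairing $\langle,\rangle$. For $\varrho:A\to\mathrm{End}(V)$ linear, $\varrho^*:A\to\mathrm{End}(V^* )$ is $\langle\varrho^*(x)u^*,v\rangle=\langle u^*,\varrho(x)v\rangle$ (no sign). $V_h^\star:=(V^* )_h\cong\mathrm{Hom}_{\mathbf{K}}(V_h,\mathbf{K})$ with the $\mathbf{K}$-bilinear pairing $\langle,\rangle_{\mathbf{K}}$ extending $\langle,\rangle$; for $\varrho_h:A_h\to\mathrm{End}_{\mathbf{K}}(V_h)$, $\langle\varrho_h^\star(x')u^\star,v'\rangle_{\mathbf{K}}=\langle u^\star,\varrho_h(x')v'\rangle_{\mathbf{K}}$. For $A$ finite-dimensional, $A^{**}=A$ and $(A_h^\star)^\star=A_h$.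 Dual operation of $\Delta:A\to A\otimes A$: $\langle a^*\cdot b^*,x\rangle=\langle a^*\otimes b^*,\Delta(x)\rangle$ (similarly $[,]$ for $\delta$). Topological dual operation of $\Delta_h$: $\langle a^\star\cdot_h b^\star,x_h\rangle_{\mathbf{K}}=\langle a^\star\hat\otimes b^\star,\Delta_h(x_h)\rangle_{\mathbf{K}}$. $A_h\oplus A_h^\star$ is identified with $(A\oplus A^* )_h$. ASI bialgebra $(A,\circ,\Delta)$: $\circ$ associative, $\Delta$ coassociative, and for all $x,y$: $\Delta(x\circ y)=(\mathrm{id}\otimes L_\circ(x))\Delta(y)+(R_\circ(y)\otimes\mathrm{id})\Delta(x)$, $(L_\circ(y)\otimes\mathrm{id}-\mathrm{id}\otimes R_\circ(y))\Delta(x)+\sigma\big((L_\circ(x)\otimes\mathrm{id}-\mathrm{id}\otimes R_\circ(x))\Delta(y)\big)=0$; commutative and cocommutative if $\circ$ is commutative and $\Delta=\sigma\Delta$. Topologically free ASI bialgebra $(A_h,\circ_h,\Delta_h)$: $A_h$ topologically free, $\circ_h$ associative $\mathbf{K}$-bilinear, $\Delta_h:A_h\to A_h\hat\otimes A_h$ coassociative $\mathbf{K}$-linear, satisfying the same two identities for all $x_h,y_h\in A_h$ with $\circ_h,\Delta_h,\hat\otimes,\sigma_{\mathbf{K}}$ in place of $\circ,\Delta,\otimes,\sigma$. ASI bialgebra deformation of $(A,\circ,\Delta)$: a topologically free ASI bialgebra with $A_h=A[[h]]$, $x\circ_h y\equiv x\circ y$, $\Delta_h(x)\equiv\Delta(x)\pmod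 h$ for $x,y\in A$. Its QCL, in the commutative and cocommutative case, is $(A,\{,\},\circ,\delta,\Delta)$ with $\{x,y\}\equiv\frac{x\circ_h y-y\circ_h x}{h}$, $\delta(x)\equiv\frac{\Delta_h(x)-\sigma_{\mathbf{K}}\Delta_h(x)}{h}\pmod h$. Associative deformation of an associative algebra $(C,\odot)$: an associative $\mathbf{K}$-bilinear $\odot_h$ on $C_h=C[[h]]$ with $x\odot_h y\equiv x\odot y\pmod h$ on $C$; for $\odot$ commutative its QCL is $(C,\llbracket,\rrbracket,\odot)$ with $\llbracket x,y\rrbracket\equiv\frac{x\odot_h y-y\odot_h x}{h}\pmod h$. Manin triples. $\mathfrak{B}(x+a^*,y+b^* )=\langle a^*,y\rangle+\langle b^*,x\rangle$ on $A\oplus A^*$; $\mathfrak{B}_h(x_h+a^\star,y_h+b^\star)=\langle a^\star,y_h\rangle_{\mathbf{K}}+\langle b^\star,x_h\rangle_{\mathbf{K}}$ on $A_h\oplus A_h^\star$. A form is invariant on an associative algebra if $\mathfrak{B}(x\odot y,z)=\mathfrak{B}(x,y\odot z)$, and on a Poisson algebra if in addition $\mathfrak{B}(\llbracket x,y\rrbracket,z)=\mathfrak{B}(x,\llbracket y,z\rrbracket)$. Standard Manin triple of (commutative) associative algebras $((A\oplus A^*,\odot),A,A^* )$: $\odot$ is (commutative and) associative, $A,A^*$ are subalgebras, $\mathfrak{B}$ is invariant. Standard Manin triple of topologically free associative algebras $((A_h\oplus A_h^\star,\odot_h),A_h,A_h^\star)$: topologically free associative algebra with $A_h,A_h^\star$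 subalgebras and $\mathfrak{B}_h$ invariant. Standard Manin triple of Poisson algebras $((A\oplus A^*,\llbracket,\rrbracket,\odot),A,A^* )$: Poisson algebra with $A,A^*$ Poisson subalgebras and $\mathfrak{B}$ invariant. Associative Manin triple deformation of $((A\oplus A^*,\odot),A,A^* )$: a standard Manin triple of topologically free associative algebras with $(A_h\oplus A_h^\star,\odot_h)$ an associative deformation of $(A\oplus A^*,\odot)$; in the commutative case its QCL is $((A\oplus A^*,\llbracket,\rrbracket,\odot),A,A^* )$ with $(A\oplus A^*,\llbracket,\rrbracket,\odot)$ the QCL of $(A_h\oplus A_h^\star,\odot_h)$. Poisson algebra: Lie bracket $\{,\}$ and commutative associative $\circ$ with $\{x,y\circ z\}=\{x,y\}\circ z+y\circ\{x,z\}$. Lie coalgebra: $\delta=-\sigma\delta$, $(\mathrm{id}+\tau+\tau^2)(\mathrm{id}\otimes\delta)\delta=0$, $\tau(x\otimes y\otimes z)=z\otimes x\otimes y$. Lie bialgebra: Lie algebra and Lie coalgebra with $\delta(\{x,y\})=(\mathrm{ad}(x)\otimes\mathrm{id}+\mathrm{id}\otimes\mathrm{ad}(x))\delta(y)-(\mathrm{ad}(y)\otimes\mathrm{id}+\mathrm{id}\otimes\mathrm{ad}(y))\delta(x)$. Poisson coalgebra $(A,\delta,\Delta)$: Lie coalgebra $\delta$, cocommutative coassociative $\Delta$, $(\mathrm{id}\otimes\Delta)\delta=(\delta\otimes\mathrm{id})\Delta+(\sigma\otimes\mathrm{id})(\mathrm{id}\otimes\delta)\Delta$. Poisson bialgebra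 $(A,\{,\},\circ,\delta,\Delta)$: Poisson algebra $(A,\{,\},\circ)$, Lie bialgebra $(A,\{,\},\delta)$, Poisson coalgebra $(A,\delta,\Delta)$, commutative cocommutative ASI bialgebra $(A,\circ,\Delta)$, with $\delta(x\circ y)=(L_\circ(y)\otimes\mathrm{id})\delta(x)+(L_\circ(x)\otimes\mathrm{id})\delta(y)+(\mathrm{id}\otimes\mathrm{ad}(x))\Delta(y)+(\mathrm{id}\otimes\mathrm{ad}(y))\Delta(x)$ and $\Delta(\{x,y\})=(\mathrm{ad}(x)\otimes\mathrm{id}+\mathrm{id}\otimes\mathrm{ad}(x))\Delta(y)+(L_\circ(y)\otimes\mathrm{id}-\mathrm{id}\otimes L_\circ(y))\delta(x)$. "Corresponding" (for $A$ finite-dimensional): the ASI bialgebra $(A,\circ,\Delta)$ corresponds to $((A\oplus A^*,\odot),A,A^* )$, and $(A_h,\circ_h,\Delta_h)$ corresponds to $((A_h\oplus A_h^\star,\odot_h),A_h,A_h^\star)$, with $\odot,\odot_h$ given by the formulas in the claim. The Poisson bialgebra $(A,\{,\},\circ,\delta,\Delta)$ corresponds to $((A\oplus A^*,\llbracket,\rrbracket,\odot),A,A^* )$ with $\odot$ as in the claim and $\llbracket x+a^*,y+b^*\rrbracket=\{x,y\}+\mathrm{ad}^*_{[,]}(b^* )x-\mathrm{ad}^*_{[,]}(a^* )y+\mathrm{ad}^*_{\{,\}}(y)a^*-\mathrm{ad}^*_{\{,\}}(x)b^*+[a^*,b^*]$, $[,]$ being the dual operation of $\delta$. In each case one side is an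 object of its type if and only if the other is. *)

theory Defs
  imports
    Complex_Main
    "HOL-Computational_Algebra.Formal_Power_Series"
    "HOL-Library.Function_Algebras"
    "HOL-Library.Product_Plus"
begin

section \<open>Tensor products\<close>

definition bilinear_map ::
  "('r::comm_ring_1 \<Rightarrow> 'v::ab_group_add \<Rightarrow> 'v) \<Rightarrow> ('r \<Rightarrow> 'w::ab_group_add \<Rightarrow> 'w) \<Rightarrow>
   ('r \<Rightarrow> 't::ab_group_add \<Rightarrow> 't) \<Rightarrow> ('v \<Rightarrow> 'w \<Rightarrow> 't) \<Rightarrow> bool" where
  "bilinear_map s1 s2 s b \<longleftrightarrow>
     (\<forall>y. module_hom s1 s (\<lambda>x. b x y)) \<and> (\<forall>x. module_hom s2 s (\<lambda>y. b x y))"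

text \<open>A vector space with a bilinear map having the universal property of the tensor product. HOL
  cannot quantify over the type of the target inside a formula, so the property is demanded for
  scalar-valued bilinear maps; over a field this gives it for every target space, as
  \<open>tensor_product_universal\<close> below proves.\<close>
definition tensor_product ::
  "('k::field \<Rightarrow> 'v::ab_group_add \<Rightarrow> 'v) \<Rightarrow> ('k \<Rightarrow> 'w::ab_group_add \<Rightarrow> 'w) \<Rightarrow>
   ('k \<Rightarrow> 't::ab_group_add \<Rightarrow> 't) \<Rightarrow> ('v \<Rightarrow> 'w \<Rightarrow> 't) \<Rightarrow> bool" where
  "tensor_product s1 s2 s t \<longleftrightarrow>
     vector_space s1 \<and> vector_space s2 \<and> vector_space s \<and> bilinear_map s1 s2 s t \<and>
     (\<forall>b. bilinear_map s1 s2 (*) b \<longrightarrow> (\<exists>!f. module_hom s (*) f \<and> (\<forall>x y. f (t x y) = b x y)))"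

text \<open>The data attached to a module \<open>V\<close> over a commutative ring: \<open>V\<close> is the type \<open>'v\<close>, its tensor
  square the type \<open>'t\<close>, its tensor cube the type \<open>'w\<close>, and its dual the subset \<open>dual\<close> of the type
  \<open>'u\<close>. The tensor cube is both \<open>(V \<otimes> V) \<otimes> V\<close>, with canonical map \<open>tensor21\<close>, and
  \<open>V \<otimes> (V \<otimes> V)\<close>, with canonical map \<open>tensor12\<close>.\<close>
record ('r, 'v, 'u, 't, 'w) space =
  smul :: "'r \<Rightarrow> 'v \<Rightarrow> 'v"
  smul2 :: "'r \<Rightarrow> 't \<Rightarrow> 't"
  smul3 :: "'r \<Rightarrow> 'w \<Rightarrow> 'w"
  tensor :: "'v \<Rightarrow> 'v \<Rightarrow> 't"
  tensor21 :: "'t \<Rightarrow> 'v \<Rightarrow> 'w"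
  tensor12 :: "'v \<Rightarrow> 't \<Rightarrow> 'w"
  dual :: "'u set"
  dsmul :: "'r \<Rightarrow> 'u \<Rightarrow> 'u"
  pairing :: "'u \<Rightarrow> 'v \<Rightarrow> 'r"

definition fin_dim_space ::
  "('k::field, 'a::ab_group_add, 'a \<Rightarrow> 'k, 't::ab_group_add, 'w::ab_group_add) space \<Rightarrow> bool" where
  "fin_dim_space M \<longleftrightarrow>
     (\<exists>B. finite_dimensional_vector_space (smul M) B) \<and>
     tensor_product (smul M) (smul M) (smul2 M) (tensor M) \<and>
     tensor_product (smul2 M) (smul M) (smul3 M) (tensor21 M) \<and>
     tensor_product (smul M) (smul2 M) (smul3 M) (tensor12 M) \<and>
     (\<forall>x y z. tensor21 M (tensor M x y) z = tensor12 M x (tensor M y z)) \<and>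
     dual M = {f. module_hom (smul M) (*) f} \<and>
     dsmul M = (\<lambda>c f x. c * f x) \<and>
     pairing M = (\<lambda>f x. f x)"

text \<open>The linear map \<open>f \<otimes> g\<close> from the tensor product \<open>(s, t)\<close> to the tensor product \<open>(s', t')\<close>.\<close>
definition tensor_map ::
  "('r::comm_ring_1 \<Rightarrow> 't::ab_group_add \<Rightarrow> 't) \<Rightarrow> ('v \<Rightarrow> 'w \<Rightarrow> 't) \<Rightarrow>
   ('r \<Rightarrow> 't2::ab_group_add \<Rightarrow> 't2) \<Rightarrow> ('v2 \<Rightarrow> 'w2 \<Rightarrow> 't2) \<Rightarrow>
   ('v \<Rightarrow> 'v2) \<Rightarrow> ('w \<Rightarrow> 'w2) \<Rightarrow> 't \<Rightarrow> 't2" where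
  "tensor_map s t s' t' f g = (THE F. module_hom s s' F \<and> (\<forall>x y. F (t x y) = t' (f x) (g y)))"

definition tmap ::
  "('r::comm_ring_1, 'v, 'u, 't::ab_group_add, 'w) space \<Rightarrow> ('v \<Rightarrow> 'v) \<Rightarrow> ('v \<Rightarrow> 'v) \<Rightarrow> 't \<Rightarrow> 't" where
  "tmap M = tensor_map (smul2 M) (tensor M) (smul2 M) (tensor M)"

text \<open>The flip \<open>\<sigma>\<close>.\<close>
definition flip :: "('r::comm_ring_1, 'v, 'u, 't::ab_group_add, 'w) space \<Rightarrow> 't \<Rightarrow> 't" where
  "flip M = (THE F. module_hom (smul2 M) (smul2 M) F \<and> (\<forall>x y. F (tensor M x y) = tensor M y x))"

text \<open>The cyclic permutation \<open>\<tau>\<close>.\<close>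
definition cyc ::
  "('r::comm_ring_1, 'v, 'u, 't, 'w::ab_group_add) space \<Rightarrow> 'w \<Rightarrow> 'w" where
  "cyc M = (THE F. module_hom (smul3 M) (smul3 M) F \<and>
     (\<forall>x y z. F (tensor21 M (tensor M x y) z) = tensor21 M (tensor M z x) y))"

definition cop_id ::
  "('r::comm_ring_1, 'v, 'u, 't::ab_group_add, 'w::ab_group_add) space \<Rightarrow> ('v \<Rightarrow> 't) \<Rightarrow> 't \<Rightarrow> 'w" where
  "cop_id M D = tensor_map (smul2 M) (tensor M) (smul3 M) (tensor21 M) D id"

definition id_cop ::
  "('r::comm_ring_1, 'v, 'u, 't::ab_group_add, 'w::ab_group_add) space \<Rightarrow> ('v \<Rightarrow> 't) \<Rightarrow> 't \<Rightarrow> 'w" where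
  "id_cop M D = tensor_map (smul2 M) (tensor M) (smul3 M) (tensor12 M) id D"

definition flip_id ::
  "('r::comm_ring_1, 'v, 'u, 't::ab_group_add, 'w::ab_group_add) space \<Rightarrow> 'w \<Rightarrow> 'w" where
  "flip_id M = tensor_map (smul3 M) (tensor21 M) (smul3 M) (tensor21 M) (flip M) id"


section \<open>Power series with coefficients in a vector space\<close>

text \<open>The type \<open>'v fps\<close> is \<open>V[[h]]\<close>, with \<open>h = fps_X\<close> in \<open>k[[h]]\<close> and \<open>fps_const\<close> the inclusion
  of \<open>V\<close>. The next function extends a bilinear map to power series by the Cauchy product.\<close>
definition series_ext :: "('a \<Rightarrow> 'b \<Rightarrow> 'c::comm_monoid_add) \<Rightarrow> 'a fps \<Rightarrow> 'b fps \<Rightarrow> 'c fps" where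
  "series_ext b u v = Abs_fps (\<lambda>n. \<Sum>i=0..n. b (fps_nth u i) (fps_nth v (n - i)))"

definition series_on :: "'c set \<Rightarrow> 'c fps set" where
  "series_on C = {u. \<forall>n. fps_nth u n \<in> C}"

text \<open>The topologically free module \<open>V[[h]]\<close>: its completed tensor square and cube are
  \<open>(V \<otimes> V)[[h]]\<close> and \<open>(V \<otimes> V \<otimes> V)[[h]]\<close>, its dual is \<open>V\<^sup>*[[h]]\<close>.\<close>
definition series_space ::
  "('k::comm_ring_1, 'a::ab_group_add, 'u::ab_group_add, 't::ab_group_add, 'w::ab_group_add) space \<Rightarrow>
   ('k fps, 'a fps, 'u fps, 't fps, 'w fps) space" where
  "series_space M = \<lparr>
     smul = series_ext (smul M),
     smul2 = series_ext (smul2 M),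
     smul3 = series_ext (smul3 M),
     tensor = series_ext (tensor M),
     tensor21 = series_ext (tensor21 M),
     tensor12 = series_ext (tensor12 M),
     dual = series_on (dual M),
     dsmul = series_ext (dsmul M),
     pairing = series_ext (pairing M)\<rparr>"

text \<open>Congruence modulo \<open>h C[[h]]\<close>, for a subspace \<open>C\<close> of the vector space with scalar
  multiplication \<open>s\<close>.\<close>
definition cong_h ::
  "('k::comm_ring_1 \<Rightarrow> 'c::ab_group_add \<Rightarrow> 'c) \<Rightarrow> 'c set \<Rightarrow> 'c fps \<Rightarrow> 'c fps \<Rightarrow> bool" where
  "cong_h s C u v \<longleftrightarrow> (\<exists>w\<in>series_on C. u - v = series_ext s fps_X w)"

text \<open>\<open>u\<close> is divisible by \<open>h\<close> in \<open>C[[h]]\<close>, and \<open>v \<equiv> u / h\<close> modulo \<open>h\<close>.\<close>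
definition cong_quot_h ::
  "('k::comm_ring_1 \<Rightarrow> 'c::ab_group_add \<Rightarrow> 'c) \<Rightarrow> 'c set \<Rightarrow> 'c fps \<Rightarrow> 'c fps \<Rightarrow> bool" where
  "cong_quot_h s C v u \<longleftrightarrow> (\<exists>q\<in>series_on C. u = series_ext s fps_X q \<and> cong_h s C v q)"


section \<open>Algebras\<close>

text \<open>Algebra structures live on a submodule \<open>C\<close> of a type; this is needed because the dual space
  is not a whole type.\<close>

definition bilinear_op_on ::
  "('r::comm_ring_1 \<Rightarrow> 'c::ab_group_add \<Rightarrow> 'c) \<Rightarrow> 'c set \<Rightarrow> ('c \<Rightarrow> 'c \<Rightarrow> 'c) \<Rightarrow> bool" where
  "bilinear_op_on s C m \<longleftrightarrow> module s \<and> module.subspace s C \<and>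
     (\<forall>x\<in>C. \<forall>y\<in>C. m x y \<in> C) \<and>
     (\<forall>x\<in>C. \<forall>y\<in>C. \<forall>z\<in>C. m (x + y) z = m x z + m y z \<and> m z (x + y) = m z x + m z y) \<and>
     (\<forall>c. \<forall>x\<in>C. \<forall>y\<in>C. m (s c x) y = s c (m x y) \<and> m x (s c y) = s c (m x y))"

definition assoc_algebra_on ::
  "('r::comm_ring_1 \<Rightarrow> 'c::ab_group_add \<Rightarrow> 'c) \<Rightarrow> 'c set \<Rightarrow> ('c \<Rightarrow> 'c \<Rightarrow> 'c) \<Rightarrow> bool" where
  "assoc_algebra_on s C m \<longleftrightarrow> bilinear_op_on s C m \<and>
     (\<forall>x\<in>C. \<forall>y\<in>C. \<forall>z\<in>C. m (m x y) z = m x (m y z))"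

definition commutative_on :: "'c set \<Rightarrow> ('c \<Rightarrow> 'c \<Rightarrow> 'c) \<Rightarrow> bool" where
  "commutative_on C m \<longleftrightarrow> (\<forall>x\<in>C. \<forall>y\<in>C. m x y = m y x)"

definition lie_algebra_on ::
  "('r::comm_ring_1 \<Rightarrow> 'c::ab_group_add \<Rightarrow> 'c) \<Rightarrow> 'c set \<Rightarrow> ('c \<Rightarrow> 'c \<Rightarrow> 'c) \<Rightarrow> bool" where
  "lie_algebra_on s C br \<longleftrightarrow> bilinear_op_on s C br \<and>
     (\<forall>x\<in>C. br x x = 0) \<and>
     (\<forall>x\<in>C. \<forall>y\<in>C. \<forall>z\<in>C. br x (br y z) + br y (br z x) + br z (br x y) = 0)"

definition poisson_algebra_on ::
  "('r::comm_ring_1 \<Rightarrow> 'c::ab_group_add \<Rightarrow> 'c) \<Rightarrow> 'c set \<Rightarrow>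
   ('c \<Rightarrow> 'c \<Rightarrow> 'c) \<Rightarrow> ('c \<Rightarrow> 'c \<Rightarrow> 'c) \<Rightarrow> bool" where
  "poisson_algebra_on s C br m \<longleftrightarrow>
     lie_algebra_on s C br \<and> assoc_algebra_on s C m \<and> commutative_on C m \<and>
     (\<forall>x\<in>C. \<forall>y\<in>C. \<forall>z\<in>C. br x (m y z) = m (br x y) z + m y (br x z))"

definition subalgebra_on ::
  "('r::comm_ring_1 \<Rightarrow> 'c::ab_group_add \<Rightarrow> 'c) \<Rightarrow> 'c set \<Rightarrow> ('c \<Rightarrow> 'c \<Rightarrow> 'c) \<Rightarrow> 'c set \<Rightarrow> bool" where
  "subalgebra_on s C m S \<longleftrightarrow> module.subspace s S \<and> S \<subseteq> C \<and> (\<forall>x\<in>S. \<forall>y\<in>S. m x y \<in> S)"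

text \<open>\<open>m_h\<close> is an associative deformation, on \<open>C[[h]]\<close>, of the associative algebra \<open>(C, m)\<close>.\<close>
definition assoc_deformation ::
  "('k::comm_ring_1 \<Rightarrow> 'c::ab_group_add \<Rightarrow> 'c) \<Rightarrow> 'c set \<Rightarrow> ('c \<Rightarrow> 'c \<Rightarrow> 'c) \<Rightarrow>
   ('c fps \<Rightarrow> 'c fps \<Rightarrow> 'c fps) \<Rightarrow> bool" where
  "assoc_deformation s C m m_h \<longleftrightarrow>
     assoc_algebra_on s C m \<and> assoc_algebra_on (series_ext s) (series_on C) m_h \<and>
     (\<forall>x\<in>C. \<forall>y\<in>C. cong_h s C (m_h (fps_const x) (fps_const y)) (fps_const (m x y)))"

text \<open>\<open>br\<close> is the bracket of the quasiclassical limit of \<open>m_h\<close>.\<close>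
definition qcl_bracket ::
  "('k::comm_ring_1 \<Rightarrow> 'c::ab_group_add \<Rightarrow> 'c) \<Rightarrow> 'c set \<Rightarrow>
   ('c fps \<Rightarrow> 'c fps \<Rightarrow> 'c fps) \<Rightarrow> ('c \<Rightarrow> 'c \<Rightarrow> 'c) \<Rightarrow> bool" where
  "qcl_bracket s C m_h br \<longleftrightarrow>
     (\<forall>x\<in>C. \<forall>y\<in>C. cong_quot_h s C (fps_const (br x y))
        (m_h (fps_const x) (fps_const y) - m_h (fps_const y) (fps_const x)))"


section \<open>Bialgebras\<close>

abbreviation (input) lmul :: "('a \<Rightarrow> 'a \<Rightarrow> 'a) \<Rightarrow> 'a \<Rightarrow> 'a \<Rightarrow> 'a" where
  "lmul m x \<equiv> (\<lambda>y. m x y)"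

abbreviation (input) rmul :: "('a \<Rightarrow> 'a \<Rightarrow> 'a) \<Rightarrow> 'a \<Rightarrow> 'a \<Rightarrow> 'a" where
  "rmul m x \<equiv> (\<lambda>y. m y x)"

definition coassociative ::
  "('r::comm_ring_1, 'v::ab_group_add, 'u, 't::ab_group_add, 'w::ab_group_add) space \<Rightarrow>
   ('v \<Rightarrow> 't) \<Rightarrow> bool" where
  "coassociative M D \<longleftrightarrow> module_hom (smul M) (smul2 M) D \<and>
     (\<forall>x. cop_id M D (D x) = id_cop M D (D x))"

definition cocommutative ::
  "('r::comm_ring_1, 'v::ab_group_add, 'u, 't::ab_group_add, 'w) space \<Rightarrow> ('v \<Rightarrow> 't) \<Rightarrow> bool" where
  "cocommutative M D \<longleftrightarrow> (\<forall>x. D x = flip M (D x))"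

text \<open>For \<open>M\<close> of the form \<open>series_space N\<close> this is the notion of a topologically free ASI bialgebra.\<close>
definition asi_bialgebra ::
  "('r::comm_ring_1, 'v::ab_group_add, 'u, 't::ab_group_add, 'w::ab_group_add) space \<Rightarrow>
   ('v \<Rightarrow> 'v \<Rightarrow> 'v) \<Rightarrow> ('v \<Rightarrow> 't) \<Rightarrow> bool" where
  "asi_bialgebra M m D \<longleftrightarrow>
     assoc_algebra_on (smul M) UNIV m \<and> coassociative M D \<and>
     (\<forall>x y. D (m x y) = tmap M id (lmul m x) (D y) + tmap M (rmul m y) id (D x)) \<and>
     (\<forall>x y. (tmap M (lmul m y) id (D x) - tmap M id (rmul m y) (D x))
        + flip M (tmap M (lmul m x) id (D y) - tmap M id (rmul m x) (D y)) = 0)"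

definition comm_cocomm_asi_bialgebra ::
  "('r::comm_ring_1, 'v::ab_group_add, 'u, 't::ab_group_add, 'w::ab_group_add) space \<Rightarrow>
   ('v \<Rightarrow> 'v \<Rightarrow> 'v) \<Rightarrow> ('v \<Rightarrow> 't) \<Rightarrow> bool" where
  "comm_cocomm_asi_bialgebra M m D \<longleftrightarrow>
     asi_bialgebra M m D \<and> commutative_on UNIV m \<and> cocommutative M D"

definition asi_deformation ::
  "('k::comm_ring_1, 'v::ab_group_add, 'u::ab_group_add, 't::ab_group_add, 'w::ab_group_add) space \<Rightarrow>
   ('v \<Rightarrow> 'v \<Rightarrow> 'v) \<Rightarrow> ('v \<Rightarrow> 't) \<Rightarrow> ('v fps \<Rightarrow> 'v fps \<Rightarrow> 'v fps) \<Rightarrow> ('v fps \<Rightarrow> 't fps) \<Rightarrow> bool" where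
  "asi_deformation M m D m_h D_h \<longleftrightarrow>
     asi_bialgebra M m D \<and> asi_bialgebra (series_space M) m_h D_h \<and>
     (\<forall>x y. cong_h (smul M) UNIV (m_h (fps_const x) (fps_const y)) (fps_const (m x y))) \<and>
     (\<forall>x. cong_h (smul2 M) UNIV (D_h (fps_const x)) (fps_const (D x)))"

text \<open>\<open>(br, d)\<close> are the bracket and cobracket of the quasiclassical limit of \<open>(m_h, D_h)\<close>.\<close>
definition asi_qcl ::
  "('k::comm_ring_1, 'v::ab_group_add, 'u::ab_group_add, 't::ab_group_add, 'w::ab_group_add) space \<Rightarrow>
   ('v fps \<Rightarrow> 'v fps \<Rightarrow> 'v fps) \<Rightarrow> ('v fps \<Rightarrow> 't fps) \<Rightarrow> ('v \<Rightarrow> 'v \<Rightarrow> 'v) \<Rightarrow> ('v \<Rightarrow> 't) \<Rightarrow> bool" where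
  "asi_qcl M m_h D_h br d \<longleftrightarrow>
     qcl_bracket (smul M) UNIV m_h br \<and>
     (\<forall>x. cong_quot_h (smul2 M) UNIV (fps_const (d x))
        (D_h (fps_const x) - flip (series_space M) (D_h (fps_const x))))"

definition lie_coalgebra ::
  "('r::comm_ring_1, 'v::ab_group_add, 'u, 't::ab_group_add, 'w::ab_group_add) space \<Rightarrow>
   ('v \<Rightarrow> 't) \<Rightarrow> bool" where
  "lie_coalgebra M d \<longleftrightarrow> module_hom (smul M) (smul2 M) d \<and>
     (\<forall>x. d x = - flip M (d x)) \<and>
     (\<forall>x. id_cop M d (d x) + cyc M (id_cop M d (d x)) + cyc M (cyc M (id_cop M d (d x))) = 0)"

definition lie_bialgebra ::
  "('r::comm_ring_1, 'v::ab_group_add, 'u, 't::ab_group_add, 'w::ab_group_add) space \<Rightarrow>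
   ('v \<Rightarrow> 'v \<Rightarrow> 'v) \<Rightarrow> ('v \<Rightarrow> 't) \<Rightarrow> bool" where
  "lie_bialgebra M br d \<longleftrightarrow> lie_algebra_on (smul M) UNIV br \<and> lie_coalgebra M d \<and>
     (\<forall>x y. d (br x y) =
        (tmap M (lmul br x) id (d y) + tmap M id (lmul br x) (d y))
        - (tmap M (lmul br y) id (d x) + tmap M id (lmul br y) (d x)))"

definition poisson_coalgebra ::
  "('r::comm_ring_1, 'v::ab_group_add, 'u, 't::ab_group_add, 'w::ab_group_add) space \<Rightarrow>
   ('v \<Rightarrow> 't) \<Rightarrow> ('v \<Rightarrow> 't) \<Rightarrow> bool" where
  "poisson_coalgebra M d D \<longleftrightarrow>
     lie_coalgebra M d \<and> coassociative M D \<and> cocommutative M D \<and>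
     (\<forall>x. id_cop M D (d x) = cop_id M d (D x) + flip_id M (id_cop M d (D x)))"

definition poisson_bialgebra ::
  "('r::comm_ring_1, 'v::ab_group_add, 'u, 't::ab_group_add, 'w::ab_group_add) space \<Rightarrow>
   ('v \<Rightarrow> 'v \<Rightarrow> 'v) \<Rightarrow> ('v \<Rightarrow> 'v \<Rightarrow> 'v) \<Rightarrow> ('v \<Rightarrow> 't) \<Rightarrow> ('v \<Rightarrow> 't) \<Rightarrow> bool" where
  "poisson_bialgebra M br m d D \<longleftrightarrow>
     poisson_algebra_on (smul M) UNIV br m \<and> lie_bialgebra M br d \<and> poisson_coalgebra M d D \<and>
     comm_cocomm_asi_bialgebra M m D \<and>
     (\<forall>x y. d (m x y) =
        tmap M (lmul m y) id (d x) + tmap M (lmul m x) id (d y)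
        + tmap M id (lmul br x) (D y) + tmap M id (lmul br y) (D x)) \<and>
     (\<forall>x y. D (br x y) =
        (tmap M (lmul br x) id (D y) + tmap M id (lmul br x) (D y))
        + (tmap M (lmul m y) id (d x) - tmap M id (lmul m y) (d x)))"


section \<open>Duality and the operations on the double\<close>

text \<open>The transpose of an endomorphism \<open>f\<close> of \<open>V\<close>, acting on the dual; \<open>\<rho>\<^sup>*(x)\<close> is
  \<open>transp M (\<rho> x)\<close>.\<close>
definition transp :: "('r, 'v, 'u, 't, 'w) space \<Rightarrow> ('v \<Rightarrow> 'v) \<Rightarrow> 'u \<Rightarrow> 'u" where
  "transp M f a = (THE b. b \<in> dual M \<and> (\<forall>x. pairing M b x = pairing M a (f x)))"

text \<open>The transpose of an endomorphism \<open>f\<close> of the dual, acting on \<open>V\<close> as the bidual.\<close>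
definition transp_bidual :: "('r, 'v, 'u, 't, 'w) space \<Rightarrow> ('u \<Rightarrow> 'u) \<Rightarrow> 'v \<Rightarrow> 'v" where
  "transp_bidual M f x = (THE y. \<forall>a\<in>dual M. pairing M a y = pairing M (f a) x)"

text \<open>The (topological) dual operation of \<open>D\<close>. The ring itself is the target tensor product in
  \<open>tensor_map\<close>, so that this is the functional \<open>x \<otimes> y \<mapsto> \<langle>a, x\<rangle> \<langle>b, y\<rangle>\<close>.\<close>
definition dual_op ::
  "('r::comm_ring_1, 'v, 'u, 't::ab_group_add, 'w) space \<Rightarrow> ('v \<Rightarrow> 't) \<Rightarrow> 'u \<Rightarrow> 'u \<Rightarrow> 'u" where
  "dual_op M D a b = (THE c. c \<in> dual M \<and>
     (\<forall>x. pairing M c x = tensor_map (smul2 M) (tensor M) (*) (*) (pairing M a) (pairing M b) (D x)))"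

definition double :: "('r, 'v, 'u, 't, 'w) space \<Rightarrow> ('v \<times> 'u) set" where
  "double M = UNIV \<times> dual M"

definition double_smul :: "('r, 'v, 'u, 't, 'w) space \<Rightarrow> 'r \<Rightarrow> 'v \<times> 'u \<Rightarrow> 'v \<times> 'u" where
  "double_smul M c = (\<lambda>(x, a). (smul M c x, dsmul M c a))"

definition double_form ::
  "('r::comm_ring_1, 'v, 'u, 't, 'w) space \<Rightarrow> 'v \<times> 'u \<Rightarrow> 'v \<times> 'u \<Rightarrow> 'r" where
  "double_form M = (\<lambda>(x, a) (y, b). pairing M a y + pairing M b x)"

text \<open>The product \<open>\<odot>\<close> (respectively \<open>\<odot>\<^sub>h\<close>) built from \<open>m\<close> and \<open>D\<close>.\<close>
definition double_prod ::
  "('r::comm_ring_1, 'v::ab_group_add, 'u::ab_group_add, 't::ab_group_add, 'w) space \<Rightarrow>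
   ('v \<Rightarrow> 'v \<Rightarrow> 'v) \<Rightarrow> ('v \<Rightarrow> 't) \<Rightarrow> 'v \<times> 'u \<Rightarrow> 'v \<times> 'u \<Rightarrow> 'v \<times> 'u" where
  "double_prod M m D = (\<lambda>(x, a) (y, b). let n = dual_op M D in
     (m x y + transp_bidual M (rmul n a) y + transp_bidual M (lmul n b) x,
      transp M (rmul m x) b + transp M (lmul m y) a + n a b))"

text \<open>The bracket on the double built from \<open>br\<close> and \<open>d\<close>.\<close>
definition double_bracket ::
  "('r::comm_ring_1, 'v::ab_group_add, 'u::ab_group_add, 't::ab_group_add, 'w) space \<Rightarrow>
   ('v \<Rightarrow> 'v \<Rightarrow> 'v) \<Rightarrow> ('v \<Rightarrow> 't) \<Rightarrow> 'v \<times> 'u \<Rightarrow> 'v \<times> 'u \<Rightarrow> 'v \<times> 'u" where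
  "double_bracket M br d = (\<lambda>(x, a) (y, b). let n = dual_op M d in
     (br x y + transp_bidual M (lmul n b) x - transp_bidual M (lmul n a) y,
      transp M (lmul br y) a - transp M (lmul br x) b + n a b))"


section \<open>Manin triples\<close>

definition invariant_on :: "'c set \<Rightarrow> ('c \<Rightarrow> 'c \<Rightarrow> 'r) \<Rightarrow> ('c \<Rightarrow> 'c \<Rightarrow> 'c) \<Rightarrow> bool" where
  "invariant_on C B m \<longleftrightarrow> (\<forall>u\<in>C. \<forall>v\<in>C. \<forall>w\<in>C. B (m u v) w = B u (m v w))"

text \<open>For \<open>M\<close> of the form \<open>series_space N\<close> this is the notion of a standard Manin triple of
  topologically free associative algebras.\<close>
definition assoc_manin_triple ::
  "('r::comm_ring_1, 'v::ab_group_add, 'u::ab_group_add, 't, 'w) space \<Rightarrow>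
   ('v \<times> 'u \<Rightarrow> 'v \<times> 'u \<Rightarrow> 'v \<times> 'u) \<Rightarrow> bool" where
  "assoc_manin_triple M p \<longleftrightarrow>
     assoc_algebra_on (double_smul M) (double M) p \<and>
     subalgebra_on (double_smul M) (double M) p (UNIV \<times> {0}) \<and>
     subalgebra_on (double_smul M) (double M) p ({0} \<times> dual M) \<and>
     invariant_on (double M) (double_form M) p"

definition comm_assoc_manin_triple ::
  "('r::comm_ring_1, 'v::ab_group_add, 'u::ab_group_add, 't, 'w) space \<Rightarrow>
   ('v \<times> 'u \<Rightarrow> 'v \<times> 'u \<Rightarrow> 'v \<times> 'u) \<Rightarrow> bool" where
  "comm_assoc_manin_triple M p \<longleftrightarrow> assoc_manin_triple M p \<and> commutative_on (double M) p"

definition poisson_manin_triple ::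
  "('r::comm_ring_1, 'v::ab_group_add, 'u::ab_group_add, 't, 'w) space \<Rightarrow>
   ('v \<times> 'u \<Rightarrow> 'v \<times> 'u \<Rightarrow> 'v \<times> 'u) \<Rightarrow> ('v \<times> 'u \<Rightarrow> 'v \<times> 'u \<Rightarrow> 'v \<times> 'u) \<Rightarrow> bool" where
  "poisson_manin_triple M lbr p \<longleftrightarrow>
     poisson_algebra_on (double_smul M) (double M) lbr p \<and>
     (\<forall>S\<in>{UNIV \<times> {0}, {0} \<times> dual M}.
        subalgebra_on (double_smul M) (double M) p S \<and>
        subalgebra_on (double_smul M) (double M) lbr S) \<and>
     invariant_on (double M) (double_form M) p \<and>
     invariant_on (double M) (double_form M) lbr"

text \<open>The identification of \<open>A[[h]] \<oplus> A\<^sup>*[[h]]\<close> with \<open>(A \<oplus> A\<^sup>*)[[h]]\<close>, used to transport an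
  operation from the former to the latter.\<close>

definition series_pair :: "'a fps \<times> 'b fps \<Rightarrow> ('a \<times> 'b) fps" where
  "series_pair = (\<lambda>(u, v). Abs_fps (\<lambda>n. (fps_nth u n, fps_nth v n)))"

definition series_unpair :: "('a \<times> 'b) fps \<Rightarrow> 'a fps \<times> 'b fps" where
  "series_unpair w = (Abs_fps (\<lambda>n. fst (fps_nth w n)), Abs_fps (\<lambda>n. snd (fps_nth w n)))"

definition series_pair_op ::
  "('a fps \<times> 'b fps \<Rightarrow> 'a fps \<times> 'b fps \<Rightarrow> 'a fps \<times> 'b fps) \<Rightarrow>
   ('a \<times> 'b) fps \<Rightarrow> ('a \<times> 'b) fps \<Rightarrow> ('a \<times> 'b) fps" where
  "series_pair_op p u v = series_pair (p (series_unpair u) (series_unpair v))"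

definition assoc_manin_deformation ::
  "('k::comm_ring_1, 'v::ab_group_add, 'u::ab_group_add, 't::ab_group_add, 'w::ab_group_add) space \<Rightarrow>
   ('v \<times> 'u \<Rightarrow> 'v \<times> 'u \<Rightarrow> 'v \<times> 'u) \<Rightarrow>
   ('v fps \<times> 'u fps \<Rightarrow> 'v fps \<times> 'u fps \<Rightarrow> 'v fps \<times> 'u fps) \<Rightarrow> bool" where
  "assoc_manin_deformation M p p_h \<longleftrightarrow>
     assoc_manin_triple M p \<and> assoc_manin_triple (series_space M) p_h \<and>
     assoc_deformation (double_smul M) (double M) p (series_pair_op p_h)"

text \<open>\<open>lbr\<close> is the bracket of the quasiclassical limit of the Manin triple deformation \<open>p_h\<close>.\<close>
definition manin_qcl ::
  "('k::comm_ring_1, 'v::ab_group_add, 'u::ab_group_add, 't::ab_group_add, 'w::ab_group_add) space \<Rightarrow>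
   ('v fps \<times> 'u fps \<Rightarrow> 'v fps \<times> 'u fps \<Rightarrow> 'v fps \<times> 'u fps) \<Rightarrow>
   ('v \<times> 'u \<Rightarrow> 'v \<times> 'u \<Rightarrow> 'v \<times> 'u) \<Rightarrow> bool" where
  "manin_qcl M p_h lbr \<longleftrightarrow> qcl_bracket (double_smul M) (double M) (series_pair_op p_h) lbr"

text \<open>The Poisson bialgebra with bracket \<open>br\<close> and cobracket \<open>d\<close>, and product \<open>m\<close> and coproduct \<open>D\<close>,
  corresponds to the standard Manin triple of Poisson algebras with bracket \<open>lbr\<close> and product \<open>p\<close>.\<close>
definition poisson_corresponds ::
  "('r::comm_ring_1, 'v::ab_group_add, 'u::ab_group_add, 't::ab_group_add, 'w::ab_group_add) space \<Rightarrow>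
   ('v \<Rightarrow> 'v \<Rightarrow> 'v) \<Rightarrow> ('v \<Rightarrow> 'v \<Rightarrow> 'v) \<Rightarrow> ('v \<Rightarrow> 't) \<Rightarrow> ('v \<Rightarrow> 't) \<Rightarrow>
   ('v \<times> 'u \<Rightarrow> 'v \<times> 'u \<Rightarrow> 'v \<times> 'u) \<Rightarrow> ('v \<times> 'u \<Rightarrow> 'v \<times> 'u \<Rightarrow> 'v \<times> 'u) \<Rightarrow> bool" where
  "poisson_corresponds M br m d D lbr p \<longleftrightarrow>
     poisson_bialgebra M br m d D \<and> poisson_manin_triple M lbr p \<and>
     (\<forall>u\<in>double M. \<forall>v\<in>double M.
        lbr u v = double_bracket M br d u v \<and> p u v = double_prod M m D u v)"


section \<open>The universal property for arbitrary targets\<close>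

lemma functional_separates:
  fixes s :: "'k::field \<Rightarrow> 'v::ab_group_add \<Rightarrow> 'v"
  assumes vs: "vector_space s" and U: "module.subspace s U" and v: "v \<notin> U"
  shows "\<exists>f. module_hom s (*) f \<and> (\<forall>u\<in>U. f u = 0) \<and> f v \<noteq> 0"
proof -
  interpret vector_space_pair s "(*) :: 'k \<Rightarrow> 'k \<Rightarrow> 'k"
    using vs by (auto intro!: vector_space_pair.intro vector_space.intro simp: algebra_simps)
  obtain B where B: "B \<subseteq> U" "vs1.independent B" "U \<subseteq> vs1.span B"
    using vs1.maximal_independent_subset[of U] by blast
  have "vs1.span B \<subseteq> U" using vs1.span_minimal[OF B(1) U] .
  with v have nin: "v \<notin> vs1.span B" by blast
  then have ind: "vs1.independent (insert v B)" using B(2) by (simp add: vs1.independent_insert)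
  obtain g where g: "Vector_Spaces.linear s (*) g"
    "\<forall>x\<in>insert v B. g x = (if x = v then 1 else 0)"
    using linear_independent_extend[OF ind, of "\<lambda>x. if x = v then 1 else 0"] by blast
  have vB: "v \<notin> B" using nin vs1.span_base by blast
  have z: "Vector_Spaces.linear s (*) (\<lambda>_. 0 :: 'k)"
    using module_hom_zero by (simp add: module_hom_iff_linear)
  have "g u = 0" if "u \<in> U" for u
  proof (rule linear_eq_on[OF g(1) z])
    show "u \<in> vs1.span B" using that B(3) by blast
    show "g b = 0" if "b \<in> B" for b using that g(2) vB by auto
  qed
  then show ?thesis using g by (intro exI[of _ g]) (auto simp: module_hom_iff_linear)
qed

lemma tensor_product_universal:
  fixes s1 :: "'k::field \<Rightarrow> 'v::ab_group_add \<Rightarrow> 'v" and s2 :: "'k \<Rightarrow> 'w::ab_group_add \<Rightarrow> 'w"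
    and s :: "'k \<Rightarrow> 't::ab_group_add \<Rightarrow> 't" and s' :: "'k \<Rightarrow> 'x::ab_group_add \<Rightarrow> 'x"
  assumes T: "tensor_product s1 s2 s t" and X: "vector_space s'" and b: "bilinear_map s1 s2 s' b"
  shows "\<exists>!F. module_hom s s' F \<and> (\<forall>x y. F (t x y) = b x y)"
proof -
  have T1: "vector_space s" "bilinear_map s1 s2 s t"
    and T2: "\<And>c. bilinear_map s1 s2 (*) c \<Longrightarrow> \<exists>!f. module_hom s (*) f \<and> (\<forall>x y. f (t x y) = c x y)"
    using T by (auto simp: tensor_product_def)
  interpret vector_space_pair s s'
    using T1 X by (simp add: vector_space_pair_def)
  let ?P = "{t x y | x y. True}"
  have comp: "bilinear_map s1 s2 (*) (\<lambda>x y. f (c x y))"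
    if "module_hom r (*) f" "bilinear_map s1 s2 r c" for f c and r :: "'k \<Rightarrow> 'z::ab_group_add \<Rightarrow> 'z"
  proof -
    have "module_hom s1 (*) (\<lambda>x. f (c x y))" for y
      using module_hom_compose[of s1 r "\<lambda>x. c x y" "(*)" f] that
      by (simp add: bilinear_map_def comp_def)
    moreover have "module_hom s2 (*) (\<lambda>y. f (c x y))" for x
      using module_hom_compose[of s2 r "\<lambda>y. c x y" "(*)" f] that
      by (simp add: bilinear_map_def comp_def)
    ultimately show ?thesis by (simp add: bilinear_map_def)
  qed
  have span: "vs1.span ?P = UNIV"
  proof (rule ccontr)
    assume "vs1.span ?P \<noteq> UNIV"
    then obtain v where v: "v \<notin> vs1.span ?P" by blast
    obtain f where f: "module_hom s (*) f" "\<forall>u\<in>vs1.span ?P. f u = 0" "f v \<noteq> 0"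
      using functional_separates[OF T1(1) vs1.subspace_span v] by blast
    have f0: "f (t x y) = 0" for x y using f(2) vs1.span_base[of "t x y" ?P] by blast
    have z: "module_hom s (*) (\<lambda>_. 0 :: 'k)"
      using f(1) unfolding module_hom_def module_hom_axioms_def by simp
    have "\<exists>!f. module_hom s (*) f \<and> (\<forall>x y. f (t x y) = (0 :: 'k))"
      using T2[OF comp[OF f(1) T1(2)]] by (simp only: f0)
    then have "f = (\<lambda>_. 0)" using f(1) f0 z by blast
    with f(3) show False by simp
  qed
  obtain B where B: "B \<subseteq> ?P" "vs1.independent B" "?P \<subseteq> vs1.span B"
    using vs1.maximal_independent_subset[of ?P] by blast
  have spanB: "vs1.span B = UNIV"
    using vs1.span_minimal[OF B(3) vs1.subspace_span] span by auto
  obtain g where g: "\<And>z. z \<in> B \<Longrightarrow> z = t (fst (g z)) (snd (g z))"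
  proof -
    have "\<forall>z\<in>B. \<exists>q. z = t (fst q) (snd q)" using B(1) by fastforce
    then show ?thesis using that by metis
  qed
  obtain F where F: "Vector_Spaces.linear s s' F" "\<forall>z\<in>B. F z = b (fst (g z)) (snd (g z))"
    using linear_independent_extend[OF B(2), of "\<lambda>z. b (fst (g z)) (snd (g z))"] by blast
  have Ft: "F (t x y) = b x y" for x y
  proof (rule ccontr)
    assume ne: "F (t x y) \<noteq> b x y"
    have "F (t x y) - b x y \<notin> {0}" using ne by simp
    from functional_separates[OF X vs2.subspace_single_0 this]
    obtain f where f: "module_hom s' (*) f" "f (F (t x y) - b x y) \<noteq> 0" by (elim exE conjE)
    have vp: "vector_space_pair s ((*) :: 'k \<Rightarrow> 'k \<Rightarrow> 'k)"
      using T1 by (auto intro!: vector_space_pair.intro vector_space.intro simp: algebra_simps)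
    obtain e where e: "module_hom s (*) e" "\<And>x y. e (t x y) = f (b x y)"
      using T2[OF comp[OF f(1) b]] by blast
    have le: "Vector_Spaces.linear s (*) e" using e(1) by (simp add: module_hom_iff_linear)
    have lf: "Vector_Spaces.linear s (*) (\<lambda>z. f (F z))"
      using module_hom_compose[of s s' F "(*)" f] F(1) f(1)
      by (simp add: module_hom_iff_linear comp_def)
    have eqB: "f (F z) = e z" if "z \<in> B" for z
    proof -
      have "f (F z) = f (b (fst (g z)) (snd (g z)))" using F(2) that by simp
      also have "\<dots> = e (t (fst (g z)) (snd (g z)))" by (simp add: e(2))
      also have "\<dots> = e z" using g[OF that] by simp
      finally show ?thesis .
    qed
    have "f (F (t x y)) = e (t x y)"
      by (rule vector_space_pair.linear_eq_on[OF vp lf le, of _ B]) (simp_all add: spanB eqB)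
    then have "f (F (t x y)) = f (b x y)" by (simp add: e(2))
    with f(2) show False by (simp add: module_hom.diff[OF f(1)])
  qed
  show ?thesis
  proof (rule ex1I[of _ F])
    show "module_hom s s' F \<and> (\<forall>x y. F (t x y) = b x y)"
      using F(1) Ft by (simp add: module_hom_iff_linear)
  next
    fix G assume G: "module_hom s s' G \<and> (\<forall>x y. G (t x y) = b x y)"
    then have lG: "Vector_Spaces.linear s s' G" by (simp add: module_hom_iff_linear)
    show "G = F"
    proof
      fix z
      show "G z = F z"
        by (rule linear_eq_on[OF lG F(1), of _ ?P]) (use G Ft span in auto)
    qed
  qed
qed
end

theory Submission
  imports Defs
begin

text \<open>
  Everything rests on one formula. Write \<open>n\<close> for the dual operation of a linear map \<open>D\<close>, so that
  \<open>\<langle>n a b, x\<rangle>\<close> is \<open>D x\<close> tested against \<open>a \<otimes> b\<close>. For \<open>u = (x, a)\<close>, \<open>v = (y, b)\<close>, \<open>w = (z, c)\<close> in the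
  double, and \<open>u v\<close> the product built from a bilinear \<open>m\<close> and \<open>D\<close>, the form of \<open>u v\<close> against \<open>w\<close> is
  \<open>\<langle>c, m x y\<rangle> + \<langle>a, m y z\<rangle> + \<langle>b, m z x\<rangle> + \<langle>n a b, z\<rangle> + \<langle>n b c, x\<rangle> + \<langle>n c a, y\<rangle>\<close>
  (\<open>form_double_prod\<close>). It is cyclically symmetric, so the form \<open>B\<close> is invariant whatever \<open>m\<close> and \<open>D\<close>
  are, and it is nondegenerate. Therefore associativity says exactly that \<open>B (u v) (w s)\<close> is cyclically
  symmetric in \<open>u, v, w, s\<close>. It is enough to check this when each entry lies in \<open>A\<close> or in \<open>A\<^sup>*\<close>, and up
  to rotation the patterns with three or one entries from \<open>A\<close> are the associativity of \<open>m\<close> and the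
  coassociativity of \<open>D\<close>, and the two patterns with two of each are the two compatibility conditions of
  an ASI bialgebra (\<open>asi_bialgebra_iff_assoc\<close>). The same evaluation of \<open>B (u v) (w s)\<close>, now with the
  bracket in one or both of the inner places, turns the Jacobi and Leibniz rules of the double into
  the axioms of a Poisson bialgebra (\<open>poisson_bialgebra_of_double\<close>).

  These arguments use only that the module has a finite frame with dual frame, and the same for its
  tensor powers. This is the locale \<open>framed_space\<close>; it holds for a finite-dimensional space, and it
  passes to power series by letting every coordinate act on coefficients (\<open>framed_space_series\<close>).
  So the equivalence of ASI bialgebras and Manin triples is available over the field and
  over \<open>k[[h]]\<close> from a single proof.

  The two levels are linked by \<open>double_prod_series_nth\<close>: on constant series, the coefficient of \<open>h\<^sup>k\<close>
  of the deformed product of the double is the product of the double built from the coefficients of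
  \<open>h\<^sup>k\<close> of \<open>m_h\<close> and \<open>D_h\<close>. For \<open>k = 0\<close> this compares the two notions of deformation. For \<open>k = 1\<close>, after
  antisymmetrization, it says that the double of the quasiclassical limit \<open>(br, d)\<close> is the
  quasiclassical limit of the double (\<open>manin_qcl_iff\<close>, \<open>asi_qcl_iff\<close>). That the limit is
  Poisson is first seen on the double, where it is the classical fact that the quasiclassical limit
  of an associative deformation of a commutative algebra is a Poisson algebra (\<open>qcl_poisson\<close>); the
  Poisson bialgebra axioms then follow.
\<close>

section \<open>Framed modules and their tensor products\<close>

text \<open>The dual basis property of a finitely generated projective module. Reconstruction of every vector from
its coordinates determines a linear map by its values on \<open>e\<close>, and turns all
constructions below into finite sums over coordinates.\<close>
definition frame ::
  "('r::comm_ring_1 \<Rightarrow> 'v::ab_group_add \<Rightarrow> 'v) \<Rightarrow> 'i set \<Rightarrow> ('i \<Rightarrow> 'v) \<Rightarrow> ('i \<Rightarrow> 'v \<Rightarrow> 'r) \<Rightarrow> bool" where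
  "frame s J e \<phi> \<longleftrightarrow> finite J \<and> module s \<and> (\<forall>j\<in>J. module_hom s (*) (\<phi> j)) \<and>
     (\<forall>x. (\<Sum>j\<in>J. s (\<phi> j x) (e j)) = x)"

lemma frame_eqI:
  assumes "frame s J e \<phi>" "\<And>j. j \<in> J \<Longrightarrow> \<phi> j x = \<phi> j y"
  shows "x = y"
proof -
  have "(\<Sum>j\<in>J. s (\<phi> j x) (e j)) = (\<Sum>j\<in>J. s (\<phi> j y) (e j))" using assms(2) by simp
  then show ?thesis using assms(1) by (simp add: frame_def)
qed

lemma frame_hom: "frame s J e \<phi> \<Longrightarrow> j \<in> J \<Longrightarrow> module_hom s (*) (\<phi> j)"
  by (simp add: frame_def)

lemma module_mult: "module ((*) :: 'r::comm_ring_1 \<Rightarrow> 'r \<Rightarrow> 'r)"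
  by unfold_locales (simp_all add: algebra_simps)

lemma module_hom_mult_left:
  "module_hom s (*) f \<Longrightarrow> module_hom s (*) (\<lambda>x. (c :: 'r::comm_ring_1) * f x)"
  by (auto simp: module_hom_iff algebra_simps)

lemma module_hom_comp:
  "module_hom s1 s2 f \<Longrightarrow> module_hom s2 s3 g \<Longrightarrow> module_hom s1 s3 (\<lambda>x. g (f x))"
  by (auto simp: module_hom_iff)

lemma module_hom_sum_fun:
  assumes "module s" "module s'" "\<And>j. j \<in> J \<Longrightarrow> module_hom s s' (f j)"
  shows "module_hom s s' (\<lambda>x. \<Sum>j\<in>J. f j x)"
proof -
  interpret S': module s' by fact
  show ?thesis using assms
    by (auto simp: module_hom_iff sum.distrib S'.scale_sum_right intro!: sum.cong)
qed

lemma module_hom_scale_fun: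
  assumes "module_hom s (*) f" "module s'"
  shows "module_hom s s' (\<lambda>x. s' (f x) y)"
proof -
  interpret S': module s' by fact
  show ?thesis using assms by (auto simp: module_hom_iff S'.scale_left_distrib)
qed

lemma bilinear_map_comp:
  assumes "bilinear_map s1 s2 s b" "module_hom r1 s1 f" "module_hom r2 s2 g"
  shows "bilinear_map r1 r2 s (\<lambda>x y. b (f x) (g y))"
  using assms by (auto simp: bilinear_map_def module_hom_iff)

lemma bilinear_map_mult: "bilinear_map (*) (*) (*) ((*) :: 'r::comm_ring_1 \<Rightarrow> 'r \<Rightarrow> 'r)"
  using module_mult by (auto simp: bilinear_map_def module_hom_iff algebra_simps)

text \<open>This turns an identity between bilinear maps into one between finite sums, which is how the
universal property and the coordinates of a tensor product are obtained.\<close>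
lemma bilinear_map_expand:
  assumes b: "bilinear_map s1 s2 s' b" and "frame s1 J e \<phi>" "frame s2 K f \<psi>"
  shows "b x y = (\<Sum>(j,k)\<in>J\<times>K. s' (\<phi> j x * \<psi> k y) (b (e j) (f k)))"
proof -
  have h1: "module_hom s1 s' (\<lambda>x. b x z)" and h2: "module_hom s2 s' (b z')" for z z'
    using b by (auto simp: bilinear_map_def)
  have "module s'" using h1 by (auto simp: module_hom_iff)
  then interpret S': module s' .
  have x: "x = (\<Sum>j\<in>J. s1 (\<phi> j x) (e j))" and y: "y = (\<Sum>k\<in>K. s2 (\<psi> k y) (f k))"
    using assms by (auto simp: frame_def)
  have 2: "b z y = (\<Sum>k\<in>K. s' (\<psi> k y) (b z (f k)))" for z
    using arg_cong[OF y, of "b z"] by (simp add: module_hom.sum[OF h2] module_hom.scale[OF h2])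
  have "b x y = (\<Sum>j\<in>J. s' (\<phi> j x) (b (e j) y))"
    using arg_cong[OF x, of "\<lambda>x. b x y"] by (simp add: module_hom.sum[OF h1] module_hom.scale[OF h1])
  then show ?thesis
    unfolding 2 by (simp add: S'.scale_sum_right sum.cartesian_product)
qed

text \<open>A tensor product in coordinates: \<open>t (e j) (f k)\<close> is a frame, with coordinates \<open>\<chi> (j, k)\<close> that are
products of coordinates on pure tensors. Unlike the predicate \<open>tensor_product\<close>, this makes sense
over \<open>k[[h]]\<close>, and it yields the universal property for every target.\<close>
locale framed_tensor =
  fixes s1 :: "'r::comm_ring_1 \<Rightarrow> 'v::ab_group_add \<Rightarrow> 'v" and J :: "'i set" and e \<phi>
    and s2 :: "'r \<Rightarrow> 'w::ab_group_add \<Rightarrow> 'w" and K :: "'j set" and f \<psi>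
    and s :: "'r \<Rightarrow> 't::ab_group_add \<Rightarrow> 't" and t \<chi>
  assumes frame1: "frame s1 J e \<phi>" and frame2: "frame s2 K f \<psi>"
    and bilinear: "bilinear_map s1 s2 s t"
    and frame_t: "frame s (J \<times> K) (\<lambda>(j, k). t (e j) (f k)) \<chi>"
    and coord: "\<And>j k x y. j \<in> J \<Longrightarrow> k \<in> K \<Longrightarrow> \<chi> (j, k) (t x y) = \<phi> j x * \<psi> k y"
begin

lemma hom_eqI:
  assumes F: "module_hom s s' F" and G: "module_hom s s' G" and eq: "\<And>x y. F (t x y) = G (t x y)"
  shows "F z = G z"
proof -
  have z: "z = (\<Sum>p\<in>J\<times>K. s (\<chi> p z) (case p of (j,k) \<Rightarrow> t (e j) (f k)))"
    using frame_t by (auto simp: frame_def)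
  show ?thesis
    using arg_cong[OF z, of F] arg_cong[OF z, of G]
    unfolding module_hom.sum[OF F] module_hom.sum[OF G] module_hom.scale[OF F] module_hom.scale[OF G]
    by (simp add: eq case_prod_beta)
qed

lemma universal:
  assumes b: "bilinear_map s1 s2 s' b"
  shows "\<exists>!F. module_hom s s' F \<and> (\<forall>x y. F (t x y) = b x y)"
proof -
  have "module s'" using b by (auto simp: bilinear_map_def module_hom_iff)
  let ?F = "\<lambda>z. \<Sum>p\<in>J\<times>K. s' (\<chi> p z) (case p of (j,k) \<Rightarrow> b (e j) (f k))"
  have F: "module_hom s s' ?F"
    using frame_t \<open>module s'\<close>
    by (intro module_hom_sum_fun module_hom_scale_fun) (auto simp: frame_def)
  moreover have "?F (t x y) = b x y" for x y
    unfolding bilinear_map_expand[OF b frame1 frame2, of x y]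
    by (intro sum.cong) (auto simp: coord)
  moreover have "G = ?F" if "module_hom s s' G \<and> (\<forall>x y. G (t x y) = b x y)" for G
    using hom_eqI[of s' G ?F] that F calculation(2) by auto
  ultimately show ?thesis by blast
qed

lemma the_hom:
  assumes "bilinear_map s1 s2 s' b"
  shows "module_hom s s' (THE F. module_hom s s' F \<and> (\<forall>x y. F (t x y) = b x y))"
    and "(THE F. module_hom s s' F \<and> (\<forall>x y. F (t x y) = b x y)) (t x y) = b x y"
  using theI'[OF universal[OF assms]] by auto

lemma tensor_map:
  assumes "bilinear_map r1 r2 s' t'" "module_hom s1 r1 g" "module_hom s2 r2 h"
  shows "module_hom s s' (tensor_map s t s' t' g h)"
    and "tensor_map s t s' t' g h (t x y) = t' (g x) (h y)"
  using the_hom[OF bilinear_map_comp[OF assms]] by (auto simp: tensor_map_def)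

end


section \<open>Framed spaces and their duals\<close>

text \<open>What the finite-dimensional space \<open>M\<close> and its space of power series have in common. The dual frame
\<open>\<epsilon>\<close> supplies the coordinates; \<open>\<chi>\<close>, \<open>\<chi>21\<close>, \<open>\<chi>12\<close> are the coordinates of the tensor square and of the two
descriptions of the tensor cube.\<close>
locale framed_space =
  fixes M :: "('r::comm_ring_1, 'v::ab_group_add, 'u::ab_group_add, 't::ab_group_add, 'w::ab_group_add) space"
    and I :: "'i set" and e :: "'i \<Rightarrow> 'v" and \<epsilon> :: "'i \<Rightarrow> 'u" and \<chi> \<chi>21 \<chi>12
  assumes framed: "framed_tensor (smul M) I e (\<lambda>i. pairing M (\<epsilon> i)) (smul M) I e (\<lambda>i. pairing M (\<epsilon> i))
      (smul2 M) (tensor M) \<chi>"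
    and framed21: "framed_tensor (smul2 M) (I \<times> I) (\<lambda>(i, j). tensor M (e i) (e j)) \<chi>
      (smul M) I e (\<lambda>i. pairing M (\<epsilon> i)) (smul3 M) (tensor21 M) \<chi>21"
    and framed12: "framed_tensor (smul M) I e (\<lambda>i. pairing M (\<epsilon> i))
      (smul2 M) (I \<times> I) (\<lambda>(i, j). tensor M (e i) (e j)) \<chi> (smul3 M) (tensor12 M) \<chi>12"
    and tensor_assoc: "\<And>x y z. tensor21 M (tensor M x y) z = tensor12 M x (tensor M y z)"
    and module_dual: "module (dsmul M)"
    and subspace_dual: "module.subspace (dsmul M) (dual M)"
    and frame_dual: "\<And>i. i \<in> I \<Longrightarrow> \<epsilon> i \<in> dual M"
    and pairing_hom_left: "\<And>x. module_hom (dsmul M) (*) (\<lambda>a. pairing M a x)"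
    and pairing_hom: "\<And>a. a \<in> dual M \<Longrightarrow> module_hom (smul M) (*) (pairing M a)"
    and dual_eqI: "\<And>a b. a \<in> dual M \<Longrightarrow> b \<in> dual M \<Longrightarrow> (\<And>x. pairing M a x = pairing M b x) \<Longrightarrow> a = b"
begin

sublocale T: framed_tensor "smul M" I e "\<lambda>i. pairing M (\<epsilon> i)" "smul M" I e "\<lambda>i. pairing M (\<epsilon> i)"
  "smul2 M" "tensor M" \<chi> by (fact framed)
sublocale T21: framed_tensor "smul2 M" "I \<times> I" "\<lambda>(i, j). tensor M (e i) (e j)" \<chi>
      "smul M" I e "\<lambda>i. pairing M (\<epsilon> i)" "smul3 M" "tensor21 M" \<chi>21 by (fact framed21)
sublocale T12: framed_tensor "smul M" I e "\<lambda>i. pairing M (\<epsilon> i)"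
      "smul2 M" "I \<times> I" "\<lambda>(i, j). tensor M (e i) (e j)" \<chi> "smul3 M" "tensor12 M" \<chi>12 by (fact framed12)
sublocale V: module "smul M" using T.frame1 by (simp add: frame_def)
sublocale V2: module "smul2 M" using T.frame_t by (simp add: frame_def)
sublocale V': module "dsmul M" by (fact module_dual)

abbreviation "linear1 \<equiv> module_hom (smul M) (smul M)"
abbreviation "linear12 \<equiv> module_hom (smul M) (smul2 M)"

lemma dual_closed [simp]:
  "0 \<in> dual M"
  "a \<in> dual M \<Longrightarrow> b \<in> dual M \<Longrightarrow> a + b \<in> dual M"
  "a \<in> dual M \<Longrightarrow> b \<in> dual M \<Longrightarrow> a - b \<in> dual M"
  "a \<in> dual M \<Longrightarrow> - a \<in> dual M"
  "a \<in> dual M \<Longrightarrow> dsmul M c a \<in> dual M"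
  using subspace_dual V'.subspace_0 V'.subspace_add V'.subspace_diff V'.subspace_neg V'.subspace_scale
  by auto

lemma pairing_left [simp]:
  "pairing M (a + b) x = pairing M a x + pairing M b x"
  "pairing M (a - b) x = pairing M a x - pairing M b x"
  "pairing M (- a) x = - pairing M a x"
  "pairing M 0 x = 0"
  "pairing M (dsmul M c a) x = c * pairing M a x"
  by (simp_all add: module_hom.add[OF pairing_hom_left]
      module_hom.diff[OF pairing_hom_left] module_hom.neg[OF pairing_hom_left]
      module_hom.zero[OF pairing_hom_left] module_hom.scale[OF pairing_hom_left])

lemma pairing_right [simp]:
  assumes "a \<in> dual M"
  shows "pairing M a (x + y) = pairing M a x + pairing M a y"
  "pairing M a (x - y) = pairing M a x - pairing M a y"
  "pairing M a (- x) = - pairing M a x"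
  "pairing M a 0 = 0"
  "pairing M a (smul M c x) = c * pairing M a x"
  by (simp_all add: module_hom.add[OF pairing_hom[OF assms]]
      module_hom.diff[OF pairing_hom[OF assms]] module_hom.neg[OF pairing_hom[OF assms]]
      module_hom.zero[OF pairing_hom[OF assms]] module_hom.scale[OF pairing_hom[OF assms]])

lemma pairing_sum [simp]:
  "a \<in> dual M \<Longrightarrow> pairing M a (\<Sum>i\<in>J. g i) = (\<Sum>i\<in>J. pairing M a (g i))"
  "pairing M (\<Sum>i\<in>J. g' i) x = (\<Sum>i\<in>J. pairing M (g' i) x)"
  by (simp_all add: module_hom.sum[OF pairing_hom] module_hom.sum[OF pairing_hom_left])

lemma expand_vector: "(\<Sum>i\<in>I. smul M (pairing M (\<epsilon> i) x) (e i)) = x"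
  using T.frame1 by (simp add: frame_def)

lemma finite_frame: "finite I" using T.frame1 by (simp add: frame_def)

lemma vector_eqI:
  assumes "\<And>a. a \<in> dual M \<Longrightarrow> pairing M a x = pairing M a y"
  shows "x = y"
proof -
  have "x = (\<Sum>i\<in>I. smul M (pairing M (\<epsilon> i) x) (e i))" by (simp add: expand_vector)
  also have "\<dots> = (\<Sum>i\<in>I. smul M (pairing M (\<epsilon> i) y) (e i))"
    using assms frame_dual by (auto intro!: sum.cong)
  finally show ?thesis by (simp add: expand_vector)
qed

lemma dual_sum: "(\<And>i. i \<in> J \<Longrightarrow> g i \<in> dual M) \<Longrightarrow> (\<Sum>i\<in>J. g i) \<in> dual M"
  using V'.subspace_sum[OF subspace_dual] by blast

lemma expand_dual:
  assumes "a \<in> dual M"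
  shows "(\<Sum>i\<in>I. dsmul M (pairing M a (e i)) (\<epsilon> i)) = a"
proof (rule dual_eqI)
  show "(\<Sum>i\<in>I. dsmul M (pairing M a (e i)) (\<epsilon> i)) \<in> dual M"
    using frame_dual by (auto intro!: dual_sum)
  fix x
  have "pairing M a x = (\<Sum>i\<in>I. pairing M (\<epsilon> i) x * pairing M a (e i))"
    using assms by (subst expand_vector[symmetric, of x]) simp
  then show "pairing M (\<Sum>i\<in>I. dsmul M (pairing M a (e i)) (\<epsilon> i)) x = pairing M a x"
    by (simp add: mult.commute)
qed fact

lemma represent_functional:
  assumes g: "module_hom (smul M) (*) g"
  shows "\<exists>a\<in>dual M. \<forall>x. pairing M a x = g x"
proof (intro bexI allI)
  show "(\<Sum>i\<in>I. dsmul M (g (e i)) (\<epsilon> i)) \<in> dual M" using frame_dual by (auto intro!: dual_sum)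
  fix x
  have "g x = (\<Sum>i\<in>I. pairing M (\<epsilon> i) x * g (e i))"
    by (subst expand_vector[symmetric, of x]) (simp add: module_hom.sum[OF g] module_hom.scale[OF g])
  then show "pairing M (\<Sum>i\<in>I. dsmul M (g (e i)) (\<epsilon> i)) x = g x" by (simp add: mult.commute)
qed

text \<open>Linearity is asked on \<open>dual M\<close> only, because the dual is a subset of its type and maps such
as \<open>dual_op M D a\<close> are uncontrolled outside it.\<close>
definition dual_linear :: "('u \<Rightarrow> 'r) \<Rightarrow> bool" where
  "dual_linear g \<longleftrightarrow> (\<forall>a\<in>dual M. \<forall>b\<in>dual M. g (a + b) = g a + g b) \<and>
     (\<forall>c. \<forall>a\<in>dual M. g (dsmul M c a) = c * g a)"

text \<open>Reflexivity of a framed module: the frame \<open>e\<close> serves as the dual frame of \<open>dual M\<close>.\<close>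
lemma represent_bidual:
  assumes g: "dual_linear g"
  shows "\<exists>x. \<forall>a\<in>dual M. pairing M a x = g a"
proof (intro exI ballI)
  fix a assume a: "a \<in> dual M"
  have sum: "g (\<Sum>i\<in>J. h i) = (\<Sum>i\<in>J. g (h i))" if "finite J" "\<And>i. i \<in> J \<Longrightarrow> h i \<in> dual M" for J and h :: "'i \<Rightarrow> 'u"
    using that
  proof (induction J rule: finite_induct)
    case empty
    have "g (dsmul M 0 0) = 0 * g 0" using g dual_closed(1) unfolding dual_linear_def by blast
    then show ?case by simp
  next
    case (insert j J)
    have "g (h j + sum h J) = g (h j) + g (sum h J)"
      using g insert.prems dual_sum[of J h] by (auto simp: dual_linear_def)
    then show ?case using insert by simp
  qed
  have "g a = (\<Sum>i\<in>I. pairing M a (e i) * g (\<epsilon> i))"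
    using g frame_dual by (subst expand_dual[OF a, symmetric])
      (auto simp: sum[OF finite_frame] dual_linear_def intro!: sum.cong)
  then show "pairing M a (\<Sum>i\<in>I. smul M (g (\<epsilon> i)) (e i)) = g a"
    using a by (simp add: mult.commute)
qed

lemma transp [simp]:
  assumes f: "linear1 f" and a: "a \<in> dual M"
  shows "transp M f a \<in> dual M" and "pairing M (transp M f a) x = pairing M a (f x)"
proof -
  obtain b where b: "b \<in> dual M" "\<forall>x. pairing M b x = pairing M a (f x)"
    using represent_functional[OF module_hom_comp[OF f pairing_hom[OF a]]] by blast
  have "transp M f a \<in> dual M \<and> (\<forall>x. pairing M (transp M f a) x = pairing M a (f x))"
    unfolding transp_def by (rule theI[of _ b]) (use b in \<open>auto intro: dual_eqI\<close>)
  then show "transp M f a \<in> dual M" "pairing M (transp M f a) x = pairing M a (f x)" by auto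
qed

lemma transp_bidual:
  assumes g: "dual_linear (\<lambda>a. pairing M (f a) x)" and a: "a \<in> dual M"
  shows "pairing M a (transp_bidual M f x) = pairing M (f a) x"
proof -
  obtain y where y: "\<forall>a\<in>dual M. pairing M a y = pairing M (f a) x"
    using represent_bidual[OF g] by blast
  have "\<forall>a\<in>dual M. pairing M a (transp_bidual M f x) = pairing M (f a) x"
    unfolding transp_bidual_def by (rule theI[of _ y]) (use y in \<open>auto intro: vector_eqI\<close>)
  then show ?thesis using a by blast
qed

lemma linear1_id: "linear1 id"
  by (auto simp: module_hom_iff V.module_axioms)


section \<open>Testing tensors against functionals\<close>

text \<open>The functionals \<open>a \<otimes> b\<close> and \<open>a \<otimes> b \<otimes> c\<close>. Evaluating them replaces every identity between tensors by
an identity between scalars, in which \<open>f \<otimes> g\<close>, the flip, the cyclic permutation and the coproduct act on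
the functionals \<open>a\<close>, \<open>b\<close>, \<open>c\<close> instead.\<close>
definition pair2 :: "'u \<Rightarrow> 'u \<Rightarrow> 't \<Rightarrow> 'r" where
  "pair2 a b = tensor_map (smul2 M) (tensor M) (*) (*) (pairing M a) (pairing M b)"

definition pair3 :: "'u \<Rightarrow> 'u \<Rightarrow> 'u \<Rightarrow> 'w \<Rightarrow> 'r" where
  "pair3 a b c = tensor_map (smul3 M) (tensor21 M) (*) (*) (pair2 a b) (pairing M c)"

lemma pair2:
  assumes "a \<in> dual M" "b \<in> dual M"
  shows pair2_hom: "module_hom (smul2 M) (*) (pair2 a b)"
    and pair2_tensor [simp]: "pair2 a b (tensor M x y) = pairing M a x * pairing M b y"
  using T.tensor_map[OF bilinear_map_mult pairing_hom pairing_hom, OF assms] by (auto simp: pair2_def)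

lemma pair2_right [simp]:
  assumes "a \<in> dual M" "b \<in> dual M"
  shows "pair2 a b (x + y) = pair2 a b x + pair2 a b y"
  "pair2 a b (x - y) = pair2 a b x - pair2 a b y"
  "pair2 a b (- x) = - pair2 a b x"
  "pair2 a b 0 = 0"
  "pair2 a b (smul2 M c x) = c * pair2 a b x"
  by (simp_all add: module_hom.add[OF pair2_hom[OF assms]]
      module_hom.diff[OF pair2_hom[OF assms]] module_hom.neg[OF pair2_hom[OF assms]]
      module_hom.zero[OF pair2_hom[OF assms]] module_hom.scale[OF pair2_hom[OF assms]])

lemma pair3:
  assumes "a \<in> dual M" "b \<in> dual M" "c \<in> dual M"
  shows pair3_hom: "module_hom (smul3 M) (*) (pair3 a b c)"
    and pair3_tensor21 [simp]: "pair3 a b c (tensor21 M t x) = pair2 a b t * pairing M c x"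
  using T21.tensor_map[OF bilinear_map_mult pair2_hom pairing_hom, OF assms] by (auto simp: pair3_def)

lemma pair3_right [simp]:
  assumes "a \<in> dual M" "b \<in> dual M" "c \<in> dual M"
  shows "pair3 a b c (x + y) = pair3 a b c x + pair3 a b c y"
  "pair3 a b c (x - y) = pair3 a b c x - pair3 a b c y"
  "pair3 a b c (- x) = - pair3 a b c x"
  "pair3 a b c 0 = 0"
  by (simp_all add: module_hom.add[OF pair3_hom[OF assms]]
      module_hom.diff[OF pair3_hom[OF assms]] module_hom.neg[OF pair3_hom[OF assms]]
      module_hom.zero[OF pair3_hom[OF assms]] module_hom.scale[OF pair3_hom[OF assms]])

text \<open>The functional \<open>a \<otimes> b \<otimes> c\<close> is defined through \<open>(V \<otimes> V) \<otimes> V\<close>; this evaluates it through \<open>V \<otimes> (V \<otimes> V)\<close>.\<close>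
lemma pair3_tensor12 [simp]:
  assumes "a \<in> dual M" "b \<in> dual M" "c \<in> dual M"
  shows "pair3 a b c (tensor12 M x t) = pairing M a x * pair2 b c t"
proof (rule T.hom_eqI)
  have "module_hom (smul2 M) (smul3 M) (tensor12 M x)"
    using T12.bilinear by (simp add: bilinear_map_def)
  from module_hom_comp[OF this pair3_hom[OF assms]]
  show "module_hom (smul2 M) (*) (\<lambda>t. pair3 a b c (tensor12 M x t))" .
  show "module_hom (smul2 M) (*) (\<lambda>t. pairing M a x * pair2 b c t)"
    using assms by (intro module_hom_mult_left pair2_hom)
  show "pair3 a b c (tensor12 M x (tensor M y z)) = pairing M a x * pair2 b c (tensor M y z)" for y z
    using assms by (simp flip: tensor_assoc)
qed

lemma coord_eq_pair2: "i \<in> I \<Longrightarrow> j \<in> I \<Longrightarrow> \<chi> (i, j) z = pair2 (\<epsilon> i) (\<epsilon> j) z"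
  by (rule T.hom_eqI[OF frame_hom[OF T.frame_t]]) (use frame_dual in \<open>auto simp: T.coord pair2_hom\<close>)

text \<open>The product functionals separate tensors because the coordinates are among them.\<close>
lemma tensor2_eqI:
  assumes eq: "\<And>a b. a \<in> dual M \<Longrightarrow> b \<in> dual M \<Longrightarrow> pair2 a b t = pair2 a b t'"
  shows "t = t'"
proof -
  have "\<chi> p t = \<chi> p t'" if "p \<in> I \<times> I" for p
    using that eq frame_dual by (auto simp: coord_eq_pair2)
  then show ?thesis by (rule frame_eqI[OF T.frame_t])
qed

lemma tensor3_eqI:
  assumes eq: "\<And>a b c. a \<in> dual M \<Longrightarrow> b \<in> dual M \<Longrightarrow> c \<in> dual M \<Longrightarrow> pair3 a b c t = pair3 a b c t'"
  shows "t = t'"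
proof -
  have "\<chi>21 ((i, j), k) z = pair3 (\<epsilon> i) (\<epsilon> j) (\<epsilon> k) z" if "i \<in> I" "j \<in> I" "k \<in> I" for i j k z
    by (rule T21.hom_eqI[OF frame_hom[OF T21.frame_t]]) (use that frame_dual in \<open>auto simp: T21.coord pair3_hom coord_eq_pair2\<close>)
  then have "\<chi>21 p t = \<chi>21 p t'" if "p \<in> (I \<times> I) \<times> I" for p
    using that eq frame_dual by auto
  then show ?thesis by (rule frame_eqI[OF T21.frame_t])
qed

lemma pair2_left [simp]:
  assumes "a \<in> dual M" "b \<in> dual M" "c \<in> dual M"
  shows "pair2 (a + b) c t = pair2 a c t + pair2 b c t"
    and "pair2 c (a + b) t = pair2 c a t + pair2 c b t"
    and "pair2 (dsmul M r a) c t = r * pair2 a c t"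
    and "pair2 c (dsmul M r a) t = r * pair2 c a t"
    and "pair2 0 c t = 0" and "pair2 c 0 t = 0"
proof -
  have add: "module_hom (smul2 M) (*) (\<lambda>t. pair2 a b t + pair2 a' b' t)"
    if "a \<in> dual M" "b \<in> dual M" "a' \<in> dual M" "b' \<in> dual M" for a b a' b'
    using pair2_hom[of a b] pair2_hom[of a' b'] that by (auto simp: module_hom_iff algebra_simps)
  show "pair2 (a + b) c t = pair2 a c t + pair2 b c t"
    "pair2 c (a + b) t = pair2 c a t + pair2 c b t"
    by - (rule T.hom_eqI[OF pair2_hom add]; use assms in \<open>auto simp: algebra_simps\<close>)+
  show s: "pair2 (dsmul M r a) c t = r * pair2 a c t"
    "pair2 c (dsmul M r a) t = r * pair2 c a t" for r
    by - (rule T.hom_eqI[OF pair2_hom module_hom_mult_left[OF pair2_hom]]; use assms in \<open>auto simp: algebra_simps\<close>)+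
  show "pair2 0 c t = 0" "pair2 c 0 t = 0" using s[of 0] by auto
qed

lemma pair2_tmap [simp]:
  assumes f: "linear1 f" "linear1 g" and a: "a \<in> dual M" "b \<in> dual M"
  shows "pair2 a b (tmap M f g t) = pair2 (transp M f a) (transp M g b) t"
proof (rule T.hom_eqI[OF _ pair2_hom])
  note F = T.tensor_map[OF T.bilinear f, folded tmap_def]
  show "module_hom (smul2 M) (*) (\<lambda>t. pair2 a b (tmap M f g t))"
    using module_hom_comp[OF F(1) pair2_hom[OF a]] .
  show "pair2 a b (tmap M f g (tensor M x y)) = pair2 (transp M f a) (transp M g b) (tensor M x y)" for x y
    using assms by (simp add: F)
qed (use assms in auto)

lemma transp_id [simp]: "a \<in> dual M \<Longrightarrow> transp M id a = a"
  by (rule dual_eqI) (simp_all add: linear1_id)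

lemma flip:
  shows flip_hom: "module_hom (smul2 M) (smul2 M) (flip M)"
    and flip_tensor: "flip M (tensor M x y) = tensor M y x"
proof -
  have "bilinear_map (smul M) (smul M) (smul2 M) (\<lambda>x y. tensor M y x)"
    using T.bilinear by (simp add: bilinear_map_def)
  from T.the_hom[OF this] show "module_hom (smul2 M) (smul2 M) (flip M)"
    "flip M (tensor M x y) = tensor M y x" by (auto simp: flip_def)
qed

lemma pair2_flip [simp]:
  assumes "a \<in> dual M" "b \<in> dual M"
  shows "pair2 a b (flip M t) = pair2 b a t"
  by (rule T.hom_eqI[OF module_hom_comp[OF flip_hom pair2_hom] pair2_hom]) (use assms in \<open>auto simp: flip_tensor\<close>)

text \<open>Linear maps on the tensor cube are compared in two steps, first in \<open>V \<otimes> V\<close> and then in the cube.\<close>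
lemma pure_tensor3_eqI:
  assumes "module_hom (smul3 M) s' F" "module_hom (smul3 M) s' G"
    and "\<And>x y z. F (tensor21 M (tensor M x y) z) = G (tensor21 M (tensor M x y) z)"
  shows "F w = G w"
proof (rule T21.hom_eqI[OF assms(1,2)])
  fix t z
  have b: "module_hom (smul2 M) (smul3 M) (\<lambda>t. tensor21 M t z)"
    using T21.bilinear by (simp add: bilinear_map_def)
  show "F (tensor21 M t z) = G (tensor21 M t z)"
    by (rule T.hom_eqI[OF module_hom_comp[OF b assms(1)] module_hom_comp[OF b assms(2)]]) fact
qed

lemma cyc:
  shows cyc_hom: "module_hom (smul3 M) (smul3 M) (cyc M)"
    and cyc_tensor: "cyc M (tensor21 M (tensor M x y) z) = tensor21 M (tensor M z x) y"
proof -
  have b: "bilinear_map (smul2 M) (smul M) (smul3 M) (\<lambda>t z. tensor12 M z t)"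
    using T12.bilinear by (simp add: bilinear_map_def)
  let ?P = "\<lambda>F. module_hom (smul3 M) (smul3 M) F \<and> (\<forall>x y z. F (tensor21 M (tensor M x y) z) = tensor21 M (tensor M z x) y)"
  obtain F where F: "module_hom (smul3 M) (smul3 M) F" "\<And>t z. F (tensor21 M t z) = tensor12 M z t"
    using T21.universal[OF b] by blast
  have PF: "?P F" using F by (simp flip: tensor_assoc)
  have "G = F" if G: "?P G" for G
  proof
    show "G w = F w" for w
      by (rule pure_tensor3_eqI[OF conjunct1[OF G] conjunct1[OF PF]]) (simp add: G PF del: pair3_tensor21)
  qed
  with PF have "?P (THE F. ?P F)" by (rule theI)
  then show "module_hom (smul3 M) (smul3 M) (cyc M)"
    "cyc M (tensor21 M (tensor M x y) z) = tensor21 M (tensor M z x) y"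
    unfolding cyc_def by blast+
qed

lemma pair3_cyc [simp]:
  assumes "a \<in> dual M" "b \<in> dual M" "c \<in> dual M"
  shows "pair3 a b c (cyc M w) = pair3 b c a w"
  by (rule pure_tensor3_eqI[OF module_hom_comp[OF cyc_hom pair3_hom] pair3_hom]) (use assms in \<open>auto simp: cyc_tensor algebra_simps\<close>)

lemma pair3_flip_id [simp]:
  assumes "a \<in> dual M" "b \<in> dual M" "c \<in> dual M"
  shows "pair3 a b c (flip_id M w) = pair3 b a c w"
proof -
  note F = T21.tensor_map[OF T21.bilinear flip_hom linear1_id, folded flip_id_def]
  show ?thesis
    by (rule T21.hom_eqI[OF module_hom_comp[OF F(1) pair3_hom] pair3_hom]) (use assms in \<open>auto simp: F\<close>)
qed

lemma dual_op:
  assumes D: "linear12 D" and a: "a \<in> dual M" and b: "b \<in> dual M"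
  shows dual_op_closed: "dual_op M D a b \<in> dual M"
    and pairing_dual_op: "pairing M (dual_op M D a b) x = pair2 a b (D x)"
proof -
  obtain c where c: "c \<in> dual M" "\<forall>x. pairing M c x = pair2 a b (D x)"
    using represent_functional[OF module_hom_comp[OF D pair2_hom[OF a b]]] by blast
  have "dual_op M D a b \<in> dual M \<and> (\<forall>x. pairing M (dual_op M D a b) x = pair2 a b (D x))"
    unfolding dual_op_def pair2_def[symmetric]
    by (rule theI[of _ c]) (use c in \<open>auto intro: dual_eqI\<close>)
  then show "dual_op M D a b \<in> dual M" "pairing M (dual_op M D a b) x = pair2 a b (D x)" by auto
qed

lemma pair3_cop_id:
  assumes D: "linear12 D" and a: "a \<in> dual M" "b \<in> dual M" "c \<in> dual M"
  shows "pair3 a b c (cop_id M D t) = pair2 (dual_op M D a b) c t"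
proof -
  note F = T.tensor_map[OF T21.bilinear D linear1_id, folded cop_id_def]
  show ?thesis
    by (rule T.hom_eqI[OF module_hom_comp[OF F(1) pair3_hom] pair2_hom]) (use a in \<open>auto simp: F dual_op[OF D]\<close>)
qed

lemma pair3_id_cop:
  assumes D: "linear12 D" and a: "a \<in> dual M" "b \<in> dual M" "c \<in> dual M"
  shows "pair3 a b c (id_cop M D t) = pair2 a (dual_op M D b c) t"
proof -
  note F = T.tensor_map[OF T12.bilinear linear1_id D, folded id_cop_def]
  show ?thesis
    by (rule T.hom_eqI[OF module_hom_comp[OF F(1) pair3_hom] pair2_hom]) (use a in \<open>auto simp: F dual_op[OF D]\<close>)
qed

end

section \<open>The product on the double\<close>

context framed_space
begin

text \<open>The standing hypothesis on a product and a coproduct, without any compatibility, so that it also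
covers brackets with cobrackets and single coefficients of a deformation.\<close>
definition linear_pair :: "('v \<Rightarrow> 'v \<Rightarrow> 'v) \<Rightarrow> ('v \<Rightarrow> 't) \<Rightarrow> bool" where
  "linear_pair m D \<longleftrightarrow> bilinear_map (smul M) (smul M) (smul M) m \<and> linear12 D"

lemma linear_pairD:
  assumes "linear_pair m D"
  shows linear_pair_left: "linear1 (m x)" and linear_pair_right: "linear1 (\<lambda>y. m y x)"
    and linear_pair_cop: "linear12 D"
  using assms by (auto simp: linear_pair_def bilinear_map_def)

lemma linear_pair_op:
  assumes "linear_pair m D"
  shows "m (x + y) z = m x z + m y z" "m z (x + y) = m z x + m z y"
    "m (smul M c x) z = smul M c (m x z)" "m z (smul M c x) = smul M c (m z x)"
    "m 0 z = 0" "m z 0 = 0"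
  using module_hom.add[OF linear_pair_left[OF assms]] module_hom.add[OF linear_pair_right[OF assms]]
    module_hom.scale[OF linear_pair_left[OF assms]] module_hom.scale[OF linear_pair_right[OF assms]]
    module_hom.zero[OF linear_pair_left[OF assms]] module_hom.zero[OF linear_pair_right[OF assms]]
  by simp_all

lemma transp_op:
  assumes "linear_pair m D" and "a \<in> dual M"
  shows "transp M (m x) a \<in> dual M" "transp M (\<lambda>y. m y x) a \<in> dual M"
    "pairing M (transp M (m x) a) y = pairing M a (m x y)"
    "pairing M (transp M (\<lambda>y. m y x) a) y = pairing M a (m y x)"
  using assms linear_pair_left[of m D] linear_pair_right[of m D] by auto

lemma dual_op_bilinear:
  assumes D: "linear12 D" and a: "a \<in> dual M" "b \<in> dual M" "c \<in> dual M"
  shows "dual_op M D (a + b) c = dual_op M D a c + dual_op M D b c"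
    and "dual_op M D c (a + b) = dual_op M D c a + dual_op M D c b"
    and "dual_op M D (dsmul M r a) c = dsmul M r (dual_op M D a c)"
    and "dual_op M D c (dsmul M r a) = dsmul M r (dual_op M D c a)"
  by (rule dual_eqI; use a in \<open>simp add: dual_op[OF D]\<close>)+

lemma dual_op_zero:
  assumes D: "linear12 D" and a: "a \<in> dual M"
  shows "dual_op M D 0 a = 0" and "dual_op M D a 0 = 0"
  by (rule dual_eqI; use a in \<open>simp add: dual_op[OF D]\<close>)+

lemma transp_bidual_op:
  assumes D: "linear12 D" and a: "a \<in> dual M" "c \<in> dual M"
  shows "pairing M c (transp_bidual M (dual_op M D a) x) = pairing M (dual_op M D a c) x"
    and "pairing M c (transp_bidual M (\<lambda>b. dual_op M D b a) x) = pairing M (dual_op M D c a) x"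
  by (rule transp_bidual; use a in \<open>simp add: dual_linear_def dual_op_bilinear[OF D]\<close>)+

lemma double_prod_Pair:
  "double_prod M m D (x, a) (y, b) =
    (m x y + transp_bidual M (\<lambda>c. dual_op M D c a) y + transp_bidual M (dual_op M D b) x,
     transp M (\<lambda>z. m z x) b + transp M (m y) a + dual_op M D a b)"
  by (simp add: double_prod_def Let_def)

lemma mem_double [simp]: "(x, a) \<in> double M \<longleftrightarrow> a \<in> dual M"
  by (simp add: double_def)

lemma double_prod_closed:
  assumes "linear_pair m D" "u \<in> double M" "v \<in> double M"
  shows "double_prod M m D u v \<in> double M"
  using assms linear_pair_cop[OF assms(1)]
  by (cases u; cases v) (simp add: double_prod_Pair transp_op dual_op)

lemma double_closed [simp]:
  "0 \<in> double M"
  "u \<in> double M \<Longrightarrow> v \<in> double M \<Longrightarrow> u + v \<in> double M"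
  "u \<in> double M \<Longrightarrow> v \<in> double M \<Longrightarrow> u - v \<in> double M"
  "u \<in> double M \<Longrightarrow> - u \<in> double M"
  "u \<in> double M \<Longrightarrow> double_smul M c u \<in> double M"
  by (cases u; cases v; simp add: zero_prod_def double_smul_def)+

lemma double_form_Pair: "double_form M (x, a) (y, b) = pairing M a y + pairing M b x"
  by (simp add: double_form_def)

lemma form_sym: "double_form M u v = double_form M v u"
  by (cases u; cases v) (simp add: double_form_def)

lemma form_linear:
  assumes "w \<in> double M"
  shows "double_form M (u + v) w = double_form M u w + double_form M v w"
    "double_form M (u - v) w = double_form M u w - double_form M v w"
    "double_form M (- u) w = - double_form M u w"
    "double_form M (double_smul M c u) w = c * double_form M u w"
    "double_form M 0 w = 0"
  using assms by (cases u; cases v; cases w; simp add: double_form_def double_smul_def zero_prod_def algebra_simps)+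

lemma form_linear_right:
  assumes "w \<in> double M"
  shows "double_form M w (u + v) = double_form M w u + double_form M w v"
    "double_form M w (u - v) = double_form M w u - double_form M w v"
    "double_form M w (- u) = - double_form M w u"
    "double_form M w (double_smul M c u) = c * double_form M w u"
    "double_form M w 0 = 0"
  using form_linear[OF assms] by (simp_all add: form_sym[of w])

text \<open>Nondegeneracy of the form: a vector of the double is tested against \<open>A\<close> and \<open>A\<^sup>*\<close> separately.\<close>
lemma double_eqI:
  assumes "u \<in> double M" "v \<in> double M"
    and eq: "\<And>w. w \<in> double M \<Longrightarrow> double_form M u w = double_form M v w"
  shows "u = v"
proof -
  obtain x a y b where uv: "u = (x, a)" "v = (y, b)" by (cases u; cases v)
  have "x = y"
  proof (rule vector_eqI)
    fix c assume "c \<in> dual M"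
    then show "pairing M c x = pairing M c y" using eq[of "(0, c)"] assms(1,2)
      by (simp add: uv double_form_def)
  qed
  moreover have "a = b"
  proof (rule dual_eqI)
    show "pairing M a z = pairing M b z" for z using eq[of "(z, 0)"]
      by (simp add: uv double_form_def)
  qed (use assms uv in auto)
  ultimately show ?thesis by (simp add: uv)
qed

text \<open>The form of a product against a third vector, with the transposes moved to the other side of
the pairings so that the cyclic symmetry becomes visible.\<close>
definition trilinear_form :: "('v \<Rightarrow> 'v \<Rightarrow> 'v) \<Rightarrow> ('v \<Rightarrow> 't) \<Rightarrow> 'v \<times> 'u \<Rightarrow> 'v \<times> 'u \<Rightarrow> 'v \<times> 'u \<Rightarrow> 'r" where
  "trilinear_form m D = (\<lambda>(x, a) (y, b) (z, c).
     pairing M c (m x y) + pairing M a (m y z) + pairing M b (m z x) +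
     pairing M (dual_op M D a b) z + pairing M (dual_op M D b c) x + pairing M (dual_op M D c a) y)"

lemma form_double_prod:
  assumes md: "linear_pair m D" and "u \<in> double M" "v \<in> double M" "w \<in> double M"
  shows "double_form M (double_prod M m D u v) w = trilinear_form m D u v w"
  using assms(2-) linear_pair_cop[OF md]
  by (cases u; cases v; cases w)
    (simp add: double_prod_Pair double_form_def trilinear_form_def transp_op[OF md] dual_op
      transp_bidual_op algebra_simps)

lemma trilinear_form_cyclic: "trilinear_form m D u v w = trilinear_form m D v w u"
  by (cases u; cases v; cases w) (simp add: trilinear_form_def algebra_simps)

text \<open>By cyclic symmetry and symmetry of the form, \<open>B (u v) w = B (v w) u = B u (v w)\<close>.\<close>
lemma double_prod_invariant:
  assumes "linear_pair m D"
  shows "invariant_on (double M) (double_form M) (double_prod M m D)"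
  unfolding invariant_on_def
  by (metis assms form_double_prod trilinear_form_cyclic form_sym double_prod_closed)

text \<open>Since the form is nondegenerate, linearity of the product follows from linearity of the trilinear
form in its first two arguments.\<close>
lemma double_prod_bilinear:
  assumes md: "linear_pair m D" and "u \<in> double M" "v \<in> double M" "w \<in> double M"
  shows "double_prod M m D (u + v) w = double_prod M m D u w + double_prod M m D v w"
    "double_prod M m D w (u + v) = double_prod M m D w u + double_prod M m D w v"
    "double_prod M m D (double_smul M c u) w = double_smul M c (double_prod M m D u w)"
    "double_prod M m D w (double_smul M c u) = double_smul M c (double_prod M m D w u)"
proof -
  note * = form_double_prod[OF md] double_prod_closed[OF md] form_linear dual_op_bilinear[OF linear_pair_cop[OF md]]
  have t: "trilinear_form m D (u + v) w s = trilinear_form m D u w s + trilinear_form m D v w s"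
    "trilinear_form m D w (u + v) s = trilinear_form m D w u s + trilinear_form m D w v s"
    "trilinear_form m D (double_smul M c u) w s = c * trilinear_form m D u w s"
    "trilinear_form m D w (double_smul M c u) s = c * trilinear_form m D w u s"
    if "s \<in> double M" for s
    using assms that
    by (cases u; cases v; cases w; cases s;
      simp add: trilinear_form_def linear_pair_op[OF md] double_smul_def dual_op_closed[OF linear_pair_cop[OF md]]
        dual_op_bilinear[OF linear_pair_cop[OF md]] distrib_left add_ac)+
  show "double_prod M m D (u + v) w = double_prod M m D u w + double_prod M m D v w"
    "double_prod M m D w (u + v) = double_prod M m D w u + double_prod M m D w v"
    "double_prod M m D (double_smul M c u) w = double_smul M c (double_prod M m D u w)"
    "double_prod M m D w (double_smul M c u) = double_smul M c (double_prod M m D w u)"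
    by (rule double_eqI; use assms in \<open>simp add: * t\<close>)+
qed

lemma module_double: "module (double_smul M)"
  by unfold_locales
    (auto simp: double_smul_def V.scale_right_distrib V.scale_left_distrib V'.scale_right_distrib V'.scale_left_distrib)

sublocale W: module "double_smul M" by (fact module_double)

lemma subspaces_double:
  "module.subspace (double_smul M) (double M)"
  "module.subspace (double_smul M) (UNIV \<times> {0})"
  "module.subspace (double_smul M) ({0} \<times> dual M)"
  by (auto simp: W.subspace_def) (auto simp: double_smul_def zero_prod_def)

lemma double_prod_bilinear_op:
  assumes md: "linear_pair m D"
  shows "bilinear_op_on (double_smul M) (double M) (double_prod M m D)"
  unfolding bilinear_op_on_def
  by (simp add: module_double subspaces_double double_prod_bilinear[OF md] double_prod_closed[OF md])

lemma double_prod_pure: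
  assumes md: "linear_pair m D"
  shows "double_prod M m D (x, 0) (y, 0) = (m x y, 0)"
    and "a \<in> dual M \<Longrightarrow> b \<in> dual M \<Longrightarrow> double_prod M m D (0, a) (0, b) = (0, dual_op M D a b)"
  by (rule double_eqI; use assms in \<open>auto simp: form_double_prod[OF md] double_prod_closed[OF md]
    dual_op[OF linear_pair_cop[OF md]] trilinear_form_def double_form_Pair
    dual_op_zero[OF linear_pair_cop[OF md]] linear_pair_op[OF md]\<close>)+

lemma double_prod_subalgebras:
  assumes md: "linear_pair m D" and S: "S \<in> {UNIV \<times> {0}, {0} \<times> dual M}"
  shows "subalgebra_on (double_smul M) (double M) (double_prod M m D) S"
  using S subspaces_double double_prod_pure[OF md] dual_op_closed[OF linear_pair_cop[OF md]]
  by (auto simp: subalgebra_on_def)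

lemma double_prod_mixed:
  assumes md: "linear_pair m D" and a: "a \<in> dual M"
  shows "double_prod M m D (x, 0) (0, a) = (transp_bidual M (dual_op M D a) x, transp M (\<lambda>y. m y x) a)"
    and "double_prod M m D (0, a) (x, 0) = (transp_bidual M (\<lambda>c. dual_op M D c a) x, transp M (m x) a)"
  by (rule double_eqI; use a linear_pair_cop[OF md] in \<open>auto simp: form_double_prod[OF md]
    double_prod_closed[OF md] dual_op trilinear_form_def double_form_Pair transp_op[OF md] transp_bidual_op
    dual_op_zero linear_pair_op[OF md]\<close>)+

text \<open>The values of the four-linear form \<open>B (u v) (w s)\<close> on all sixteen patterns of vectors and functionals. The
inner products come from two possibly different pairs \<open>(m, D)\<close> and \<open>(m', D')\<close>, so that the same table
serves the associative product, the bracket, and the mixed expressions of the Leibniz rule.\<close>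
lemma four_form_pure:
  assumes md: "linear_pair m D" and md': "linear_pair m' D'"
  defines "q \<equiv> \<lambda>u v w s. double_form M (double_prod M m D u v) (double_prod M m' D' w s)"
    and "n \<equiv> dual_op M D" and "n' \<equiv> dual_op M D'"
    and "L \<equiv> \<lambda>x. transp M (m x)" and "R \<equiv> \<lambda>x. transp M (\<lambda>y. m y x)"
    and "L' \<equiv> \<lambda>x. transp M (m' x)" and "R' \<equiv> \<lambda>x. transp M (\<lambda>y. m' y x)"
  shows "q (x, 0) (y, 0) (z, 0) (t, 0) = 0"
    and "a \<in> dual M \<Longrightarrow> b \<in> dual M \<Longrightarrow> c \<in> dual M \<Longrightarrow> d \<in> dual M \<Longrightarrow> q (0, a) (0, b) (0, c) (0, d) = 0"
    and "a \<in> dual M \<Longrightarrow> q (x, 0) (y, 0) (z, 0) (0, a) = pairing M a (m' (m x y) z)"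
    and "a \<in> dual M \<Longrightarrow> q (x, 0) (y, 0) (0, a) (z, 0) = pairing M a (m' z (m x y))"
    and "a \<in> dual M \<Longrightarrow> q (x, 0) (0, a) (y, 0) (z, 0) = pairing M a (m (m' y z) x)"
    and "a \<in> dual M \<Longrightarrow> q (0, a) (x, 0) (y, 0) (z, 0) = pairing M a (m x (m' y z))"
    and "a \<in> dual M \<Longrightarrow> b \<in> dual M \<Longrightarrow> c \<in> dual M \<Longrightarrow> q (0, a) (0, b) (0, c) (x, 0) = pairing M (n' (n a b) c) x"
    and "a \<in> dual M \<Longrightarrow> b \<in> dual M \<Longrightarrow> c \<in> dual M \<Longrightarrow> q (0, a) (0, b) (x, 0) (0, c) = pairing M (n' c (n a b)) x"
    and "a \<in> dual M \<Longrightarrow> b \<in> dual M \<Longrightarrow> c \<in> dual M \<Longrightarrow> q (0, a) (x, 0) (0, b) (0, c) = pairing M (n (n' b c) a) x"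
    and "a \<in> dual M \<Longrightarrow> b \<in> dual M \<Longrightarrow> c \<in> dual M \<Longrightarrow> q (x, 0) (0, a) (0, b) (0, c) = pairing M (n a (n' b c)) x"
    and "a \<in> dual M \<Longrightarrow> b \<in> dual M \<Longrightarrow> q (x, 0) (y, 0) (0, a) (0, b) = pairing M (n' a b) (m x y)"
    and "a \<in> dual M \<Longrightarrow> b \<in> dual M \<Longrightarrow> q (0, a) (0, b) (x, 0) (y, 0) = pairing M (n a b) (m' x y)"
    and "a \<in> dual M \<Longrightarrow> b \<in> dual M \<Longrightarrow> q (x, 0) (0, a) (0, b) (y, 0) = pairing M (n' (R x a) b) y + pairing M (n a (L' y b)) x"
    and "a \<in> dual M \<Longrightarrow> b \<in> dual M \<Longrightarrow> q (0, a) (x, 0) (y, 0) (0, b) = pairing M (n' b (L x a)) y + pairing M (n (R' y b) a) x"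
    and "a \<in> dual M \<Longrightarrow> b \<in> dual M \<Longrightarrow> q (x, 0) (0, a) (y, 0) (0, b) = pairing M (n' b (R x a)) y + pairing M (n a (R' y b)) x"
    and "a \<in> dual M \<Longrightarrow> b \<in> dual M \<Longrightarrow> q (0, a) (x, 0) (0, b) (y, 0) = pairing M (n' (L x a) b) y + pairing M (n (L' y b) a) x"
  using linear_pair_cop[OF md] linear_pair_cop[OF md']
  by (simp_all add: q_def n_def n'_def L_def L'_def R_def R'_def double_form_Pair
      double_prod_mixed[OF md] double_prod_mixed[OF md'] double_prod_pure[OF md] double_prod_pure[OF md']
      transp_op[OF md] transp_op[OF md'] transp_bidual_op dual_op_closed)


section \<open>Associativity of the double and ASI bialgebras\<close>

lemma double_zeroI:
  assumes add: "\<And>u v. u \<in> double M \<Longrightarrow> v \<in> double M \<Longrightarrow> g (u + v) = g u + (g v :: 'r)"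
    and V: "\<And>x. g (x, 0) = 0" and D: "\<And>a. a \<in> dual M \<Longrightarrow> g (0, a) = 0"
    and u: "u \<in> double M"
  shows "g u = 0"
proof -
  obtain x a where xa: "u = (x, a)" "a \<in> dual M" using u by (cases u) auto
  have "g ((x, 0) + (0, a)) = g (x, 0) + g (0, a)" using xa by (intro add) auto
  then show ?thesis using V D xa by simp
qed

text \<open>By invariance \<open>B ((u v) w) s = B (u v) (w s)\<close> and \<open>B (u (v w)) s = B (v w) (s u)\<close>, so associativity is
invariance of the four-linear form under one rotation.\<close>
lemma assoc_iff_cyclic:
  assumes md: "linear_pair m D"
  defines "p \<equiv> double_prod M m D"
  shows "assoc_algebra_on (double_smul M) (double M) p \<longleftrightarrow>
    (\<forall>u\<in>double M. \<forall>v\<in>double M. \<forall>w\<in>double M. \<forall>s\<in>double M.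
       double_form M (p u v) (p w s) = double_form M (p v w) (p s u))"
proof -
  note cl = double_prod_closed[OF md, folded p_def]
  have inv: "double_form M (p u v) w = double_form M u (p v w)"
    if "u \<in> double M" "v \<in> double M" "w \<in> double M" for u v w
    using double_prod_invariant[OF md] that by (simp add: invariant_on_def p_def)
  have 1: "double_form M (p (p u v) w) s = double_form M (p u v) (p w s)"
    and 2: "double_form M (p u (p v w)) s = double_form M (p v w) (p s u)"
    if "u \<in> double M" "v \<in> double M" "w \<in> double M" "s \<in> double M" for u v w s
  proof -
    show "double_form M (p (p u v) w) s = double_form M (p u v) (p w s)"
      using that by (simp add: inv cl)
    have "double_form M (p u (p v w)) s = double_form M s (p u (p v w))" by (rule form_sym)
    also have "\<dots> = double_form M (p s u) (p v w)" using that by (simp add: inv cl)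
    finally show "double_form M (p u (p v w)) s = double_form M (p v w) (p s u)"
      by (simp add: form_sym)
  qed
  have "p (p u v) w = p u (p v w) \<longleftrightarrow>
      (\<forall>s\<in>double M. double_form M (p u v) (p w s) = double_form M (p v w) (p s u))"
    if "u \<in> double M" "v \<in> double M" "w \<in> double M" for u v w
  proof
    assume "p (p u v) w = p u (p v w)"
    then show "\<forall>s\<in>double M. double_form M (p u v) (p w s) = double_form M (p v w) (p s u)"
      using 1[OF that] 2[OF that] by simp
  next
    assume *: "\<forall>s\<in>double M. double_form M (p u v) (p w s) = double_form M (p v w) (p s u)"
    show "p (p u v) w = p u (p v w)"
      by (rule double_eqI) (use that cl 1[OF that] 2[OF that] * in simp_all)
  qed
  then show ?thesis
    using double_prod_bilinear_op[OF md, folded p_def] by (simp add: assoc_algebra_on_def)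
qed

text \<open>The axioms of an ASI bialgebra after testing against functionals. Both sides of each condition, the
first one tested against a functional, are entries of the table in \<open>four_form_pure\<close>.\<close>
lemma asi_bialgebra_iff_cyclic:
  assumes md: "linear_pair m D"
  defines "n \<equiv> dual_op M D" and "L \<equiv> \<lambda>x. transp M (m x)" and "R \<equiv> \<lambda>x. transp M (\<lambda>y. m y x)"
  shows "asi_bialgebra M m D \<longleftrightarrow>
    (\<forall>x y z. m (m x y) z = m x (m y z)) \<and>
    (\<forall>a\<in>dual M. \<forall>b\<in>dual M. \<forall>c\<in>dual M. \<forall>x. pairing M (n (n a b) c) x = pairing M (n a (n b c)) x) \<and>
    (\<forall>a\<in>dual M. \<forall>b\<in>dual M. \<forall>x y. pairing M (n a b) (m x y) = pairing M (n (R y a) b) x + pairing M (n a (L x b)) y) \<and>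
    (\<forall>a\<in>dual M. \<forall>b\<in>dual M. \<forall>x y. pairing M (n b (R x a)) y + pairing M (n a (R y b)) x =
       pairing M (n (L y a) b) x + pairing M (n (L x b) a) y)"
proof -
  note D = linear_pair_cop[OF md]
  note lin = linear_pair_left[OF md] linear_pair_right[OF md] linear1_id
  have 1: "assoc_algebra_on (smul M) UNIV m \<longleftrightarrow> (\<forall>x y z. m (m x y) z = m x (m y z))"
    by (auto simp: assoc_algebra_on_def bilinear_op_on_def V.module_axioms linear_pair_op[OF md] V.subspace_UNIV)
  have 2: "coassociative M D \<longleftrightarrow>
    (\<forall>a\<in>dual M. \<forall>b\<in>dual M. \<forall>c\<in>dual M. \<forall>x. pairing M (n (n a b) c) x = pairing M (n a (n b c)) x)"
  proof -
    have "cop_id M D t = id_cop M D t' \<longleftrightarrow>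
      (\<forall>a\<in>dual M. \<forall>b\<in>dual M. \<forall>c\<in>dual M. pair2 (n a b) c t = pair2 a (n b c) t')" for t t'
      using tensor3_eqI[of "cop_id M D t" "id_cop M D t'"]
      by (auto simp: pair3_cop_id[OF D, folded n_def] pair3_id_cop[OF D, folded n_def])
        (metis pair3_cop_id[OF D, folded n_def] pair3_id_cop[OF D, folded n_def])+
    then show ?thesis
      using D by (auto simp: coassociative_def n_def dual_op[OF D])
  qed
  have 3: "D (m x y) = tmap M id (m x) (D y) + tmap M (\<lambda>z. m z y) id (D x) \<longleftrightarrow>
     (\<forall>a\<in>dual M. \<forall>b\<in>dual M. pairing M (n a b) (m x y) = pairing M (n (R y a) b) x + pairing M (n a (L x b)) y)" (is "?l = ?r \<longleftrightarrow> _") for x y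
  proof -
    have "pair2 a b ?l = pairing M (n a b) (m x y)"
      "pair2 a b ?r = pairing M (n (R y a) b) x + pairing M (n a (L x b)) y"
      if "a \<in> dual M" "b \<in> dual M" for a b
      using that by (simp_all add: n_def dual_op[OF D] L_def R_def lin)
    then show ?thesis using tensor2_eqI[of ?l ?r] by metis
  qed
  have 4: "(tmap M (m y) id (D x) - tmap M id (\<lambda>z. m z y) (D x)) +
      flip M (tmap M (m x) id (D y) - tmap M id (\<lambda>z. m z x) (D y)) = 0 \<longleftrightarrow>
     (\<forall>a\<in>dual M. \<forall>b\<in>dual M. pairing M (n b (R x a)) y + pairing M (n a (R y b)) x =
       pairing M (n (L y a) b) x + pairing M (n (L x b) a) y)" (is "?l = 0 \<longleftrightarrow> _") for x y
  proof -
    have l: "pair2 a b ?l = (pairing M (n (L y a) b) x + pairing M (n (L x b) a) y)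
        - (pairing M (n b (R x a)) y + pairing M (n a (R y b)) x)" "pair2 a b 0 = 0"
      if "a \<in> dual M" "b \<in> dual M" for a b
      using that by (simp_all add: n_def dual_op[OF D] L_def R_def lin)
    show ?thesis
    proof
      assume "?l = 0"
      then show "\<forall>a\<in>dual M. \<forall>b\<in>dual M. pairing M (n b (R x a)) y + pairing M (n a (R y b)) x =
          pairing M (n (L y a) b) x + pairing M (n (L x b) a) y"
        using l by (metis eq_iff_diff_eq_0)
    next
      assume "\<forall>a\<in>dual M. \<forall>b\<in>dual M. pairing M (n b (R x a)) y + pairing M (n a (R y b)) x =
          pairing M (n (L y a) b) x + pairing M (n (L x b) a) y"
      then show "?l = 0" by (intro tensor2_eqI) (simp only: l, simp)
    qed
  qed
  show ?thesis unfolding asi_bialgebra_def 1 2 3 4 by blast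
qed

text \<open>One half expands the difference of the two sides of the cyclic symmetry into pure
arguments, where each of the sixteen patterns is trivial, an axiom, or an axiom read from a rotated
starting point; the other half reads the axioms off four of the patterns.\<close>
lemma asi_bialgebra_iff_assoc:
  assumes md: "linear_pair m D"
  shows "asi_bialgebra M m D \<longleftrightarrow>
    assoc_algebra_on (double_smul M) (double M) (double_prod M m D)"
proof
  define p where "p = double_prod M m D"
  note q = four_form_pure[OF md md, folded p_def]
  assume asi: "asi_bialgebra M m D"
  note cond = asi[unfolded asi_bialgebra_iff_cyclic[OF md]]
  define g where "g u v w s = double_form M (p u v) (p w s) - double_form M (p v w) (p s u)" for u v w s
  note cl = double_prod_closed[OF md, folded p_def]
  have add: "g (u + u') v w s = g u v w s + g u' v w s" "g v (u + u') w s = g v u w s + g v u' w s"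
    "g v w (u + u') s = g v w u s + g v w u' s" "g v w s (u + u') = g v w s u + g v w s u'"
    if "u \<in> double M" "u' \<in> double M" "v \<in> double M" "w \<in> double M" "s \<in> double M" for u u' v w s
    using that by (simp_all add: g_def double_prod_bilinear[OF md, folded p_def] cl form_linear form_linear_right)
  note [simp] = cond[THEN conjunct1, rule_format]
  have c: "\<And>a b c x. a \<in> dual M \<Longrightarrow> b \<in> dual M \<Longrightarrow> c \<in> dual M \<Longrightarrow>
      pairing M (dual_op M D (dual_op M D a b) c) x = pairing M (dual_op M D a (dual_op M D b c)) x"
    "\<And>a b x y. a \<in> dual M \<Longrightarrow> b \<in> dual M \<Longrightarrow> pairing M (dual_op M D a b) (m x y)
       = pairing M (dual_op M D (transp M (\<lambda>z. m z y) a) b) x + pairing M (dual_op M D a (transp M (m x) b)) y"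
    "\<And>a b x y. a \<in> dual M \<Longrightarrow> b \<in> dual M \<Longrightarrow> pairing M (dual_op M D b (transp M (\<lambda>z. m z x) a)) y
          + pairing M (dual_op M D a (transp M (\<lambda>z. m z y) b)) x =
       pairing M (dual_op M D (transp M (m y) a) b) x + pairing M (dual_op M D (transp M (m x) b) a) y"
    using cond by blast+
  define P :: "('v \<times> 'u) set" where "P = range (\<lambda>x. (x, 0)) \<union> (\<lambda>a. (0, a)) ` dual M"
  have P: "u \<in> P \<Longrightarrow> u \<in> double M" for u by (auto simp: P_def)
  have 0: "g u v w s = 0" if "u \<in> P" "v \<in> P" "w \<in> P" "s \<in> P" for u v w s
    using that unfolding P_def g_def by (elim UnE imageE; simp add: q c)
  have P0: "(x, 0) \<in> P" and P1: "a \<in> dual M \<Longrightarrow> (0, a) \<in> P" for x a by (auto simp: P_def)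
  \<comment> \<open>Free one argument at a time, using additivity in that argument.\<close>
  have 1: "g u v w s = 0" if "u \<in> P" "v \<in> P" "w \<in> P" "s \<in> double M" for u v w s
    by (rule double_zeroI[of "\<lambda>s. g u v w s"]) (simp_all add: that P P0 P1 add 0)
  have 2: "g u v w s = 0" if "u \<in> P" "v \<in> P" "w \<in> double M" "s \<in> double M" for u v w s
    by (rule double_zeroI[of "\<lambda>w. g u v w s"]) (simp_all add: that P P0 P1 add 1)
  have 3: "g u v w s = 0" if "u \<in> P" "v \<in> double M" "w \<in> double M" "s \<in> double M" for u v w s
    by (rule double_zeroI[of "\<lambda>v. g u v w s"]) (simp_all add: that P P0 P1 add 2)
  have "g u v w s = 0" if "u \<in> double M" "v \<in> double M" "w \<in> double M" "s \<in> double M" for u v w s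
    by (rule double_zeroI[of "\<lambda>u. g u v w s"]) (simp_all add: that P P0 P1 add 3)
  then show "assoc_algebra_on (double_smul M) (double M) (double_prod M m D)"
    unfolding assoc_iff_cyclic[OF md] g_def p_def right_minus_eq by blast
next
  define p where "p = double_prod M m D"
  note q = four_form_pure[OF md md, folded p_def]
  assume assoc: "assoc_algebra_on (double_smul M) (double M) (double_prod M m D)"
  then have cyc: "double_form M (p u v) (p w s) = double_form M (p v w) (p s u)"
    if "u \<in> double M" "v \<in> double M" "w \<in> double M" "s \<in> double M" for u v w s
    using that unfolding assoc_iff_cyclic[OF md] p_def by blast
  show "asi_bialgebra M m D"
    unfolding asi_bialgebra_iff_cyclic[OF md]
  proof (intro conjI allI ballI)
    show "m (m x y) z = m x (m y z)" for x y z
    proof (rule vector_eqI)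
      fix a assume "a \<in> dual M"
      then show "pairing M a (m (m x y) z) = pairing M a (m x (m y z))"
        using cyc[of "(x, 0)" "(y, 0)" "(z, 0)" "(0, a)"] by (simp add: q)
    qed
    fix a b x assume a: "a \<in> dual M" "b \<in> dual M"
    show "pairing M (dual_op M D (dual_op M D a b) c) x = pairing M (dual_op M D a (dual_op M D b c)) x"
      if "c \<in> dual M" for c
      using cyc[of "(0, a)" "(0, b)" "(0, c)" "(x, 0)"] a that by (simp add: q)
    fix y
    show "pairing M (dual_op M D a b) (m x y) = pairing M (dual_op M D (transp M (\<lambda>z. m z y) a) b) x
        + pairing M (dual_op M D a (transp M (m x) b)) y"
      using cyc[of "(x, 0)" "(y, 0)" "(0, a)" "(0, b)"] a by (simp add: q)
    show "pairing M (dual_op M D b (transp M (\<lambda>z. m z x) a)) y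
          + pairing M (dual_op M D a (transp M (\<lambda>z. m z y) b)) x =
       pairing M (dual_op M D (transp M (m y) a) b) x + pairing M (dual_op M D (transp M (m x) b) a) y"
      using cyc[of "(x, 0)" "(0, a)" "(y, 0)" "(0, b)"] a by (simp add: q)
  qed
qed

lemma assoc_manin_triple_iff:
  assumes md: "linear_pair m D"
  shows "assoc_manin_triple M (double_prod M m D) \<longleftrightarrow> asi_bialgebra M m D"
  unfolding assoc_manin_triple_def asi_bialgebra_iff_assoc[OF md]
  using double_prod_subalgebras[OF md] double_prod_invariant[OF md] by simp

lemma cocommutative_iff:
  assumes D: "linear12 D"
  shows "cocommutative M D \<longleftrightarrow> commutative_on (dual M) (dual_op M D)"
proof
  assume "cocommutative M D"
  then have f: "D x = flip M (D x)" for x by (simp add: cocommutative_def)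
  have "dual_op M D a b = dual_op M D b a" if ab: "a \<in> dual M" "b \<in> dual M" for a b
  proof (rule dual_eqI)
    show "pairing M (dual_op M D a b) x = pairing M (dual_op M D b a) x" for x
      using ab by (simp add: dual_op[OF D]) (subst f, simp)
  qed (use ab D in \<open>auto simp: dual_op\<close>)
  then show "commutative_on (dual M) (dual_op M D)" by (simp add: commutative_on_def)
next
  assume c: "commutative_on (dual M) (dual_op M D)"
  show "cocommutative M D"
    unfolding cocommutative_def
  proof (intro allI tensor2_eqI)
    fix x a b assume ab: "a \<in> dual M" "b \<in> dual M"
    then have "dual_op M D a b = dual_op M D b a" using c by (simp add: commutative_on_def)
    then show "pair2 a b (D x) = pair2 a b (flip M (D x))"
      using ab pairing_dual_op[OF D ab, of x] pairing_dual_op[OF D ab(2,1), of x] by simp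
  qed
qed

lemma commutative_double_iff:
  assumes md: "linear_pair m D"
  shows "commutative_on (double M) (double_prod M m D) \<longleftrightarrow> commutative_on UNIV m \<and> cocommutative M D"
proof
  assume c: "commutative_on (double M) (double_prod M m D)"
  have "m x y = m y x" for x y
  proof -
    have "double_prod M m D (x, 0) (y, 0) = double_prod M m D (y, 0) (x, 0)"
      using c by (simp add: commutative_on_def)
    then show ?thesis by (simp add: double_prod_pure[OF md])
  qed
  moreover have "dual_op M D a b = dual_op M D b a" if "a \<in> dual M" "b \<in> dual M" for a b
  proof -
    have "double_prod M m D (0, a) (0, b) = double_prod M m D (0, b) (0, a)"
      using c that by (simp add: commutative_on_def)
    then show ?thesis using that by (simp add: double_prod_pure[OF md])
  qed
  ultimately show "commutative_on UNIV m \<and> cocommutative M D"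
    unfolding cocommutative_iff[OF linear_pair_cop[OF md]] commutative_on_def by blast
next
  assume c: "commutative_on UNIV m \<and> cocommutative M D"
  have "double_prod M m D u v = double_prod M m D v u" if uv: "u \<in> double M" "v \<in> double M" for u v
  proof (rule double_eqI)
    fix w assume w: "w \<in> double M"
    have "trilinear_form m D u v w = trilinear_form m D v u w"
      using c uv w unfolding cocommutative_iff[OF linear_pair_cop[OF md]]
      by (cases u; cases v; cases w) (simp add: trilinear_form_def commutative_on_def)
    then show "double_form M (double_prod M m D u v) w = double_form M (double_prod M m D v u) w"
      using uv w by (simp add: form_double_prod[OF md])
  qed (use uv double_prod_closed[OF md] in auto)
  then show "commutative_on (double M) (double_prod M m D)" by (simp add: commutative_on_def)
qed

lemma comm_assoc_manin_triple_iff: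
  assumes md: "linear_pair m D"
  shows "comm_assoc_manin_triple M (double_prod M m D) \<longleftrightarrow> comm_cocomm_asi_bialgebra M m D"
  unfolding comm_assoc_manin_triple_def comm_cocomm_asi_bialgebra_def
    assoc_manin_triple_iff[OF md] commutative_double_iff[OF md] by blast

end

section \<open>Poisson brackets on the double\<close>

context framed_space
begin

lemma dual_op_neg:
  assumes D: "linear12 D" and a: "a \<in> dual M" "b \<in> dual M"
  shows "dual_op M D (- a) b = - dual_op M D a b" and "dual_op M D a (- b) = - dual_op M D a b"
proof -
  have "pair2 (- a) b t = - pair2 a b t" "pair2 a (- b) t = - pair2 a b t" for t
    using pair2_left(3)[of a a b "- 1" t] pair2_left(4)[of b b a "- 1" t] a by simp_all
  then show "dual_op M D (- a) b = - dual_op M D a b" and "dual_op M D a (- b) = - dual_op M D a b"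
    using a by (auto intro!: dual_eqI simp: dual_op[OF D])
qed

lemma dual_op_antisym:
  assumes D: "linear12 d" and anti: "\<And>x. d x = - flip M (d x)" and a: "a \<in> dual M" "b \<in> dual M"
  shows "dual_op M d a b = - dual_op M d b a"
proof (rule dual_eqI)
  show "pairing M (dual_op M d a b) x = pairing M (- dual_op M d b a) x" for x
    using a by (simp add: dual_op[OF D]) (subst anti, simp)
qed (use a D in \<open>auto simp: dual_op\<close>)

lemma transp_antisym:
  assumes bd: "linear_pair br d" and anti: "\<And>x y. br x y = - br y x" and a: "a \<in> dual M"
  shows "transp M (\<lambda>z. br z x) a = - transp M (br x) a"
proof (rule dual_eqI)
  show "pairing M (transp M (\<lambda>z. br z x) a) z = pairing M (- transp M (br x) a) z" for z
    using a by (simp add: transp_op[OF bd]) (subst anti, simp add: a)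
qed (use a transp_op[OF bd] in auto)

text \<open>The signs in the formula for the bracket on the double are those produced by antisymmetry from the
formula for the product. Hence everything proved about products applies to brackets.\<close>
lemma double_bracket_eq:
  assumes bd: "linear_pair br d" and anti: "\<And>x y. br x y = - br y x" "\<And>x. d x = - flip M (d x)"
    and "u \<in> double M" "v \<in> double M"
  shows "double_bracket M br d u v = double_prod M br d u v"
proof -
  obtain x a y b where uv: "u = (x, a)" "v = (y, b)" "a \<in> dual M" "b \<in> dual M"
    using assms(4,5) by (cases u; cases v) auto
  note d = linear_pair_cop[OF bd]
  have "- transp_bidual M (dual_op M d a) y = transp_bidual M (\<lambda>c. dual_op M d c a) y"
  proof (rule vector_eqI)
    fix c assume c: "c \<in> dual M"
    then show "pairing M c (- transp_bidual M (dual_op M d a) y)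
        = pairing M c (transp_bidual M (\<lambda>c. dual_op M d c a) y)"
      using uv(3) by (simp add: transp_bidual_op[OF d] dual_op_antisym[OF d anti(2), of a c])
  qed
  from this[symmetric] show ?thesis
    by (simp add: uv double_bracket_def Let_def double_prod_Pair transp_antisym[OF bd anti(1)])
qed

text \<open>Restricting the Poisson axioms of the double to \<open>A\<close> gives the Poisson algebra, and restricting them to
\<open>A\<^sup>*\<close> gives, by duality, the Poisson coalgebra. The three compatibility conditions are the Jacobi and
Leibniz rules with two arguments in \<open>A\<close>, two in \<open>A\<^sup>*\<close>, rewritten by invariance into values of
four-linear forms (the facts \<open>J\<close> and \<open>Lb\<close> in the proof).\<close>
lemma poisson_bialgebra_of_double:
  assumes md: "linear_pair m D" and bd: "linear_pair br d"
    and anti: "\<And>x y. br x y = - br y x" "\<And>x. d x = - flip M (d x)"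
    and asi: "comm_cocomm_asi_bialgebra M m D"
    and poisson: "poisson_algebra_on (double_smul M) (double M) (double_prod M br d) (double_prod M m D)"
  shows "poisson_bialgebra M br m d D"
proof -
  define p where "p = double_prod M m D"
  define l where "l = double_prod M br d"
  define n where "n = dual_op M D"
  define k where "k = dual_op M d"
  note clp = double_prod_closed[OF md, folded p_def] and cll = double_prod_closed[OF bd, folded l_def]
  note D = linear_pair_cop[OF md] and d = linear_pair_cop[OF bd]
  have lie: "l u u = 0" and jac: "l u (l v w) + l v (l w u) + l w (l u v) = 0"
    and leib: "l u (p v w) = p (l u v) w + p v (l u w)" and comm: "p u v = p v u"
    if "u \<in> double M" "v \<in> double M" "w \<in> double M" for u v w
    using poisson that
    unfolding poisson_algebra_on_def lie_algebra_on_def commutative_on_def p_def l_def by blast+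
  have invp: "double_form M (p u v) w = double_form M u (p v w)"
    and invl: "double_form M (l u v) w = double_form M u (l v w)"
    if "u \<in> double M" "v \<in> double M" "w \<in> double M" for u v w
    using double_prod_invariant[OF md] double_prod_invariant[OF bd] that
    by (simp_all add: invariant_on_def p_def l_def)
  have skew: "l u v = - l v u" if "u \<in> double M" "v \<in> double M" for u v
  proof -
    have "l (u + v) (u + v) = l u u + l u v + (l v u + l v v)"
      using that by (simp add: l_def double_prod_bilinear[OF bd] algebra_simps)
    then show ?thesis using that by (simp add: lie eq_neg_iff_add_eq_0)
  qed
  have J: "double_form M (l s u) (l v w) + double_form M (l s v) (l w u) + double_form M (l s w) (l u v) = 0"
    if "u \<in> double M" "v \<in> double M" "w \<in> double M" "s \<in> double M" for u v w s
  proof -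
    have "double_form M s (l u (l v w) + l v (l w u) + l w (l u v)) = 0"
      using that by (simp add: jac form_linear_right)
    then show ?thesis using that by (simp add: form_linear_right invl cll)
  qed
  have Lb: "double_form M (l s u) (p v w) = double_form M (l u v) (p w s) + double_form M (l u w) (p s v)"
    if "u \<in> double M" "v \<in> double M" "w \<in> double M" "s \<in> double M" for u v w s
  proof -
    have "double_form M (l s u) (p v w) = double_form M s (l u (p v w))"
      using that by (simp add: invl clp)
    also have "\<dots> = double_form M s (p w (l u v)) + double_form M s (p v (l u w))"
      using that by (simp add: leib clp cll form_linear_right comm[of "l u v" w])
    also have "double_form M s (p v (l u w)) = double_form M (p s v) (l u w)"
      using that by (simp add: invp cll)
    also have "double_form M s (p w (l u v)) = double_form M (l u v) (p w s)"
      using that comm[of w s] invp[of s w "l u v"] by (simp add: cll form_sym[of _ "l u v"])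
    finally show ?thesis by (simp add: form_sym)
  qed
  note qll = four_form_pure[OF bd bd, folded l_def k_def]
    and qlp = four_form_pure[OF bd md, folded l_def p_def k_def n_def]
  have mc: "m x y = m y x" for x y
    using asi by (simp add: comm_cocomm_asi_bialgebra_def commutative_on_def)
  have nc: "n a b = n b a" if "a \<in> dual M" "b \<in> dual M" for a b
    using asi that cocommutative_iff[OF D]
    by (simp add: comm_cocomm_asi_bialgebra_def commutative_on_def n_def)
  have kc: "k a b = - k b a" if "a \<in> dual M" "b \<in> dual M" for a b
    using dual_op_antisym[OF d anti(2) that] by (simp add: k_def)
  have Rm: "transp M (\<lambda>z. m z x) = transp M (m x)" for x
    using mc by (intro arg_cong[of _ _ "transp M"]) blast
  note Rl = transp_antisym[OF bd anti(1)]
  note cl [simp] = transp_op[OF md] transp_op[OF bd] dual_op_closed[OF D, folded n_def] dual_op_closed[OF d, folded k_def]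
  note neg [simp] = dual_op_neg[OF D, folded n_def] dual_op_neg[OF d, folded k_def]
  note lin [simp] = linear_pair_left[OF md] linear_pair_left[OF bd] linear1_id
  have n2: "pair2 a b (D x) = pairing M (n a b) x" and k2: "pair2 a b (d x) = pairing M (k a b) x"
    if "a \<in> dual M" "b \<in> dual M" for a b x
    using that by (simp_all add: n_def k_def dual_op[OF D] dual_op[OF d])
  have br0: "br x x = 0" for x
    using lie[of "(x, 0)" 0 0] by (simp add: l_def double_prod_pure[OF bd] zero_prod_def)
  have pois: "poisson_algebra_on (smul M) UNIV br m"
  proof -
    have 1: "br x (br y z) + br y (br z x) + br z (br x y) = 0" for x y z
      using jac[of "(x, 0)" "(y, 0)" "(z, 0)"] by (simp add: l_def double_prod_pure[OF bd] zero_prod_def)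
    have 2: "br x (m y z) = m (br x y) z + m y (br x z)" for x y z
      using leib[of "(x, 0)" "(y, 0)" "(z, 0)"]
      by (simp add: l_def p_def double_prod_pure[OF bd] double_prod_pure[OF md])
    have 3: "bilinear_op_on (smul M) UNIV br"
      by (simp add: bilinear_op_on_def V.module_axioms linear_pair_op[OF bd])
    show ?thesis
      using asi 1 2 3 br0
      by (simp add: poisson_algebra_on_def lie_algebra_on_def comm_cocomm_asi_bialgebra_def asi_bialgebra_def)
  qed
  have coalg: "lie_coalgebra M d"
    unfolding lie_coalgebra_def
  proof (intro conjI allI d anti)
    fix x
    show "id_cop M d (d x) + cyc M (id_cop M d (d x)) + cyc M (cyc M (id_cop M d (d x))) = 0"
    proof (rule tensor3_eqI)
      fix a b c assume a: "a \<in> dual M" "b \<in> dual M" "c \<in> dual M"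
      have "k a (k b c) + k b (k c a) + k c (k a b) = 0"
        using jac[of "(0, a)" "(0, b)" "(0, c)"] a
        by (simp add: l_def double_prod_pure[OF bd, folded k_def] zero_prod_def)
      then have "pairing M (k a (k b c) + k b (k c a) + k c (k a b)) x = 0" by simp
      then show "pair3 a b c (id_cop M d (d x) + cyc M (id_cop M d (d x)) + cyc M (cyc M (id_cop M d (d x))))
          = pair3 a b c 0"
        using a by (simp add: pair3_id_cop[OF d, folded k_def] k2)
    qed
  qed
  have bialg: "d (br x y) = (tmap M (br x) id (d y) + tmap M id (br x) (d y))
      - (tmap M (br y) id (d x) + tmap M id (br y) (d x))" for x y
  proof (rule tensor2_eqI)
    fix a b assume a: "a \<in> dual M" "b \<in> dual M"
    show "pair2 a b (d (br x y)) = pair2 a b ((tmap M (br x) id (d y) + tmap M id (br x) (d y))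
      - (tmap M (br y) id (d x) + tmap M id (br y) (d x)))"
      \<comment> \<open>In this order the first term of \<open>J\<close> is \<open>\<langle>k a b, br x y\<rangle>\<close>.\<close>
      using J[of "(y, 0)" "(0, a)" "(0, b)" "(x, 0)"] a kc[of "transp M (br y) a" b]
      by (simp add: qll Rl k2) (simp add: algebra_simps)
  qed
  have copois: "id_cop M D (d x) = cop_id M d (D x) + flip_id M (id_cop M d (D x))" for x
  proof (rule tensor3_eqI)
    fix a b c assume a: "a \<in> dual M" "b \<in> dual M" "c \<in> dual M"
    have "k a (n b c) = n (k a b) c + n b (k a c)"
      using leib[of "(0, a)" "(0, b)" "(0, c)"] a
      by (simp add: l_def p_def double_prod_pure[OF bd, folded k_def] double_prod_pure[OF md, folded n_def])
    then have "pairing M (k a (n b c)) x = pairing M (n (k a b) c + n b (k a c)) x" by simp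
    then show "pair3 a b c (id_cop M D (d x)) = pair3 a b c (cop_id M d (D x) + flip_id M (id_cop M d (D x)))"
      using a by (simp add: pair3_id_cop[OF d, folded k_def] pair3_id_cop[OF D, folded n_def]
          pair3_cop_id[OF d, folded k_def] k2 n2)
  qed
  have dm: "d (m x y) = tmap M (m y) id (d x) + tmap M (m x) id (d y)
        + tmap M id (br x) (D y) + tmap M id (br y) (D x)" for x y
  proof (rule tensor2_eqI)
    fix a b assume a: "a \<in> dual M" "b \<in> dual M"
    show "pair2 a b (d (m x y)) = pair2 a b (tmap M (m y) id (d x) + tmap M (m x) id (d y)
        + tmap M id (br x) (D y) + tmap M id (br y) (D x))"
      \<comment> \<open>The bracket of functionals meets the product of vectors: the left side of \<open>Lb\<close> is \<open>\<langle>k a b, m x y\<rangle>\<close>.\<close>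
      using Lb[of "(0, b)" "(x, 0)" "(y, 0)" "(0, a)"] a nc[of a "transp M (br y) b"]
      by (simp add: qlp Rl Rm k2 n2 algebra_simps)
  qed
  have Db: "D (br x y) = (tmap M (br x) id (D y) + tmap M id (br x) (D y))
        + (tmap M (m y) id (d x) - tmap M id (m y) (d x))" for x y
  proof (rule tensor2_eqI)
    fix a b assume a: "a \<in> dual M" "b \<in> dual M"
    show "pair2 a b (D (br x y)) = pair2 a b ((tmap M (br x) id (D y) + tmap M id (br x) (D y))
        + (tmap M (m y) id (d x) - tmap M id (m y) (d x)))"
      \<comment> \<open>The bracket of vectors meets the product of functionals: the left side of \<open>Lb\<close> is \<open>\<langle>n a b, br y x\<rangle>\<close>.\<close>
      using Lb[of "(x, 0)" "(0, a)" "(0, b)" "(y, 0)"] a kc[of b "transp M (m y) a"] anti(1)[of y x]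
      by (simp add: qlp Rl Rm k2 n2) (simp add: algebra_simps)
  qed
  have "poisson_coalgebra M d D" "lie_bialgebra M br d"
    using coalg copois asi pois bialg
    by (auto simp: poisson_coalgebra_def comm_cocomm_asi_bialgebra_def asi_bialgebra_def
        lie_bialgebra_def poisson_algebra_on_def)
  then show ?thesis
    using pois asi dm Db by (simp add: poisson_bialgebra_def)
qed

text \<open>The double determines its ingredients: \<open>m\<close> is the product of vectors and the dual operation of \<open>D\<close> the
product of functionals.\<close>
lemma linear_pair_eqI:
  assumes md: "linear_pair m D" and md': "linear_pair m' D'"
    and eq: "\<And>u v. u \<in> double M \<Longrightarrow> v \<in> double M \<Longrightarrow> double_prod M m D u v = double_prod M m' D' u v"
  shows "m = m'" and "D = D'"
proof -
  show "m = m'"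
  proof (intro ext)
    show "m x y = m' x y" for x y
      using eq[of "(x, 0)" "(y, 0)"] by (simp add: double_prod_pure[OF md] double_prod_pure[OF md'])
  qed
  show "D = D'"
  proof (intro ext tensor2_eqI)
    fix x a b assume a: "a \<in> dual M" "b \<in> dual M"
    then have "dual_op M D a b = dual_op M D' a b"
      using eq[of "(0, a)" "(0, b)"] by (simp add: double_prod_pure[OF md] double_prod_pure[OF md'])
    then show "pair2 a b (D x) = pair2 a b (D' x)"
      using a pairing_dual_op[OF linear_pair_cop[OF md] a, of x] pairing_dual_op[OF linear_pair_cop[OF md'] a, of x]
      by simp
  qed
qed

definition commutator :: "('v \<Rightarrow> 'v \<Rightarrow> 'v) \<Rightarrow> 'v \<Rightarrow> 'v \<Rightarrow> 'v" where
  "commutator m x y = m x y - m y x"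

definition cocommutator :: "('v \<Rightarrow> 't) \<Rightarrow> 'v \<Rightarrow> 't" where
  "cocommutator D x = D x - flip M (D x)"

lemma flip_linear: "flip M (s - t) = flip M s - flip M t" "flip M (s + t) = flip M s + flip M t"
  "flip M (smul2 M c t) = smul2 M c (flip M t)" "flip M (flip M t) = t"
  by (rule tensor2_eqI, simp)+

lemma linear_pair_commutator:
  assumes "linear_pair m D"
  shows "linear_pair (commutator m) (cocommutator D)"
proof -
  note D = linear_pair_cop[OF assms]
  have "bilinear_map (smul M) (smul M) (smul M) (commutator m)"
    by (simp add: bilinear_map_def module_hom_iff V.module_axioms commutator_def linear_pair_op[OF assms]
        algebra_simps V.scale_right_diff_distrib)
  moreover have "linear12 (cocommutator D)"
    by (simp add: module_hom_iff V.module_axioms V2.module_axioms cocommutator_def module_hom.add[OF D]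
        module_hom.scale[OF D] flip_linear algebra_simps V2.scale_right_diff_distrib)
  ultimately show ?thesis by (simp add: linear_pair_def)
qed

lemma commutator_antisym:
  "commutator m x y = - commutator m y x" "cocommutator D x = - flip M (cocommutator D x)"
  by (simp_all add: commutator_def cocommutator_def flip_linear)

text \<open>Forming the double is linear in \<open>(m, D)\<close>, and exchanging the factors of its product replaces \<open>m\<close> by the opposite
product and \<open>D\<close> by its flip.\<close>
lemma double_prod_commutator:
  assumes md: "linear_pair m D" and uv: "u \<in> double M" "v \<in> double M"
  shows "double_prod M m D u v - double_prod M m D v u = double_prod M (commutator m) (cocommutator D) u v"
proof (rule double_eqI)
  note md' = linear_pair_commutator[OF md]
  show "double_prod M m D u v - double_prod M m D v u \<in> double M"
    "double_prod M (commutator m) (cocommutator D) u v \<in> double M"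
    using uv by (simp_all add: double_prod_closed[OF md] double_prod_closed[OF md'])
  fix w assume w: "w \<in> double M"
  note D = linear_pair_cop[OF md] linear_pair_cop[OF md']
  have "trilinear_form m D u v w - trilinear_form m D v u w
      = trilinear_form (commutator m) (cocommutator D) u v w"
    using uv w by (cases u; cases v; cases w)
      (simp add: trilinear_form_def dual_op[OF D(1)] dual_op[OF D(2)] commutator_def cocommutator_def)
  then show "double_form M (double_prod M m D u v - double_prod M m D v u) w
      = double_form M (double_prod M (commutator m) (cocommutator D) u v) w"
    using uv w by (simp add: form_linear form_double_prod[OF md] form_double_prod[OF md'])
qed

end


section \<open>The quasiclassical limit of a deformation of a commutative algebra\<close>

lemma series_ext_nth: "fps_nth (series_ext b u v) n = (\<Sum>i=0..n. b (fps_nth u i) (fps_nth v (n - i)))"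
  by (simp add: series_ext_def)

lemma series_ext_const_left:
  assumes "\<And>y. b 0 y = 0"
  shows "fps_nth (series_ext b (fps_const x) v) n = b x (fps_nth v n)"
proof -
  have "fps_nth (series_ext b (fps_const x) v) n = (\<Sum>i=0..n. if i = 0 then b x (fps_nth v n) else 0)"
    unfolding series_ext_nth by (rule sum.cong) (auto simp: assms)
  then show ?thesis by simp
qed

lemma series_ext_const_right:
  assumes "\<And>n. b (fps_nth u n) 0 = 0"
  shows "fps_nth (series_ext b u (fps_const y)) n = b (fps_nth u n) y"
proof -
  have "fps_nth (series_ext b u (fps_const y)) n = (\<Sum>i=0..n. if i = n then b (fps_nth u n) y else 0)"
    unfolding series_ext_nth by (rule sum.cong) (auto simp: assms)
  then show ?thesis by simp
qed

text \<open>Multiplication by \<open>h\<close> shifts the coefficients; for \<open>n = 0\<close> the truncated subtraction is masked by the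
case distinction.\<close>
lemma series_ext_X:
  assumes "module s"
  shows "fps_nth (series_ext s fps_X w) n = (if n = 0 then 0 else fps_nth w (n - 1))"
proof -
  interpret module s by fact
  have "fps_nth (series_ext s fps_X w) n = (\<Sum>i=0..n. if i = 1 then fps_nth w (n - 1) else 0)"
    unfolding series_ext_nth by (rule sum.cong) auto
  then show ?thesis by (auto simp: not_le)
qed

lemma mem_series_on: "u \<in> series_on C \<longleftrightarrow> (\<forall>n. fps_nth u n \<in> C)"
  by (simp add: series_on_def)

lemma series_on_UNIV [simp]: "series_on UNIV = UNIV"
  by (simp add: series_on_def)

lemma cong_h_const_iff:
  assumes "module s"
  shows "cong_h s C u (fps_const v) \<longleftrightarrow> fps_nth u 0 = v \<and> (\<forall>n. fps_nth u (Suc n) \<in> C)"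
proof
  assume "cong_h s C u (fps_const v)"
  then obtain w where w: "w \<in> series_on C" "u - fps_const v = series_ext s fps_X w"
    by (auto simp: cong_h_def)
  have *: "fps_nth (u - fps_const v) n = (if n = 0 then 0 else fps_nth w (n - 1))" for n
    by (simp add: w series_ext_X[OF assms])
  show "fps_nth u 0 = v \<and> (\<forall>n. fps_nth u (Suc n) \<in> C)"
    using *[of 0] *[of "Suc n" for n] w(1) by (auto simp: mem_series_on)
next
  assume *: "fps_nth u 0 = v \<and> (\<forall>n. fps_nth u (Suc n) \<in> C)"
  show "cong_h s C u (fps_const v)"
    unfolding cong_h_def
    by (rule bexI[of _ "Abs_fps (\<lambda>n. fps_nth u (Suc n))"])
      (use * in \<open>auto simp: mem_series_on fps_eq_iff series_ext_X[OF assms] gr0_conv_Suc\<close>)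
qed

text \<open>This replaces division by \<open>h\<close> by conditions on the first two coefficients.\<close>
lemma cong_quot_h_const_iff:
  assumes s: "module s" and C: "module.subspace s C"
  shows "cong_quot_h s C (fps_const v) u \<longleftrightarrow>
    fps_nth u 0 = 0 \<and> fps_nth u 1 = v \<and> (\<forall>n. fps_nth u n \<in> C)"
proof
  interpret module s by fact
  assume "cong_quot_h s C (fps_const v) u"
  then obtain q w where q: "q \<in> series_on C" "u = series_ext s fps_X q"
    and w: "fps_const v - q = series_ext s fps_X w"
    by (auto simp: cong_quot_h_def cong_h_def)
  have "fps_nth (fps_const v - q) 0 = 0" by (simp add: w series_ext_X[OF s])
  then show "fps_nth u 0 = 0 \<and> fps_nth u 1 = v \<and> (\<forall>n. fps_nth u n \<in> C)"
    using q(1) subspace_0[OF C] by (auto simp: q(2) series_ext_X[OF s] mem_series_on)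
next
  interpret module s by fact
  assume *: "fps_nth u 0 = 0 \<and> fps_nth u 1 = v \<and> (\<forall>n. fps_nth u n \<in> C)"
  let ?q = "Abs_fps (\<lambda>n. fps_nth u (Suc n))" and ?w = "Abs_fps (\<lambda>n. - fps_nth u (Suc (Suc n)))"
  have "?q \<in> series_on C" "u = series_ext s fps_X ?q" "?w \<in> series_on C"
    "fps_const v - ?q = series_ext s fps_X ?w"
    using * subspace_neg[OF C] by (auto simp: mem_series_on fps_eq_iff series_ext_X[OF s] gr0_conv_Suc)
  then show "cong_quot_h s C (fps_const v) u"
    unfolding cong_quot_h_def cong_h_def by blast
qed

text \<open>The commutator \<open>c\<close> of the deformed product is divisible by \<open>h\<close>, because the undeformed product is commutative, and
\<open>br\<close> is \<open>c / h\<close> at \<open>h = 0\<close>. So the Jacobi identity of the commutator, read at \<open>h\<^sup>2\<close>, and its Leibniz rule,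
read at \<open>h\<close>, are the Jacobi identity and the Leibniz rule of \<open>br\<close>.\<close>
lemma qcl_poisson:
  assumes def: "assoc_deformation s C m m_h" and comm: "commutative_on C m"
    and qcl: "qcl_bracket s C m_h br"
  shows "poisson_algebra_on s C br m"
proof -
  have alg: "assoc_algebra_on s C m" and alg_h: "assoc_algebra_on (series_ext s) (series_on C) m_h"
    and cong: "\<And>x y. x \<in> C \<Longrightarrow> y \<in> C \<Longrightarrow> cong_h s C (m_h (fps_const x) (fps_const y)) (fps_const (m x y))"
    using def by (auto simp: assoc_deformation_def)
  have s: "module s" and C: "module.subspace s C" and m_C: "x \<in> C \<Longrightarrow> y \<in> C \<Longrightarrow> m x y \<in> C" for x y
    using alg by (auto simp: assoc_algebra_on_def bilinear_op_on_def)
  interpret module s by fact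
  let ?S = "series_on C"
  define h where "h = series_ext s fps_X"
  have h_nth: "fps_nth (h u) n = (if n = 0 then 0 else fps_nth u (n - 1))" for u n
    by (simp add: h_def series_ext_X[OF s])
  have bil: "bilinear_op_on (series_ext s) ?S m_h"
    and ass: "u \<in> ?S \<Longrightarrow> v \<in> ?S \<Longrightarrow> w \<in> ?S \<Longrightarrow> m_h (m_h u v) w = m_h u (m_h v w)" for u v w
    using alg_h by (auto simp: assoc_algebra_on_def)
  have S: "u \<in> ?S \<Longrightarrow> v \<in> ?S \<Longrightarrow> m_h u v \<in> ?S"
    and add: "u \<in> ?S \<Longrightarrow> v \<in> ?S \<Longrightarrow> w \<in> ?S \<Longrightarrow> m_h (u + v) w = m_h u w + m_h v w"
      "u \<in> ?S \<Longrightarrow> v \<in> ?S \<Longrightarrow> w \<in> ?S \<Longrightarrow> m_h w (u + v) = m_h w u + m_h w v"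
    and sc: "u \<in> ?S \<Longrightarrow> v \<in> ?S \<Longrightarrow> m_h (series_ext s c u) v = series_ext s c (m_h u v)"
      "u \<in> ?S \<Longrightarrow> v \<in> ?S \<Longrightarrow> m_h v (series_ext s c u) = series_ext s c (m_h v u)" for u v w c
    using bil unfolding bilinear_op_on_def by blast+
  interpret H: module "series_ext s" using bil by (simp add: bilinear_op_on_def)
  have Sub: "H.subspace ?S" using bil by (simp add: bilinear_op_on_def)
  have hS: "h u \<in> ?S" if "u \<in> ?S" for u using that subspace_0[OF C] by (auto simp: mem_series_on h_nth)
  have cS [simp]: "fps_const x \<in> ?S \<longleftrightarrow> x \<in> C" for x
    using subspace_0[OF C] by (auto simp: mem_series_on dest: spec[of _ 0])
  have C0: "fps_nth u n \<in> C" if "u \<in> ?S" for u n using that by (simp add: mem_series_on)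
  define r where "r u = Abs_fps (\<lambda>n. fps_nth u (Suc n))" for u :: "'b fps"
  have rS: "r u \<in> ?S" if "u \<in> ?S" for u using that by (simp add: r_def mem_series_on)
  have split: "u = fps_const (fps_nth u 0) + h (r u)" for u
    by (auto simp: fps_eq_iff h_nth r_def)
  have const0: "fps_nth (m_h (fps_const x) (fps_const y)) 0 = m x y" if "x \<in> C" "y \<in> C" for x y
    using cong[OF that] by (simp add: cong_h_const_iff[OF s])
  define c where "c u v = m_h u v - m_h v u" for u v
  have c_S: "c u v \<in> ?S" if "u \<in> ?S" "v \<in> ?S" for u v
    using that S H.subspace_diff[OF Sub] by (simp add: c_def)
  have c_const: "fps_nth (c (fps_const x) (fps_const y)) 0 = 0"
    "fps_nth (c (fps_const x) (fps_const y)) 1 = br x y" "br x y \<in> C" if "x \<in> C" "y \<in> C" for x y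
  proof -
    have "cong_quot_h s C (fps_const (br x y)) (c (fps_const x) (fps_const y))"
      using qcl that by (simp add: qcl_bracket_def c_def)
    then have *: "fps_nth (c (fps_const x) (fps_const y)) 0 = 0"
      "fps_nth (c (fps_const x) (fps_const y)) 1 = br x y"
      "\<And>n. fps_nth (c (fps_const x) (fps_const y)) n \<in> C"
      by (auto simp: cong_quot_h_const_iff[OF s C])
    show "fps_nth (c (fps_const x) (fps_const y)) 0 = 0"
      "fps_nth (c (fps_const x) (fps_const y)) 1 = br x y" by fact+
    show "br x y \<in> C" using *(3)[of 1] unfolding *(2) .
  qed
  have c_add: "c (u + v) w = c u w + c v w" "c w (u + v) = c w u + c w v"
    if "u \<in> ?S" "v \<in> ?S" "w \<in> ?S" for u v w
    using that by (simp_all add: c_def add)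
  have c_sc: "c (series_ext s k u) v = series_ext s k (c u v)" "c v (series_ext s k u) = series_ext s k (c v u)"
    if "u \<in> ?S" "v \<in> ?S" for u v k
    using that by (simp_all add: c_def sc H.scale_right_diff_distrib)
  \<comment> \<open>The common source of the low coefficients of \<open>m_h u v\<close> and \<open>c u v\<close> for nonconstant \<open>u\<close>, \<open>v\<close>.\<close>
  have expand: "b u v = b (fps_const (fps_nth u 0)) (fps_const (fps_nth v 0))
      + h (b (fps_const (fps_nth u 0)) (r v)) + h (b (r u) v)"
    if uv: "u \<in> ?S" "v \<in> ?S"
      and b: "\<And>u v w. u \<in> ?S \<Longrightarrow> v \<in> ?S \<Longrightarrow> w \<in> ?S \<Longrightarrow> b (u + v) w = b u w + b v w"
      "\<And>u v w. u \<in> ?S \<Longrightarrow> v \<in> ?S \<Longrightarrow> w \<in> ?S \<Longrightarrow> b w (u + v) = b w u + b w v"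
      "\<And>u v. u \<in> ?S \<Longrightarrow> v \<in> ?S \<Longrightarrow> b (h u) v = h (b u v)"
      "\<And>u v. u \<in> ?S \<Longrightarrow> v \<in> ?S \<Longrightarrow> b v (h u) = h (b v u)"
    for b u v
  proof -
    have "b u v = b (fps_const (fps_nth u 0) + h (r u)) v" using split[of u] by simp
    also have "\<dots> = b (fps_const (fps_nth u 0)) v + h (b (r u) v)"
      using uv C0 by (simp add: b hS rS)
    also have "b (fps_const (fps_nth u 0)) v = b (fps_const (fps_nth u 0)) (fps_const (fps_nth v 0) + h (r v))"
      using split[of v] by simp
    also have "\<dots> = b (fps_const (fps_nth u 0)) (fps_const (fps_nth v 0)) + h (b (fps_const (fps_nth u 0)) (r v))"
      using uv C0 by (simp add: b hS rS)
    finally show ?thesis .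
  qed
  have m0: "fps_nth (m_h u v) 0 = m (fps_nth u 0) (fps_nth v 0)" if "u \<in> ?S" "v \<in> ?S" for u v
    by (subst expand[of u v m_h, OF that]) (simp_all add: add sc h_def[symmetric] h_nth const0 C0 that sc[of _ _ fps_X, folded h_def])
  have c0: "fps_nth (c u v) 0 = 0" if "u \<in> ?S" "v \<in> ?S" for u v
    by (subst expand[of u v c, OF that])
      (simp_all add: c_add h_nth c_const C0 that c_sc[of _ _ fps_X, folded h_def])
  have c1: "fps_nth (c u v) 1 = br (fps_nth u 0) (fps_nth v 0)" if "u \<in> ?S" "v \<in> ?S" for u v
    by (subst expand[of u v c, OF that])
      (simp_all add: c_add h_nth c_const[unfolded One_nat_def] c0 C0 rS that c_sc[of _ _ fps_X, folded h_def])
  have ch: "c u v = h (r (c u v))" if "u \<in> ?S" "v \<in> ?S" for u v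
    using split[of "c u v"] c0[OF that] by simp
  have r0: "fps_nth (r (c u v)) 0 = br (fps_nth u 0) (fps_nth v 0)" if "u \<in> ?S" "v \<in> ?S" for u v
    using c1[OF that] by (simp add: r_def)
  have br_bil: "bilinear_op_on s C br"
  proof -
    have "br (x + y) z = br x z + br y z" "br z (x + y) = br z x + br z y"
      if "x \<in> C" "y \<in> C" "z \<in> C" for x y z
      using that c1[of "fps_const x + fps_const y" "fps_const z"] c1[of "fps_const z" "fps_const x + fps_const y"]
      by (simp_all add: H.subspace_add[OF Sub] c_add c_const[unfolded One_nat_def] del: fps_const_add)
    moreover have "br (s k x) y = s k (br x y)" "br y (s k x) = s k (br y x)"
      if "x \<in> C" "y \<in> C" for k x y
      using that c1[of "series_ext s (fps_const k) (fps_const x)" "fps_const y"]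
        c1[of "fps_const y" "series_ext s (fps_const k) (fps_const x)"]
      by (simp_all add: H.subspace_scale[OF Sub] c_sc c_const[unfolded One_nat_def] series_ext_const_left)
    ultimately show ?thesis
      using s C c_const(3) by (simp add: bilinear_op_on_def)
  qed
  have iter: "fps_nth (c u (c v w)) 2 = br (fps_nth u 0) (br (fps_nth v 0) (fps_nth w 0))"
    if "u \<in> ?S" "v \<in> ?S" "w \<in> ?S" for u v w
  proof -
    have "c u (c v w) = h (c u (r (c v w)))"
      using that c_S by (subst ch[of v w]) (simp_all add: c_sc[of _ _ fps_X, folded h_def] rS)
    then show ?thesis using that c1[of u "r (c v w)"] by (simp add: h_nth rS c_S r0)
  qed
  have d: "m_h (u - v) w = m_h u w - m_h v w" "m_h w (u - v) = m_h w u - m_h w v"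
    if "u \<in> ?S" "v \<in> ?S" "w \<in> ?S" for u v w
    using add(1)[of "u - v" v w] add(2)[of "u - v" v w] H.subspace_diff[OF Sub] that by simp_all
  have "br x (br y z) + br y (br z x) + br z (br x y) = 0" if "x \<in> C" "y \<in> C" "z \<in> C" for x y z
  proof -
    let ?x = "fps_const x" and ?y = "fps_const y" and ?z = "fps_const z"
    have "c ?x (c ?y ?z) + c ?y (c ?z ?x) + c ?z (c ?x ?y) = 0"
      using that by (simp add: c_def d S ass)
    then have "fps_nth (c ?x (c ?y ?z) + c ?y (c ?z ?x) + c ?z (c ?x ?y)) 2 = 0" by simp
    then show ?thesis using that by (simp add: iter)
  qed
  moreover have "br x x = 0" if "x \<in> C" for x
    using c_const(2)[OF that that] by (simp add: c_def)
  moreover have "br x (m y z) = m (br x y) z + m y (br x z)" if "x \<in> C" "y \<in> C" "z \<in> C" for x y z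
  proof -
    let ?x = "fps_const x" and ?y = "fps_const y" and ?z = "fps_const z"
    have "c ?x (m_h ?y ?z) = m_h (c ?x ?y) ?z + m_h ?y (c ?x ?z)"
      using that by (simp add: c_def d S ass)
    also have "\<dots> = h (m_h (r (c ?x ?y)) ?z) + h (m_h ?y (r (c ?x ?z)))"
      using that by (subst (1 2) ch) (simp_all add: sc[of _ _ fps_X, folded h_def] rS c_S)
    finally have "fps_nth (c ?x (m_h ?y ?z)) 1 = fps_nth (h (m_h (r (c ?x ?y)) ?z) + h (m_h ?y (r (c ?x ?z)))) 1" by simp
    then show ?thesis using that c1[of ?x "m_h ?y ?z"] by (simp add: h_nth m0 S rS c_S r0)
  qed
  ultimately show ?thesis
    using br_bil alg comm by (simp add: poisson_algebra_on_def lie_algebra_on_def)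
qed

section \<open>Power series over a framed space\<close>

lemma series_ext_flip: "series_ext b u v = series_ext (\<lambda>y x. b x y) v u"
proof (rule fps_ext)
  fix n
  show "fps_nth (series_ext b u v) n = fps_nth (series_ext (\<lambda>y x. b x y) v u) n"
    unfolding series_ext_nth by (rule sum.reindex_bij_witness[of _ "\<lambda>i. n - i" "\<lambda>i. n - i"]) auto
qed

lemma series_ext_mult: "series_ext (*) = ((*) :: 'r::comm_ring_1 fps \<Rightarrow> _)"
  by (intro ext fps_ext) (simp add: series_ext_nth fps_mult_nth)

text \<open>Associativity of the Cauchy product in the generality needed for scalar multiplication, for tensor
products and for the pairing. The last is linear on the right only when its left
argument is in the dual, hence the sets \<open>A\<close>, \<open>B\<close>, \<open>C\<close>.\<close>
lemma series_ext_assoc: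
  assumes u: "u \<in> series_on A" and v: "v \<in> series_on B" and w: "w \<in> series_on C"
    and assoc: "\<And>x y z. x \<in> A \<Longrightarrow> y \<in> B \<Longrightarrow> z \<in> C \<Longrightarrow> b1 (b2 x y) z = b3 x (b4 y z)"
    and b1: "\<And>f z n. z \<in> C \<Longrightarrow> b1 (\<Sum>i=0..n. f i) z = (\<Sum>i=(0::nat)..n. b1 (f i) z)"
    and b3: "\<And>f x n. x \<in> A \<Longrightarrow> b3 x (\<Sum>i=0..n. f i) = (\<Sum>i=(0::nat)..n. b3 x (f i))"
  shows "series_ext b1 (series_ext b2 u v) w = series_ext b3 u (series_ext b4 v w)"
proof (rule fps_ext)
  fix n
  have mem: "fps_nth u i \<in> A" "fps_nth v i \<in> B" "fps_nth w i \<in> C" for i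
    using u v w by (auto simp: mem_series_on)
  have "fps_nth (series_ext b1 (series_ext b2 u v) w) n =
      (\<Sum>j=0..n. \<Sum>i=0..j. b1 (b2 (fps_nth u i) (fps_nth v (j - i))) (fps_nth w (n - j)))"
    by (simp add: series_ext_nth b1 mem)
  also have "\<dots> = (\<Sum>j=0..n. \<Sum>i=0..n - j. b1 (b2 (fps_nth u j) (fps_nth v i)) (fps_nth w (n - j - i)))"
    by (rule fps_mult_assoc_lemma)
  also have "\<dots> = fps_nth (series_ext b3 u (series_ext b4 v w)) n"
    by (simp add: series_ext_nth b3 mem assoc)
  finally show "fps_nth (series_ext b1 (series_ext b2 u v) w) n = fps_nth (series_ext b3 u (series_ext b4 v w)) n" .
qed

lemma series_ext_add_left:
  assumes "\<And>x y z. z \<in> C \<Longrightarrow> b (x + y) z = b x z + (b y z :: 'c::ab_group_add)" "w \<in> series_on C"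
  shows "series_ext b (u + v) w = series_ext b u w + series_ext b v w"
  using assms by (intro fps_ext) (simp add: series_ext_nth mem_series_on sum.distrib)

lemma series_ext_add_right:
  assumes "\<And>x y z. z \<in> C \<Longrightarrow> b z (x + y) = b z x + (b z y :: 'c::ab_group_add)" "w \<in> series_on C"
  shows "series_ext b w (u + v) = series_ext b w u + series_ext b w v"
  using assms by (intro fps_ext) (simp add: series_ext_nth mem_series_on sum.distrib)

lemma module_series:
  fixes s :: "'r::comm_ring_1 \<Rightarrow> 'v::ab_group_add \<Rightarrow> 'v"
  assumes "module s"
  shows "module (series_ext s)"
proof
  interpret module s by fact
  fix a b :: "'r fps" and x y :: "'v fps"
  show "series_ext s a (x + y) = series_ext s a x + series_ext s a y"
    by (rule series_ext_add_right[of UNIV]) (simp_all add: scale_right_distrib)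
  show "series_ext s (a + b) x = series_ext s a x + series_ext s b x"
    by (rule series_ext_add_left[of UNIV]) (simp_all add: scale_left_distrib)
  have "series_ext s (series_ext (*) a b) x = series_ext s a (series_ext s b x)"
    by (rule series_ext_assoc[of _ UNIV _ UNIV _ UNIV]) (simp_all add: scale_sum_left scale_sum_right)
  then show "series_ext s a (series_ext s b x) = series_ext s (a * b) x" by (simp add: series_ext_mult)
  show "series_ext s 1 x = x"
    unfolding fps_const_1_eq_1[symmetric] by (rule fps_ext) (simp add: series_ext_const_left del: fps_const_1_eq_1)
qed

lemma module_hom_series_left:
  assumes "\<And>y. y \<in> C \<Longrightarrow> module_hom s s' (\<lambda>x. b x y)" and s: "module s" "module s'" and w: "w \<in> series_on C"
  shows "module_hom (series_ext s) (series_ext s') (\<lambda>u. series_ext b u w)"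
proof -
  interpret S': module s' by fact
  have "series_ext b (series_ext s c u) w = series_ext s' c (series_ext b u w)" for c u
    by (rule series_ext_assoc[of _ UNIV _ UNIV _ C])
      (auto simp: w assms(1)[THEN module_hom.scale] assms(1)[THEN module_hom.sum] S'.scale_sum_right)
  moreover have "series_ext b (u + v) w = series_ext b u w + series_ext b v w" for u v
    by (rule series_ext_add_left[of C]) (auto simp: w assms(1)[THEN module_hom.add])
  ultimately show ?thesis using s by (simp add: module_hom_iff module_series)
qed

lemma module_hom_series_right:
  assumes "\<And>x. x \<in> C \<Longrightarrow> module_hom s s' (b x)" and s: "module s" "module s'" and w: "w \<in> series_on C"
  shows "module_hom (series_ext s) (series_ext s') (series_ext b w)"
proof -
  have "series_ext b w = (\<lambda>u. series_ext (\<lambda>y x. b x y) u w)" by (rule ext) (rule series_ext_flip)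
  then show ?thesis using module_hom_series_left[of C s s' "\<lambda>y x. b x y" w] assms by simp
qed

lemma bilinear_map_series:
  assumes "bilinear_map s1 s2 s b"
  shows "bilinear_map (series_ext s1) (series_ext s2) (series_ext s) (series_ext b)"
proof -
  have "module s1" "module s2" "module s" using assms by (auto simp: bilinear_map_def module_hom_iff)
  then show ?thesis
    using assms module_hom_series_left[of UNIV s1 s b] module_hom_series_right[of UNIV s2 s b]
    by (simp add: bilinear_map_def)
qed

definition coeffwise :: "('a \<Rightarrow> 'b) \<Rightarrow> 'a fps \<Rightarrow> 'b fps" where
  "coeffwise f u = Abs_fps (\<lambda>n. f (fps_nth u n))"

lemma coeffwise_nth [simp]: "fps_nth (coeffwise f u) n = f (fps_nth u n)"
  by (simp add: coeffwise_def)

lemma module_hom_coeffwise: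
  assumes f: "module_hom s s' f"
  shows "module_hom (series_ext s) (series_ext s') (coeffwise f)"
proof -
  have "module s" "module s'" using f by (auto simp: module_hom_iff)
  moreover have "coeffwise f (u + v) = coeffwise f u + coeffwise f v" for u v
    by (rule fps_ext) (simp add: module_hom.add[OF f])
  moreover have "coeffwise f (series_ext s c u) = series_ext s' c (coeffwise f u)" for c u
    by (rule fps_ext) (simp add: series_ext_nth module_hom.sum[OF f] module_hom.scale[OF f])
  ultimately show ?thesis by (simp add: module_hom_iff module_series)
qed

lemma module_hom_coeffwise_mult:
  assumes f: "module_hom s (*) f"
  shows "module_hom (series_ext s) (*) (coeffwise f)"
  using module_hom_coeffwise[OF f] by (simp add: series_ext_mult)

text \<open>The constant series of a frame form a frame over \<open>k[[h]]\<close>, with coordinates taken coefficient by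
coefficient; being finite, the expansion involves no convergence.\<close>
lemma frame_series:
  assumes fr: "frame s J e \<phi>"
  shows "frame (series_ext s) J (\<lambda>j. fps_const (e j)) (\<lambda>j. coeffwise (\<phi> j))"
proof -
  have s: "module s" and "finite J" using fr by (auto simp: frame_def)
  interpret module s by fact
  have "(\<Sum>j\<in>J. series_ext s (coeffwise (\<phi> j) u) (fps_const (e j))) = u" for u
  proof (rule fps_ext)
    fix n
    have "fps_nth (\<Sum>j\<in>J. series_ext s (coeffwise (\<phi> j) u) (fps_const (e j))) n = (\<Sum>j\<in>J. s (\<phi> j (fps_nth u n)) (e j))"
      by (simp add: fps_sum_nth series_ext_const_right)
    also have "\<dots> = fps_nth u n" using fr by (simp add: frame_def)
    finally show "fps_nth (\<Sum>j\<in>J. series_ext s (coeffwise (\<phi> j) u) (fps_const (e j))) n = fps_nth u n" .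
  qed
  then show ?thesis
    using module_series[OF s] \<open>finite J\<close> frame_hom[OF fr]
    by (simp add: frame_def module_hom_coeffwise_mult)
qed

lemma series_ext_const_const:
  assumes "\<And>y. b 0 y = 0" "\<And>x. b x 0 = 0"
  shows "series_ext b (fps_const x) (fps_const y) = fps_const (b x y)"
  by (rule fps_ext) (simp add: series_ext_const_left assms)

lemma bilinear_map_zero:
  assumes "bilinear_map s1 s2 s b"
  shows "b 0 y = 0" and "b x 0 = 0"
  using assms module_hom.zero[of s1 s "\<lambda>x. b x y"] module_hom.zero[of s2 s "b x"]
  by (auto simp: bilinear_map_def)

lemma framed_tensor_series:
  assumes "framed_tensor s1 J e \<phi> s2 K f \<psi> s t \<chi>"
  shows "framed_tensor (series_ext s1) J (\<lambda>j. fps_const (e j)) (\<lambda>j. coeffwise (\<phi> j))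
    (series_ext s2) K (\<lambda>k. fps_const (f k)) (\<lambda>k. coeffwise (\<psi> k))
    (series_ext s) (series_ext t) (\<lambda>p. coeffwise (\<chi> p))"
proof -
  interpret framed_tensor s1 J e \<phi> s2 K f \<psi> s t \<chi> by fact
  show ?thesis
  proof
    have "(\<lambda>(j, k). series_ext t (fps_const (e j)) (fps_const (f k))) = (\<lambda>p. fps_const (case p of (j, k) \<Rightarrow> t (e j) (f k)))"
      using bilinear_map_zero[OF bilinear] by (auto simp: series_ext_const_const)
    then show "frame (series_ext s) (J \<times> K) (\<lambda>(j, k). series_ext t (fps_const (e j)) (fps_const (f k)))
        (\<lambda>p. coeffwise (\<chi> p))"
      using frame_series[OF frame_t] by simp
    fix j k x y assume jk: "j \<in> J" "k \<in> K"
    then have h: "module_hom s (*) (\<chi> (j, k))" using frame_hom[OF frame_t] by simp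
    show "coeffwise (\<chi> (j, k)) (series_ext t x y) = coeffwise (\<phi> j) x * coeffwise (\<psi> k) y"
      by (rule fps_ext) (simp add: series_ext_nth module_hom.sum[OF h] coord[OF jk] fps_mult_nth)
  qed (intro frame_series frame1 frame2 bilinear_map_series bilinear)+
qed

context framed_space
begin

lemma pairing_series_const: "series_ext (pairing M) (fps_const a) = coeffwise (pairing M a)"
  by (intro ext fps_ext) (simp add: series_ext_const_left)

text \<open>This is what makes every result about framed spaces available over \<open>k[[h]]\<close>.\<close>
lemma framed_space_series:
  "framed_space (series_space M) I (\<lambda>i. fps_const (e i)) (\<lambda>i. fps_const (\<epsilon> i))
    (\<lambda>p. coeffwise (\<chi> p)) (\<lambda>p. coeffwise (\<chi>21 p)) (\<lambda>p. coeffwise (\<chi>12 p))"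
proof -
  have t: "(\<lambda>(i, j). tensor (series_space M) (fps_const (e i)) (fps_const (e j)))
      = (\<lambda>p. fps_const (case p of (i, j) \<Rightarrow> tensor M (e i) (e j)))"
    using bilinear_map_zero[OF T.bilinear] by (auto simp: series_ext_const_const series_space_def)
  have p: "(\<lambda>i. pairing (series_space M) (fps_const (\<epsilon> i))) = (\<lambda>i. coeffwise (pairing M (\<epsilon> i)))"
    by (simp add: series_space_def pairing_series_const)
  have sel: "smul (series_space M) = series_ext (smul M)" "smul2 (series_space M) = series_ext (smul2 M)"
    "smul3 (series_space M) = series_ext (smul3 M)" "tensor21 (series_space M) = series_ext (tensor21 M)"
    "tensor12 (series_space M) = series_ext (tensor12 M)" "dual (series_space M) = series_on (dual M)"
    "dsmul (series_space M) = series_ext (dsmul M)"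
    by (simp_all add: series_space_def)
  have sel': "tensor (series_space M) = series_ext (tensor M)" "pairing (series_space M) = series_ext (pairing M)"
    by (simp_all add: series_space_def)
  interpret S': module "series_ext (dsmul M)" by (rule module_series[OF module_dual])
  show ?thesis
  proof (rule framed_space.intro, unfold t p, unfold sel sel')
    show "framed_tensor (series_ext (smul M)) I (\<lambda>i. fps_const (e i)) (\<lambda>i. coeffwise (pairing M (\<epsilon> i)))
       (series_ext (smul M)) I (\<lambda>i. fps_const (e i)) (\<lambda>i. coeffwise (pairing M (\<epsilon> i)))
       (series_ext (smul2 M)) (series_ext (tensor M)) (\<lambda>p. coeffwise (\<chi> p))"
      by (rule framed_tensor_series[OF framed])
    show "framed_tensor (series_ext (smul2 M)) (I \<times> I) (\<lambda>p. fps_const (case p of (i, j) \<Rightarrow> tensor M (e i) (e j)))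
       (\<lambda>p. coeffwise (\<chi> p)) (series_ext (smul M)) I (\<lambda>i. fps_const (e i))
       (\<lambda>i. coeffwise (pairing M (\<epsilon> i))) (series_ext (smul3 M)) (series_ext (tensor21 M)) (\<lambda>p. coeffwise (\<chi>21 p))"
      by (rule framed_tensor_series[OF framed21])
    show "framed_tensor (series_ext (smul M)) I (\<lambda>i. fps_const (e i)) (\<lambda>i. coeffwise (pairing M (\<epsilon> i)))
       (series_ext (smul2 M)) (I \<times> I) (\<lambda>p. fps_const (case p of (i, j) \<Rightarrow> tensor M (e i) (e j)))
       (\<lambda>p. coeffwise (\<chi> p)) (series_ext (smul3 M)) (series_ext (tensor12 M)) (\<lambda>p. coeffwise (\<chi>12 p))"
      by (rule framed_tensor_series[OF framed12])
    have t21: "module_hom (smul2 M) (smul3 M) (\<lambda>t. tensor21 M t z)"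
      and t12: "module_hom (smul2 M) (smul3 M) (tensor12 M z)" for z
      using T21.bilinear T12.bilinear by (auto simp: bilinear_map_def)
    show "series_ext (tensor21 M) (series_ext (tensor M) x y) z
        = series_ext (tensor12 M) x (series_ext (tensor M) y z)" for x y z
      by (rule series_ext_assoc[of _ UNIV _ UNIV _ UNIV])
        (simp_all add: tensor_assoc module_hom.sum[OF t21] module_hom.sum[OF t12])
    show "module (series_ext (dsmul M))" by (rule S'.module_axioms)
    show "module.subspace (series_ext (dsmul M)) (series_on (dual M))"
      by (auto simp: S'.subspace_def mem_series_on series_ext_nth intro!: dual_sum)
    show "fps_const (\<epsilon> i) \<in> series_on (dual M)" if "i \<in> I" for i
      using frame_dual[OF that] by (simp add: mem_series_on)
    show "module_hom (series_ext (dsmul M)) (*) (\<lambda>a. series_ext (pairing M) a x)" for x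
      using module_hom_series_left[of UNIV "dsmul M" "(*)" "pairing M" x]
      by (simp add: pairing_hom_left module_dual module_mult series_ext_mult)
    show "module_hom (series_ext (smul M)) (*) (series_ext (pairing M) a)" if "a \<in> series_on (dual M)" for a
      using module_hom_series_right[of "dual M" "smul M" "(*)" "pairing M" a] that
      by (simp add: pairing_hom V.module_axioms module_mult series_ext_mult)
    show "a = b" if ab: "a \<in> series_on (dual M)" "b \<in> series_on (dual M)"
      and eq: "\<And>x. series_ext (pairing M) a x = series_ext (pairing M) b x" for a b
    proof (intro fps_ext dual_eqI)
      fix n
      show mem: "fps_nth a n \<in> dual M" "fps_nth b n \<in> dual M" for n using ab by (auto simp: mem_series_on)
      show "pairing M (fps_nth a n) x = pairing M (fps_nth b n) x" for x
        using arg_cong[OF eq[of "fps_const x"], of "\<lambda>u. fps_nth u n"]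
        by (simp add: series_ext_const_right mem)
    qed
  qed
qed

end

lemma module_hom_id: "module s \<Longrightarrow> module_hom s s (\<lambda>x. x)"
  by (simp add: module_hom_iff)

text \<open>The coordinates are obtained from the universal property for scalar targets, the
expansion of every tensor in the \<open>t (e j) (f k)\<close> from uniqueness for the tensor product itself as target.\<close>
lemma tensor_product_framed:
  fixes s :: "'k::field \<Rightarrow> 't::ab_group_add \<Rightarrow> 't"
  assumes tp: "tensor_product s1 s2 s t" and f1: "frame s1 J e \<phi>" and f2: "frame s2 K f \<psi>"
  shows "\<exists>\<chi>. framed_tensor s1 J e \<phi> s2 K f \<psi> s t \<chi>"
proof -
  have bil: "bilinear_map s1 s2 s t" and s: "vector_space s"
    using tp by (auto simp: tensor_product_def)
  then have mod: "module s" by (simp add: vector_space_def module_def)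
  have "\<exists>g. module_hom s (*) g \<and> (\<forall>x y. g (t x y) = \<phi> (fst p) x * \<psi> (snd p) y)" if p: "p \<in> J \<times> K" for p
  proof -
    have "bilinear_map s1 s2 (*) (\<lambda>x y. \<phi> (fst p) x * \<psi> (snd p) y)"
      using p by (intro bilinear_map_comp[OF bilinear_map_mult] frame_hom[OF f1] frame_hom[OF f2]) auto
    then have "\<exists>!g. module_hom s (*) g \<and> (\<forall>x y. g (t x y) = \<phi> (fst p) x * \<psi> (snd p) y)"
      using tp unfolding tensor_product_def by blast
    then show ?thesis by blast
  qed
  then have "\<forall>p\<in>J \<times> K. \<exists>g. module_hom s (*) g \<and> (\<forall>x y. g (t x y) = \<phi> (fst p) x * \<psi> (snd p) y)" ..
  from bchoice[OF this] obtain \<chi> where *: "\<forall>p\<in>J \<times> K. module_hom s (*) (\<chi> p) \<and>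
    (\<forall>x y. \<chi> p (t x y) = \<phi> (fst p) x * \<psi> (snd p) y)" ..
  have \<chi>: "module_hom s (*) (\<chi> (j, k))" "\<chi> (j, k) (t x y) = \<phi> j x * \<psi> k y"
    if "j \<in> J" "k \<in> K" for j k x y
    using bspec[OF *, of "(j, k)"] that by simp_all
  let ?E = "\<lambda>z. \<Sum>p\<in>J\<times>K. s (\<chi> p z) (case p of (j, k) \<Rightarrow> t (e j) (f k))"
  have E: "module_hom s s ?E"
    using mod \<chi>(1) by (intro module_hom_sum_fun module_hom_scale_fun) auto
  have Et: "?E (t x y) = t x y" for x y
    by (rule trans[OF sum.cong[OF refl] bilinear_map_expand[OF bil f1 f2, of x y, symmetric]])
      (auto simp: \<chi>(2))
  have "?E = (\<lambda>z. z)"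
    using tensor_product_universal[OF tp s bil] E Et module_hom_id[OF mod] by blast
  then have "?E z = z" for z by (rule fun_cong)
  then have "frame s (J \<times> K) (\<lambda>(j, k). t (e j) (f k)) \<chi>"
    using f1 f2 mod \<chi>(1) by (auto simp: frame_def)
  then have "framed_tensor s1 J e \<phi> s2 K f \<psi> s t \<chi>"
    using f1 f2 bil \<chi>(2) by unfold_locales auto
  then show ?thesis by blast
qed

lemma fin_dim_framed:
  assumes "fin_dim_space M"
  obtains B \<epsilon> \<chi> \<chi>21 \<chi>12 where "framed_space M B (\<lambda>b. b) \<epsilon> \<chi> \<chi>21 \<chi>12"
proof -
  obtain B where B: "finite_dimensional_vector_space (smul M) B"
    and T: "tensor_product (smul M) (smul M) (smul2 M) (tensor M)"
     "tensor_product (smul2 M) (smul M) (smul3 M) (tensor21 M)"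
     "tensor_product (smul M) (smul2 M) (smul3 M) (tensor12 M)"
    and a: "\<And>x y z. tensor21 M (tensor M x y) z = tensor12 M x (tensor M y z)"
    and d: "dual M = {f. module_hom (smul M) (*) f}" "dsmul M = (\<lambda>c f x. c * f x)" "pairing M = (\<lambda>f x. f x)"
    using assms by (auto simp: fin_dim_space_def)
  interpret finite_dimensional_vector_space "smul M" B by fact
  define \<epsilon> where "\<epsilon> b x = representation B x b" for b x
  have \<epsilon>: "module_hom (smul M) (*) (\<epsilon> b)" for b
    using module_axioms independent_Basis span_Basis module_mult
    by (auto simp: module_hom_iff \<epsilon>_def representation_add representation_scale)
  have fr: "frame (smul M) B (\<lambda>b. b) (\<lambda>b. pairing M (\<epsilon> b))"
    using module_axioms finite_Basis \<epsilon> independent_Basis span_Basis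
    by (simp add: frame_def d) (simp add: \<epsilon>_def sum_representation_eq)
  obtain \<chi> where \<chi>: "framed_tensor (smul M) B (\<lambda>b. b) (\<lambda>b. pairing M (\<epsilon> b)) (smul M) B (\<lambda>b. b) (\<lambda>b. pairing M (\<epsilon> b))
      (smul2 M) (tensor M) \<chi>"
    using tensor_product_framed[OF T(1) fr fr] by blast
  note f2 = framed_tensor.frame_t[OF \<chi>]
  obtain \<chi>21 where \<chi>21: "framed_tensor (smul2 M) (B \<times> B) (\<lambda>(i, j). tensor M i j) \<chi>
      (smul M) B (\<lambda>b. b) (\<lambda>b. pairing M (\<epsilon> b)) (smul3 M) (tensor21 M) \<chi>21"
    using tensor_product_framed[OF T(2) f2 fr] by blast
  obtain \<chi>12 where \<chi>12: "framed_tensor (smul M) B (\<lambda>b. b) (\<lambda>b. pairing M (\<epsilon> b))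
      (smul2 M) (B \<times> B) (\<lambda>(i, j). tensor M i j) \<chi> (smul3 M) (tensor12 M) \<chi>12"
    using tensor_product_framed[OF T(3) fr f2] by blast
  have md: "module (dsmul M)" by unfold_locales (auto simp: d algebra_simps)
  interpret D: module "dsmul M" by fact
  have "framed_space M B (\<lambda>b. b) \<epsilon> \<chi> \<chi>21 \<chi>12"
  proof (rule framed_space.intro[OF \<chi> \<chi>21 \<chi>12 a md])
    show "D.subspace (dual M)"
      using module_axioms module_mult unfolding D.subspace_def
      by (auto simp: d module_hom_iff algebra_simps zero_fun_def)
    show "module_hom (dsmul M) (*) (\<lambda>a. pairing M a x)" for x
      using md module_mult by (auto simp: d module_hom_iff)
  qed (use \<epsilon> in \<open>auto simp: d\<close>)
  then show thesis by (rule that)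
qed

section \<open>Power series on the double\<close>

lemma series_space_sel [simp]:
  "smul (series_space M) = series_ext (smul M)" "smul2 (series_space M) = series_ext (smul2 M)"
  "tensor (series_space M) = series_ext (tensor M)"
  "dual (series_space M) = series_on (dual M)" "dsmul (series_space M) = series_ext (dsmul M)"
  "pairing (series_space M) = series_ext (pairing M)"
  by (simp_all add: series_space_def)

lemma series_pair_inverse [simp]:
  "series_pair (series_unpair w) = w" "series_unpair (series_pair p) = p"
  by (cases p; auto simp: series_pair_def series_unpair_def fps_eq_iff)+

lemma series_unpair_nth:
  "fps_nth (fst (series_unpair w)) n = fst (fps_nth w n)"
  "fps_nth (snd (series_unpair w)) n = snd (fps_nth w n)"
  by (simp_all add: series_unpair_def)

lemma series_pair_nth: "fps_nth (series_pair p) n = (fps_nth (fst p) n, fps_nth (snd p) n)"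
  by (cases p) (simp add: series_pair_def)

lemma series_pair_add: "series_pair (p + q) = series_pair p + series_pair q"
  by (rule fps_ext) (simp add: series_pair_nth)

lemma series_unpair_add: "series_unpair (u + v) = series_unpair u + series_unpair v"
  by (intro prod_eqI fps_ext) (simp_all add: series_unpair_nth)

lemma series_unpair_smul:
  "series_unpair (series_ext (double_smul M) c u) = double_smul (series_space M) c (series_unpair u)"
  by (intro prod_eqI fps_ext)
    (simp_all add: series_unpair_nth series_ext_nth double_smul_def fst_sum snd_sum case_prod_beta)

lemma series_pair_smul:
  "series_pair (double_smul (series_space M) c p) = series_ext (double_smul M) c (series_pair p)"
  by (metis series_pair_inverse series_unpair_smul)

lemma series_unpair_const: "series_unpair (fps_const (x, a)) = (fps_const x, fps_const a)"
  by (auto simp: series_unpair_def fps_eq_iff zero_prod_def)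

lemma series_unpair_double: "series_unpair u \<in> double (series_space M) \<longleftrightarrow> u \<in> series_on (double M)"
  by (auto simp: double_def mem_series_on series_unpair_def mem_Times_iff)

lemma series_pair_double: "series_pair p \<in> series_on (double M) \<longleftrightarrow> p \<in> double (series_space M)"
  by (metis series_pair_inverse(2) series_unpair_double)

text \<open>Transport of structure along the identification of \<open>A[[h]] \<oplus> A\<^sup>*[[h]]\<close> with \<open>(A \<oplus> A\<^sup>*)[[h]]\<close>.\<close>
lemma assoc_algebra_series_pair:
  assumes "module (double_smul M)" "module.subspace (double_smul M) (double M)"
    and alg: "assoc_algebra_on (double_smul (series_space M)) (double (series_space M)) p"
  shows "assoc_algebra_on (series_ext (double_smul M)) (series_on (double M)) (series_pair_op p)"
proof -
  interpret W: module "double_smul M" by fact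
  interpret S: module "series_ext (double_smul M)" by (rule module_series[OF assms(1)])
  have sub: "S.subspace (series_on (double M))"
    unfolding S.subspace_def
    by (simp add: mem_series_on W.subspace_0[OF assms(2)] W.subspace_add[OF assms(2)] series_ext_nth
        W.subspace_sum[OF assms(2)] W.subspace_scale[OF assms(2)])
  have p: "u \<in> double (series_space M) \<Longrightarrow> v \<in> double (series_space M) \<Longrightarrow> p u v \<in> double (series_space M)"
    "u \<in> double (series_space M) \<Longrightarrow> v \<in> double (series_space M) \<Longrightarrow> w \<in> double (series_space M) \<Longrightarrow>
      p (u + v) w = p u w + p v w \<and> p w (u + v) = p w u + p w v"
    "u \<in> double (series_space M) \<Longrightarrow> v \<in> double (series_space M) \<Longrightarrow>
      p (double_smul (series_space M) c u) v = double_smul (series_space M) c (p u v) \<and>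
      p u (double_smul (series_space M) c v) = double_smul (series_space M) c (p u v)"
    "u \<in> double (series_space M) \<Longrightarrow> v \<in> double (series_space M) \<Longrightarrow> w \<in> double (series_space M) \<Longrightarrow>
      p (p u v) w = p u (p v w)" for u v w c
    using alg unfolding assoc_algebra_on_def bilinear_op_on_def by blast+
  show ?thesis
    unfolding assoc_algebra_on_def bilinear_op_on_def series_pair_op_def
    using sub S.module_axioms
    by (simp add: series_unpair_double[symmetric] p series_unpair_add series_unpair_smul
        series_pair_add series_pair_smul)
qed

context framed_space
begin

lemma double_series_const:
  "u \<in> double M \<Longrightarrow> series_unpair (fps_const u) \<in> double (series_space M)"
  by (cases u) (auto simp: series_unpair_const double_def mem_series_on)

lemma pair2_series:
  assumes ab: "a \<in> dual M" "b \<in> dual M"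
  shows "framed_space.pair2 (series_space M) (fps_const a) (fps_const b) t = coeffwise (pair2 a b) t"
proof -
  interpret S: framed_space "series_space M" I "\<lambda>i. fps_const (e i)" "\<lambda>i. fps_const (\<epsilon> i)"
    "\<lambda>p. coeffwise (\<chi> p)" "\<lambda>p. coeffwise (\<chi>21 p)" "\<lambda>p. coeffwise (\<chi>12 p)"
    by (rule framed_space_series)
  have c: "fps_const a \<in> dual (series_space M)" "fps_const b \<in> dual (series_space M)"
    using ab by (auto simp: mem_series_on)
  show ?thesis
  proof (rule S.T.hom_eqI[OF S.pair2_hom[OF c]])
    show "module_hom (smul2 (series_space M)) (*) (coeffwise (pair2 a b))"
      using module_hom_coeffwise_mult[OF pair2_hom[OF ab]] by simp
    fix x y
    show "S.pair2 (fps_const a) (fps_const b) (tensor (series_space M) x y)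
        = coeffwise (pair2 a b) (tensor (series_space M) x y)"
      unfolding S.pair2_tensor[OF c]
      by (rule fps_ext) (simp add: pairing_series_const fps_mult_nth series_ext_nth ab
          module_hom.sum[OF pair2_hom[OF ab]])
  qed
qed

lemma flip_series: "flip (series_space M) t = coeffwise (flip M) t"
proof -
  interpret S: framed_space "series_space M" I "\<lambda>i. fps_const (e i)" "\<lambda>i. fps_const (\<epsilon> i)"
    "\<lambda>p. coeffwise (\<chi> p)" "\<lambda>p. coeffwise (\<chi>21 p)" "\<lambda>p. coeffwise (\<chi>12 p)"
    by (rule framed_space_series)
  show ?thesis
  proof (rule S.T.hom_eqI[OF S.flip_hom])
    show "module_hom (smul2 (series_space M)) (smul2 (series_space M)) (coeffwise (flip M))"
      using module_hom_coeffwise[OF flip_hom] by simp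
    fix x y
    have "series_ext (tensor M) y x = series_ext (\<lambda>x y. tensor M y x) x y" by (rule series_ext_flip)
    then show "flip (series_space M) (tensor (series_space M) x y)
        = coeffwise (flip M) (tensor (series_space M) x y)"
      unfolding S.flip_tensor
      by (intro fps_ext) (simp add: series_ext_nth flip_tensor module_hom.sum[OF flip_hom])
  qed
qed

definition coeff_prod :: "nat \<Rightarrow> ('v fps \<Rightarrow> 'v fps \<Rightarrow> 'v fps) \<Rightarrow> 'v \<Rightarrow> 'v \<Rightarrow> 'v" where
  "coeff_prod k m_h x y = fps_nth (m_h (fps_const x) (fps_const y)) k"

definition coeff_cop :: "nat \<Rightarrow> ('v fps \<Rightarrow> 't fps) \<Rightarrow> 'v \<Rightarrow> 't" where
  "coeff_cop k D_h x = fps_nth (D_h (fps_const x)) k"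

lemma module_hom_coeff:
  assumes f: "module_hom (series_ext s) (series_ext s') f" and s: "module s" "module s'"
  shows "module_hom s s' (\<lambda>x. fps_nth (f (fps_const x)) k)"
proof -
  interpret s1: module s by fact
  interpret s2: module s' by fact
  have "fps_nth (f (fps_const (s c x))) k = s' c (fps_nth (f (fps_const x)) k)" for c x
  proof -
    have "fps_const (s c x) = series_ext s (fps_const c) (fps_const x)"
      by (simp add: series_ext_const_const)
    then show ?thesis by (simp add: module_hom.scale[OF f] series_ext_const_left)
  qed
  moreover have "fps_nth (f (fps_const (x + y))) k = fps_nth (f (fps_const x)) k + fps_nth (f (fps_const y)) k" for x y
    using module_hom.add[OF f, of "fps_const x" "fps_const y"] by simp
  ultimately show ?thesis using s by (simp add: module_hom_iff)
qed

lemma linear_pair_coeff: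
  assumes "framed_space.linear_pair (series_space M) m_h D_h"
  shows "linear_pair (coeff_prod k m_h) (coeff_cop k D_h)"
proof -
  interpret S: framed_space "series_space M" I "\<lambda>i. fps_const (e i)" "\<lambda>i. fps_const (\<epsilon> i)"
    "\<lambda>p. coeffwise (\<chi> p)" "\<lambda>p. coeffwise (\<chi>21 p)" "\<lambda>p. coeffwise (\<chi>12 p)"
    by (rule framed_space_series)
  show ?thesis
    using S.linear_pair_left[OF assms] S.linear_pair_right[OF assms] S.linear_pair_cop[OF assms]
    unfolding linear_pair_def bilinear_map_def coeff_prod_def coeff_cop_def
    by (auto intro!: module_hom_coeff V.module_axioms V2.module_axioms)
qed

text \<open>Both sides are determined by their form against constants, and by \<open>form_double_prod\<close> over \<open>k[[h]]\<close> this
form is a sum of pairings of \<open>m_h\<close> and \<open>D_h\<close> with constants, whose coefficients can be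
taken termwise.\<close>
lemma double_prod_series_nth:
  assumes md: "framed_space.linear_pair (series_space M) m_h D_h" and u: "u \<in> double M" "v \<in> double M"
  shows "fps_nth (series_pair_op (double_prod (series_space M) m_h D_h) (fps_const u) (fps_const v)) k
    = double_prod M (coeff_prod k m_h) (coeff_cop k D_h) u v"
proof -
  interpret S: framed_space "series_space M" I "\<lambda>i. fps_const (e i)" "\<lambda>i. fps_const (\<epsilon> i)"
    "\<lambda>p. coeffwise (\<chi> p)" "\<lambda>p. coeffwise (\<chi>21 p)" "\<lambda>p. coeffwise (\<chi>12 p)"
    by (rule framed_space_series)
  note mdk = linear_pair_coeff[OF md, of k]
  let ?u = "series_unpair (fps_const u)" and ?v = "series_unpair (fps_const v)"
  let ?P = "double_prod (series_space M) m_h D_h ?u ?v"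
  have P: "?P \<in> double (series_space M)"
    using u by (intro S.double_prod_closed[OF md] double_series_const)
  show ?thesis
    unfolding series_pair_op_def
  proof (rule double_eqI)
    have "series_pair ?P \<in> series_on (double M)" using P by (simp add: series_pair_double)
    then show mem: "fps_nth (series_pair ?P) k \<in> double M" by (simp add: mem_series_on)
    show "double_prod M (coeff_prod k m_h) (coeff_cop k D_h) u v \<in> double M"
      using u by (rule double_prod_closed[OF mdk])
    fix w assume w: "w \<in> double M"
    let ?w = "series_unpair (fps_const w)"
    obtain x a y b z c where uvw: "u = (x, a)" "v = (y, b)" "w = (z, c)" "a \<in> dual M" "b \<in> dual M" "c \<in> dual M"
      using u w by (cases u; cases v; cases w) auto
    have const_dual: "fps_const a \<in> series_on (dual M)" if "a \<in> dual M" for a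
      using that by (simp add: mem_series_on)
    obtain X A where XA: "?P = (X, A)" "A \<in> series_on (dual M)"
      using P by (cases ?P) (auto simp: double_def)
    have A: "fps_nth (series_ext (pairing M) A (fps_const z)) k = pairing M (fps_nth A k) z"
      using XA(2) by (simp add: series_ext_const_right mem_series_on)
    have "double_form M (fps_nth (series_pair ?P) k) w = fps_nth (double_form (series_space M) ?P ?w) k"
      using XA uvw by (simp add: series_pair_nth double_form_def series_unpair_const pairing_series_const A)
    also have "\<dots> = fps_nth (S.trilinear_form m_h D_h ?u ?v ?w) k"
      using u w by (simp add: S.form_double_prod[OF md] double_series_const)
    also have "\<dots> = trilinear_form (coeff_prod k m_h) (coeff_cop k D_h) u v w"
      using uvw
      by (simp add: S.trilinear_form_def trilinear_form_def series_unpair_const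
          S.pairing_dual_op[OF S.linear_pair_cop[OF md], unfolded series_space_sel] const_dual pair2_series
          pairing_series_const
          pairing_dual_op[OF linear_pair_cop[OF mdk]] coeff_prod_def coeff_cop_def)
    also have "\<dots> = double_form M (double_prod M (coeff_prod k m_h) (coeff_cop k D_h) u v) w"
      using u w by (simp add: form_double_prod[OF mdk])
    finally show "double_form M (fps_nth (series_pair ?P) k) w
        = double_form M (double_prod M (coeff_prod k m_h) (coeff_cop k D_h) u v) w" .
  qed
qed

lemma series_pair_op_closed:
  assumes md: "framed_space.linear_pair (series_space M) m_h D_h" and u: "u \<in> double M" "v \<in> double M"
  shows "fps_nth (series_pair_op (double_prod (series_space M) m_h D_h) (fps_const u) (fps_const v)) k \<in> double M"
  using u by (simp add: double_prod_series_nth[OF md u] double_prod_closed[OF linear_pair_coeff[OF md]])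


section \<open>Deformations and quasiclassical limits, read off the coefficients\<close>

lemma asi_deformation_iff:
  "asi_deformation M m D m_h D_h \<longleftrightarrow> asi_bialgebra M m D \<and> asi_bialgebra (series_space M) m_h D_h \<and>
     coeff_prod 0 m_h = m \<and> coeff_cop 0 D_h = D"
  by (auto simp: asi_deformation_def cong_h_const_iff V.module_axioms V2.module_axioms
      coeff_prod_def coeff_cop_def fun_eq_iff)

text \<open>Commutativity and cocommutativity at \<open>h = 0\<close> make the commutator and cocommutator divisible by \<open>h\<close>; the
quotient at \<open>h = 0\<close> is then their coefficient of \<open>h\<close>.\<close>
lemma asi_qcl_iff:
  assumes "commutative_on UNIV (coeff_prod 0 m_h)" "cocommutative M (coeff_cop 0 D_h)"
  shows "asi_qcl M m_h D_h br d \<longleftrightarrow>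
    br = commutator (coeff_prod 1 m_h) \<and> d = cocommutator (coeff_cop 1 D_h)"
  using assms
  by (auto simp: asi_qcl_def qcl_bracket_def cong_quot_h_const_iff V.module_axioms V2.module_axioms
      V.subspace_UNIV V2.subspace_UNIV commutator_def cocommutator_def flip_series
      coeff_prod_def coeff_cop_def fun_eq_iff commutative_on_def cocommutative_def)

text \<open>The congruence modulo \<open>h\<close> of the products on the double says that \<open>(coeff_prod 0 m_h, coeff_cop 0 D_h)\<close>
and \<open>(m, D)\<close> have the same double, hence are equal.\<close>
lemma assoc_manin_deformation_iff:
  assumes md: "linear_pair m D" and mdh: "framed_space.linear_pair (series_space M) m_h D_h"
  shows "assoc_manin_deformation M (double_prod M m D) (double_prod (series_space M) m_h D_h) \<longleftrightarrow>
    asi_deformation M m D m_h D_h"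
proof -
  interpret S: framed_space "series_space M" I "\<lambda>i. fps_const (e i)" "\<lambda>i. fps_const (\<epsilon> i)"
    "\<lambda>p. coeffwise (\<chi> p)" "\<lambda>p. coeffwise (\<chi>21 p)" "\<lambda>p. coeffwise (\<chi>12 p)"
    by (rule framed_space_series)
  let ?p = "double_prod M m D" and ?ph = "double_prod (series_space M) m_h D_h"
  have cong: "(\<forall>u\<in>double M. \<forall>v\<in>double M. cong_h (double_smul M) (double M)
      (series_pair_op ?ph (fps_const u) (fps_const v)) (fps_const (?p u v))) \<longleftrightarrow>
      coeff_prod 0 m_h = m \<and> coeff_cop 0 D_h = D"
  proof -
    have "cong_h (double_smul M) (double M)
      (series_pair_op ?ph (fps_const u) (fps_const v)) (fps_const (?p u v)) \<longleftrightarrow>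
      double_prod M (coeff_prod 0 m_h) (coeff_cop 0 D_h) u v = ?p u v" if "u \<in> double M" "v \<in> double M" for u v
      using that series_pair_op_closed[OF mdh that]
      by (simp add: cong_h_const_iff[OF module_double] double_prod_series_nth[OF mdh that])
    then show ?thesis
      using linear_pair_eqI[OF linear_pair_coeff[OF mdh] md, of 0] by metis
  qed
  have series: "assoc_algebra_on (series_ext (double_smul M)) (series_on (double M)) (series_pair_op ?ph)"
    if "asi_bialgebra (series_space M) m_h D_h"
    using that assoc_algebra_series_pair[OF module_double subspaces_double(1)]
    by (simp add: S.asi_bialgebra_iff_assoc[OF mdh])
  show ?thesis
    unfolding assoc_manin_deformation_def assoc_deformation_def cong asi_deformation_iff
      assoc_manin_triple_iff[OF md] S.assoc_manin_triple_iff[OF mdh]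
    using series asi_bialgebra_iff_assoc[OF md] by blast
qed

lemma manin_qcl_iff:
  assumes mdh: "framed_space.linear_pair (series_space M) m_h D_h"
    and c: "commutative_on UNIV (coeff_prod 0 m_h)" "cocommutative M (coeff_cop 0 D_h)"
  shows "manin_qcl M (double_prod (series_space M) m_h D_h) lbr \<longleftrightarrow>
    (\<forall>u\<in>double M. \<forall>v\<in>double M. lbr u v =
       double_prod M (commutator (coeff_prod 1 m_h)) (cocommutator (coeff_cop 1 D_h)) u v)"
proof -
  let ?ph = "series_pair_op (double_prod (series_space M) m_h D_h)"
  have "commutative_on (double M) (double_prod M (coeff_prod 0 m_h) (coeff_cop 0 D_h))"
    using c by (simp add: commutative_double_iff[OF linear_pair_coeff[OF mdh]])
  then have "cong_quot_h (double_smul M) (double M) (fps_const (lbr u v))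
      (?ph (fps_const u) (fps_const v) - ?ph (fps_const v) (fps_const u)) \<longleftrightarrow>
    lbr u v = double_prod M (commutator (coeff_prod 1 m_h)) (cocommutator (coeff_cop 1 D_h)) u v"
    if "u \<in> double M" "v \<in> double M" for u v
    using that double_prod_commutator[OF linear_pair_coeff[OF mdh] that, of 1]
    by (auto simp: cong_quot_h_const_iff[OF module_double subspaces_double(1)] series_pair_op_closed[OF mdh]
        double_prod_series_nth[OF mdh] double_prod_closed[OF linear_pair_coeff[OF mdh]] commutative_on_def)
  then show ?thesis by (simp add: manin_qcl_def qcl_bracket_def)
qed

text \<open>The bracket \<open>lbr\<close> is fixed only on \<open>double M\<close>, so the statement is made for every operation agreeing
there with the double of the quasiclassical limit; this serves \<open>double_bracket M br d\<close> and an arbitrary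
quasiclassical limit alike.\<close>
lemma qcl_poisson_corresponds:
  assumes md: "linear_pair m D" and mdh: "framed_space.linear_pair (series_space M) m_h D_h"
    and asi: "comm_cocomm_asi_bialgebra M m D" and def: "asi_deformation M m D m_h D_h"
    and br: "br = commutator (coeff_prod 1 m_h)" and d: "d = cocommutator (coeff_cop 1 D_h)"
    and lbr: "\<And>u v. u \<in> double M \<Longrightarrow> v \<in> double M \<Longrightarrow> lbr u v = double_prod M br d u v"
  shows "poisson_corresponds M br m d D lbr (double_prod M m D)"
proof -
  let ?p = "double_prod M m D" and ?l = "double_prod M br d"
  have bd: "linear_pair br d"
    unfolding br d by (intro linear_pair_commutator linear_pair_coeff mdh)
  have anti: "\<And>x y. br x y = - br y x" "\<And>x. d x = - flip M (d x)"
    unfolding br d by (rule commutator_antisym)+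
  have c: "commutative_on UNIV (coeff_prod 0 m_h)" "cocommutative M (coeff_cop 0 D_h)"
    using def asi by (auto simp: asi_deformation_iff comm_cocomm_asi_bialgebra_def)
  have "qcl_bracket (double_smul M) (double M) (series_pair_op (double_prod (series_space M) m_h D_h)) f"
    if "\<And>u v. u \<in> double M \<Longrightarrow> v \<in> double M \<Longrightarrow> f u v = ?l u v" for f
    using manin_qcl_iff[OF mdh c, of f] that by (simp add: manin_qcl_def br d)
  moreover have "assoc_deformation (double_smul M) (double M) ?p (series_pair_op (double_prod (series_space M) m_h D_h))"
    using def assoc_manin_deformation_iff[OF md mdh] by (simp add: assoc_manin_deformation_def)
  moreover have "commutative_on (double M) ?p"
    using asi by (simp add: commutative_double_iff[OF md] comm_cocomm_asi_bialgebra_def)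
  ultimately have poisson: "poisson_algebra_on (double_smul M) (double M) f ?p"
    if "\<And>u v. u \<in> double M \<Longrightarrow> v \<in> double M \<Longrightarrow> f u v = ?l u v" for f
    using that qcl_poisson by blast
  have bialg: "poisson_bialgebra M br m d D"
    by (rule poisson_bialgebra_of_double[OF md bd anti asi poisson]) simp
  have sub: "subalgebra_on (double_smul M) (double M) lbr S" if "S \<in> {UNIV \<times> {0}, {0} \<times> dual M}" for S
    using double_prod_subalgebras[OF bd that] unfolding subalgebra_on_def by (metis lbr subsetD)
  have "invariant_on (double M) (double_form M) lbr"
    using double_prod_invariant[OF bd] by (simp add: invariant_on_def lbr double_prod_closed[OF bd])
  then have "poisson_manin_triple M lbr ?p"
    unfolding poisson_manin_triple_def
    using poisson[of lbr] lbr sub double_prod_subalgebras[OF md] double_prod_invariant[OF md] by blast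
  then show ?thesis
    using bialg lbr double_bracket_eq[OF bd anti] by (simp add: poisson_corresponds_def)
qed

text \<open>The Poisson bialgebra is recovered from its double, which identifies every bialgebra corresponding to
the limit triple with the quasiclassical limit.\<close>
lemma poisson_corresponds_unique:
  assumes bd: "linear_pair br d" and lbr: "\<And>u v. u \<in> double M \<Longrightarrow> v \<in> double M \<Longrightarrow> lbr u v = double_prod M br d u v"
    and cor: "poisson_corresponds M br' m d' D lbr p"
  shows "br' = br" "d' = d"
proof -
  have lie: "lie_algebra_on (smul M) UNIV br'" and co: "lie_coalgebra M d'"
    and eq: "\<And>u v. u \<in> double M \<Longrightarrow> v \<in> double M \<Longrightarrow> lbr u v = double_bracket M br' d' u v"
    using cor by (auto simp: poisson_corresponds_def poisson_bialgebra_def lie_bialgebra_def)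
  have b: "br' x x = 0" "br' (x + y) z = br' x z + br' y z" "br' z (x + y) = br' z x + br' z y"
    "br' (smul M c x) y = smul M c (br' x y)" "br' x (smul M c y) = smul M c (br' x y)" for x y z c
    using lie by (simp_all add: lie_algebra_on_def bilinear_op_on_def)
  have anti: "br' x y = - br' y x" for x y
    using b(1)[of "x + y"] unfolding b(2,3) by (simp add: b(1) eq_neg_iff_add_eq_0 add.commute)
  have bd': "linear_pair br' d'"
    using co by (simp add: linear_pair_def bilinear_map_def module_hom_iff V.module_axioms b lie_coalgebra_def)
  have "double_prod M br' d' u v = double_prod M br d u v" if "u \<in> double M" "v \<in> double M" for u v
    using double_bracket_eq[OF bd' anti _ that] co eq[OF that] lbr[OF that] by (simp add: lie_coalgebra_def)
  then show "br' = br" "d' = d" using linear_pair_eqI[OF bd' bd] by blast+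
qed

end


section \<open>The correspondence of quasiclassical limits\<close>

theorem theorem4p11:
  fixes M :: "('k::field_char_0, 'a::ab_group_add, 'a \<Rightarrow> 'k, 't::ab_group_add, 'w::ab_group_add) space"
    and m :: "'a \<Rightarrow> 'a \<Rightarrow> 'a" and D :: "'a \<Rightarrow> 't"
    and m_h :: "'a fps \<Rightarrow> 'a fps \<Rightarrow> 'a fps" and D_h :: "'a fps \<Rightarrow> 't fps"
  assumes "fin_dim_space M"
    and "bilinear_map (smul M) (smul M) (smul M) m"
    and "module_hom (smul M) (smul2 M) D"
    and "bilinear_map (smul (series_space M)) (smul (series_space M)) (smul (series_space M)) m_h"
    and "module_hom (smul (series_space M)) (smul2 (series_space M)) D_h"
  shows
    "(\<forall>br d.
        comm_cocomm_asi_bialgebra M m D \<and>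
        asi_deformation M m D m_h D_h \<and>
        asi_qcl M m_h D_h br d \<longrightarrow>
          comm_assoc_manin_triple M (double_prod M m D) \<and>
          assoc_manin_deformation M (double_prod M m D) (double_prod (series_space M) m_h D_h) \<and>
          poisson_corresponds M br m d D (double_bracket M br d) (double_prod M m D) \<and>
          manin_qcl M (double_prod (series_space M) m_h D_h) (double_bracket M br d))
     \<and>
     (\<forall>lbr.
        comm_assoc_manin_triple M (double_prod M m D) \<and>
        assoc_manin_deformation M (double_prod M m D) (double_prod (series_space M) m_h D_h) \<and>
        manin_qcl M (double_prod (series_space M) m_h D_h) lbr \<longrightarrow>
          comm_cocomm_asi_bialgebra M m D \<and>
          asi_deformation M m D m_h D_h \<and>
          (\<exists>br d. poisson_corresponds M br m d D lbr (double_prod M m D)) \<and>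
          (\<forall>br d. poisson_corresponds M br m d D lbr (double_prod M m D) \<longrightarrow>
             asi_qcl M m_h D_h br d))"
proof -
  obtain B \<epsilon> \<chi> \<chi>21 \<chi>12 where "framed_space M B (\<lambda>b. b) \<epsilon> \<chi> \<chi>21 \<chi>12"
    using fin_dim_framed[OF assms(1)] by blast
  then interpret framed_space M B "\<lambda>b. b" \<epsilon> \<chi> \<chi>21 \<chi>12 .
  interpret S: framed_space "series_space M" B "\<lambda>i. fps_const i" "\<lambda>i. fps_const (\<epsilon> i)"
    "\<lambda>p. coeffwise (\<chi> p)" "\<lambda>p. coeffwise (\<chi>21 p)" "\<lambda>p. coeffwise (\<chi>12 p)"
    by (rule framed_space_series)
  have md: "linear_pair m D" using assms by (simp add: linear_pair_def)
  have mdh: "S.linear_pair m_h D_h" using assms by (simp add: S.linear_pair_def)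
  let ?br = "commutator (coeff_prod 1 m_h)" and ?d = "cocommutator (coeff_cop 1 D_h)"
  have bd: "linear_pair ?br ?d"
    by (intro linear_pair_commutator linear_pair_coeff mdh)
  have anti: "?br x y = - ?br y x" "?d x = - flip M (?d x)" for x y
    by (rule commutator_antisym)+
  have comm: "commutative_on UNIV (coeff_prod 0 m_h)" "cocommutative M (coeff_cop 0 D_h)"
    if "comm_cocomm_asi_bialgebra M m D" "asi_deformation M m D m_h D_h"
    using that by (auto simp: asi_deformation_iff comm_cocomm_asi_bialgebra_def)
  show ?thesis
    unfolding comm_assoc_manin_triple_iff[OF md] assoc_manin_deformation_iff[OF md mdh]
  proof (intro conjI allI impI; elim conjE)
    fix br d
    assume asi: "comm_cocomm_asi_bialgebra M m D" and def: "asi_deformation M m D m_h D_h"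
      and qcl: "asi_qcl M m_h D_h br d"
    have brd: "br = ?br" "d = ?d" using qcl asi_qcl_iff[OF comm[OF asi def]] by auto
    show "comm_cocomm_asi_bialgebra M m D" "asi_deformation M m D m_h D_h" by fact+
    have l: "double_bracket M br d u v = double_prod M br d u v" if "u \<in> double M" "v \<in> double M" for u v
      unfolding brd by (rule double_bracket_eq[OF bd anti that])
    show "poisson_corresponds M br m d D (double_bracket M br d) (double_prod M m D)"
      by (rule qcl_poisson_corresponds[OF md mdh asi def brd l])
    show "manin_qcl M (double_prod (series_space M) m_h D_h) (double_bracket M br d)"
      using l by (simp add: manin_qcl_iff[OF mdh comm[OF asi def]] brd)
  next
    fix lbr
    assume asi: "comm_cocomm_asi_bialgebra M m D" and def: "asi_deformation M m D m_h D_h"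
      and qcl: "manin_qcl M (double_prod (series_space M) m_h D_h) lbr"
    have l: "lbr u v = double_prod M ?br ?d u v" if "u \<in> double M" "v \<in> double M" for u v
      using qcl that by (simp add: manin_qcl_iff[OF mdh comm[OF asi def]])
    show "comm_cocomm_asi_bialgebra M m D" "asi_deformation M m D m_h D_h" by fact+
    show "\<exists>br d. poisson_corresponds M br m d D lbr (double_prod M m D)"
      using qcl_poisson_corresponds[OF md mdh asi def refl refl l] by blast
    fix br d assume "poisson_corresponds M br m d D lbr (double_prod M m D)"
    then have "br = ?br" "d = ?d" using poisson_corresponds_unique[OF bd l] by auto
    then show "asi_qcl M m_h D_h br d" by (simp add: asi_qcl_iff[OF comm[OF asi def]])
  qed
qed

end
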